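(* Let $X$ be a compact complex manifold, $L$ a vector bundle on $X$ and $(E,L,\theta)$ a Hitchin pair on $X$ with $\mathrm{rk}\,E=r$. Let $g^k_\infty=\{g^k_n\}_{n\ge1}$, $k=1,\dots,r$, be the sequences of maps defined in the context. Then $h=(g^1_\infty,\dots,g^r_\infty)$, with components $$h_n=(g^1_n,\dots,g^r_n):\ \textstyle\bigodot^n(M[1])\longrightarrow\bigoplus_{k=1}^rA_X^{0,*}(\bigodot^kL),\qquad n\ge1,$$ is an $L_\infty$-morphism from the dgla $M=\bigoplus_{p+q=*}A_X^{0,p}(\mathcal{E}nd(E)\otimes\bigwedge^qL)$ to the abelian dgla $\bigoplus_{k=1}^rA_X^{0,*}(\bigodot^kL)[-1]$.
   Context: **Hitchin pairs.** A Hitchin pair $(E,L,\theta)$ on $X$ consists of holomorphic vector bundles $E$, $L$ on $X$ and $\theta\in H^0(X,\mathcal{E}nd(E)\otimes L)$ with $\theta\wedge\theta=0$ in $H^0(X,\mathcal{E}nd(E)\otimes(L\wedge L))$. **The dgla $M$.** $A_X^{0,p}(\mathcal F)$ is the space of global smooth $(0,p)$-forms with values in $\mathcal F$. On $\mathcal{E}nd(E)\otimes\bigwedge^*L$, graded by the degree in $\bigwedge^*L$, take $[\phi\otimes h,\psi\otimes l]=[\phi,\psi]\otimes h\wedge l$. On $M^n=\bigoplus_{p+q=n}A_X^{0,p}(\mathcal{E}nd(E)\otimes\bigwedge^qL)$ put $d(\omega\otimes f)=\bar\partial\omega\otimes f+(-1)^{\deg\omega}\omega\otimes[\theta,f]$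 and $[\omega\otimes f,\omega'\otimes f']=(-1)^{\deg\omega'\deg f}\omega\wedge\omega'\otimes[f,f']$ ($\omega,\omega'$ $(0,* )$-forms, $f,f'$ local holomorphic sections of $\mathcal{E}nd(E)\otimes\bigwedge^*L$). **The target.** $\bigoplus_kA_X^{0,*}(\bigodot^kL)[-1]$ (where $V[-1]^i=V^{i-1}$ and $\bigodot^kL$ is the $k$-th symmetric power) is a dgla with zero bracket and differential $\bar\partial$; thus its shift by $1$ is $\bigoplus_kA_X^{0,*}(\bigodot^kL)$. **$L_\infty$-structures.** For a graded vector space $V$, $\overline{S(V)}=\bigoplus_{n\ge1}\bigodot^nV$ is the reduced symmetric coalgebra (graded symmetric powers, with coproduct $\Delta(v_1\odot\cdots\odot v_n)=\sum_{k=1}^{n-1}\sum_{\sigma\in S(k,n-k)}\epsilon(\sigma)(v_{\sigma(1)}\odot\cdots\odot v_{\sigma(k)})\otimes(v_{\sigma(k+1)}\odot\cdots\odot v_{\sigma(n)})$, sum over shuffles, $\epsilon$ the Koszul sign). An $L_\infty$-structure on $V$ is a sequence of degree $1$ maps $q_k:\bigodot^kV[1]\to V[1]$, $k\ge1$, whose induced coderivation $Q$ on $\overline{S(V[1])}$, $$Q(v_1\odot\cdots\odot v_n)=\sum_{k=1}^n\sum_{\sigma\in S(k,n-k)}\epsilon(\sigma)\,q_k(v_{\sigma(1)}\odot\cdots\odot v_{\sigma(k)})\odot v_{\sigma(k+1)}\odot\cdots\odot v_{\sigma(n)},$$ satisfies $Q\circ Q=0$. A dgla is an $L_\infty$-algebra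 with $q_1(x)=-dx$, $q_2(x\odot y)=(-1)^{\deg x}[x,y]$ ($\deg x$ the degree in the dgla) and $q_k=0$ for $k\ge3$. An $L_\infty$-morphism $(V,q_i)\to(W,\hat q_i)$ is a sequence of degree $0$ maps $f_k:\bigodot^kV[1]\to W[1]$, $k\ge1$, such that the induced coalgebra morphism $F:\overline{S(V[1])}\to\overline{S(W[1])}$ satisfies $F\circ Q=\hat Q\circ F$. **The maps $g^k_n$.** For $n\ge1$, $k\in\{1,\dots,r\}$, $g^k_n:\bigodot^n(M[1])\to A^{0,*}_X(\bigodot^kL)$ is defined on $\bigodot^n\bigl(A_X^{0,*}(\mathcal{E}nd(E)\otimes L)\bigr)$ by $$g^k_n((\omega_1\otimes f_1)\odot\cdots\odot(\omega_n\otimes f_n))=\omega_1\wedge\cdots\wedge\omega_n\otimes\overline{g^k_n}(f_1\odot\cdots\odot f_n),$$ where $\overline{g^k_n}(f_1\odot\cdots\odot f_n)$ is the coefficient of $t_1\cdots t_n$ in $\mathrm{Tr}\bigl((\theta+t_1f_1+\cdots+t_nf_n)^k\bigr)$ (powers taken in the associative algebra $\mathcal{E}nd(E)\otimes\bigodot^*L$), and $g^k_n$ is zero whenever one of the arguments lies in $A_X^{0,p}(\mathcal{E}nd(E)\otimes\bigwedge^qL)$ with $q\ne1$. *)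

theory Defs
  imports "HOL-Analysis.Analysis" "HOL-Library.Function_Algebras" "HOL-Library.Poly_Mapping"
begin

section \<open>Complex vector spaces\<close>

class cvs = ab_group_add +
  fixes scaleC :: "complex \<Rightarrow> 'a \<Rightarrow> 'a"  (infixr "*\<^sub>C" 75)
  assumes scaleC_add_right: "a *\<^sub>C (x + y) = a *\<^sub>C x + a *\<^sub>C y"
    and scaleC_add_left: "(a + b) *\<^sub>C x = a *\<^sub>C x + b *\<^sub>C x"
    and scaleC_scaleC: "a *\<^sub>C (b *\<^sub>C x) = (a * b) *\<^sub>C x"
    and scaleC_one: "1 *\<^sub>C x = x"

global_interpretation cvs: vector_space "scaleC :: complex \<Rightarrow> 'a::cvs \<Rightarrow> 'a"
  by unfold_locales (rule scaleC_add_right scaleC_add_left scaleC_scaleC scaleC_one)+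

instantiation complex :: cvs
begin
definition "a *\<^sub>C (x::complex) = a * x"
instance by standard (simp_all add: scaleC_complex_def algebra_simps)
end

instantiation vec :: (cvs, finite) cvs
begin
definition "a *\<^sub>C (x::'a^'b) = (\<chi> i. a *\<^sub>C (x $ i))"
instance by standard
  (simp_all add: scaleC_vec_def vec_eq_iff scaleC_add_right scaleC_add_left scaleC_scaleC scaleC_one)
end

instantiation "fun" :: (type, cvs) cvs
begin
definition "a *\<^sub>C (f::'a \<Rightarrow> 'b) = (\<lambda>x. a *\<^sub>C f x)"
instance by standard
  (simp_all add: scaleC_fun_def fun_eq_iff scaleC_add_right scaleC_add_left scaleC_scaleC scaleC_one)
end

instantiation poly_mapping :: (type, cvs) cvs
begin
definition "a *\<^sub>C (p::'a \<Rightarrow>\<^sub>0 'b) = Poly_Mapping.map (scaleC a) p"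
instance
proof
  have lk: "Poly_Mapping.lookup (a *\<^sub>C p) k = a *\<^sub>C Poly_Mapping.lookup p k"
    for a and p :: "'a \<Rightarrow>\<^sub>0 'b" and k
    by (simp add: scaleC_poly_mapping_def map.rep_eq when_def cvs.scale_zero_right)
  fix a b :: complex and x y :: "'a \<Rightarrow>\<^sub>0 'b"
  show "a *\<^sub>C (x + y) = a *\<^sub>C x + a *\<^sub>C y"
    by (rule poly_mapping_eqI) (simp add: lk lookup_add scaleC_add_right)
  show "(a + b) *\<^sub>C x = a *\<^sub>C x + b *\<^sub>C x"
    by (rule poly_mapping_eqI) (simp add: lk lookup_add scaleC_add_left)
  show "a *\<^sub>C (b *\<^sub>C x) = (a * b) *\<^sub>C x"
    by (rule poly_mapping_eqI) (simp add: lk scaleC_scaleC)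
  show "1 *\<^sub>C x = x"
    by (rule poly_mapping_eqI) (simp add: lk scaleC_one)
qed
end


section \<open>Graded symmetric coalgebras and \<open>L\<^sub>\<infinity>\<close>-morphisms\<close>

text \<open>A graded space is given by its homogeneous components. A homogeneous element is recorded
  together with its degree, and the word \<open>[(d\<^sub>1,v\<^sub>1),\<dots>,(d\<^sub>n,v\<^sub>n)]\<close> stands for the monomial
  \<open>v\<^sub>1 \<odot> \<dots> \<odot> v\<^sub>n\<close> (or for the argument of a map on \<open>\<Odot>\<^sup>n V\<close>).\<close>

type_synonym 'v graded = "int \<Rightarrow> 'v set"
type_synonym 'v word = "(int \<times> 'v) list"

definition shift :: "'v graded \<Rightarrow> int \<Rightarrow> 'v graded"  \<comment> \<open>\<open>V[k]\<close>\<close>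
  where "shift V k = (\<lambda>i. V (i + k))"

definition words :: "'v graded \<Rightarrow> 'v word set"
  where "words V = {w. w \<noteq> [] \<and> (\<forall>(d, v)\<in>set w. v \<in> V d)}"

definition wdeg :: "'v word \<Rightarrow> int"
  where "wdeg w = sum_list (map fst w)"

text \<open>The reduced symmetric coalgebra of \<open>V\<close> is the quotient of the space \<open>sym_pre V\<close> of formal linear
  combinations of words by the subspace \<open>sym_rel V\<close> generated by multilinearity and graded
  commutativity.\<close>

definition sym_pre :: "'v graded \<Rightarrow> ('v word \<Rightarrow>\<^sub>0 complex) set"
  where "sym_pre V = {x. Poly_Mapping.keys x \<subseteq> words V}"

abbreviation mono1 :: "'v word \<Rightarrow> ('v word \<Rightarrow>\<^sub>0 complex)"
  where "mono1 w \<equiv> Poly_Mapping.single w 1"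

definition sym_rel :: "'v::cvs graded \<Rightarrow> ('v word \<Rightarrow>\<^sub>0 complex) set"
  where "sym_rel V = cvs.span
    ({mono1 (u @ (d, a *\<^sub>C x + b *\<^sub>C y) # w) - a *\<^sub>C mono1 (u @ (d, x) # w) - b *\<^sub>C mono1 (u @ (d, y) # w)
        | u w d a b x y. u @ (d, x) # w \<in> words V \<and> y \<in> V d} \<union>
     {mono1 (u @ (d, x) # (e, y) # w) - ((-1) powi (d * e)) *\<^sub>C mono1 (u @ (e, y) # (d, x) # w)
        | u w d e x y. u @ (d, x) # (e, y) # w \<in> words V})"

definition lin_ext :: "('a \<Rightarrow> 'b::cvs) \<Rightarrow> ('a \<Rightarrow>\<^sub>0 complex) \<Rightarrow> 'b"
  where "lin_ext \<phi> x = (\<Sum>w\<in>Poly_Mapping.keys x. Poly_Mapping.lookup x w *\<^sub>C \<phi> w)"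

text \<open>A family of linear maps \<open>f\<^sub>n : \<Odot>\<^sup>n V \<rightarrow> W\<close>, \<open>n \<ge> 1\<close>, of degree \<open>k\<close>. The index \<open>n\<close> is the length of
  the argument.\<close>

definition sym_maps :: "'v::cvs graded \<Rightarrow> 'w::cvs graded \<Rightarrow> int \<Rightarrow> ('v word \<Rightarrow> 'w) \<Rightarrow> bool"
  where "sym_maps V W k f \<longleftrightarrow>
    (\<forall>w\<in>words V. f w \<in> W (wdeg w + k)) \<and>
    (\<forall>u w d x y a b. u @ (d, x) # w \<in> words V \<longrightarrow> y \<in> V d \<longrightarrow>
       f (u @ (d, a *\<^sub>C x + b *\<^sub>C y) # w) = a *\<^sub>C f (u @ (d, x) # w) + b *\<^sub>C f (u @ (d, y) # w)) \<and>
    (\<forall>u w d e x y. u @ (d, x) # (e, y) # w \<in> words V \<longrightarrow>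
       f (u @ (d, x) # (e, y) # w) = ((-1) powi (d * e)) *\<^sub>C f (u @ (e, y) # (d, x) # w))"

text \<open>An unshuffle of positions \<open>0,\<dots>,n-1\<close> into consecutive blocks is encoded by the map \<open>b\<close> sending a
  position to the number of its block: positions are listed block by block, in increasing order
  inside each block. Its Koszul sign, for positions carrying degrees \<open>d\<close>, is the product over
  inversions. Two blocks, \<open>S\<close> followed by its complement, give the \<open>(card S, n - card S)\<close>-shuffles.\<close>

definition koszul :: "(nat \<Rightarrow> int) \<Rightarrow> nat \<Rightarrow> (nat \<Rightarrow> nat) \<Rightarrow> complex"
  where "koszul d n b = (\<Prod>(i, j)\<in>{(i, j). i < j \<and> j < n \<and> b j < b i}. (-1) powi (d i * d j))"

definition koszul2 :: "(nat \<Rightarrow> int) \<Rightarrow> nat \<Rightarrow> nat set \<Rightarrow> complex"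
  where "koszul2 d n S = koszul d n (\<lambda>i. if i \<in> S then 0 else 1)"

definition coderivation :: "('v word \<Rightarrow> 'v) \<Rightarrow> 'v word \<Rightarrow> ('v word \<Rightarrow>\<^sub>0 complex)"
  where "coderivation q w =
    (\<Sum>S\<in>{S. S \<subseteq> {..<length w} \<and> S \<noteq> {}}.
       koszul2 (\<lambda>i. fst (w ! i)) (length w) S *\<^sub>C
       mono1 ((wdeg (nths w S) + 1, q (nths w S)) # nths w (- S)))"

text \<open>The unique coalgebra morphism with corestriction \<open>f\<close>:
  \<open>F(v\<^sub>1 \<odot> \<dots> \<odot> v\<^sub>n) = \<Sum>\<^sub>s (1/s!) \<Sum> \<epsilon>(\<sigma>) f(v\<^sub>\<sigma>\<^sub>(\<^sub>1\<^sub>) \<odot> \<dots>) \<odot> \<dots> \<odot> f(\<dots> \<odot> v\<^sub>\<sigma>\<^sub>(\<^sub>n\<^sub>))\<close>, the inner sum being over all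
  unshuffles into \<open>s\<close> nonempty blocks.\<close>

definition coalg_morphism :: "('v word \<Rightarrow> 'w) \<Rightarrow> 'v word \<Rightarrow> ('w word \<Rightarrow>\<^sub>0 complex)"
  where "coalg_morphism f w =
    (\<Sum>s=1..length w. \<Sum>b\<in>{b \<in> {..<length w} \<rightarrow>\<^sub>E {..<s}. b ` {..<length w} = {..<s}}.
       (koszul (\<lambda>i. fst (w ! i)) (length w) b / fact s) *\<^sub>C
       mono1 (map (\<lambda>a. (wdeg (nths w {i. b i = a}), f (nths w {i. b i = a}))) [0..<s]))"

definition Linfty_morphism ::
    "'v::cvs graded \<Rightarrow> ('v word \<Rightarrow> 'v) \<Rightarrow> 'w::cvs graded \<Rightarrow> ('w word \<Rightarrow> 'w) \<Rightarrow> ('v word \<Rightarrow> 'w) \<Rightarrow> bool"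
  where "Linfty_morphism V q W q' f \<longleftrightarrow>
    sym_maps (shift V 1) (shift W 1) 0 f \<and>
    (\<forall>x\<in>sym_pre (shift V 1).
       lin_ext (coalg_morphism f) (lin_ext (coderivation q) x)
       - lin_ext (coderivation q') (lin_ext (coalg_morphism f) x) \<in> sym_rel (shift W 1))"

text \<open>The degrees recorded in the words are those of \<open>V[1]\<close>, hence \<open>e + 1\<close> is the degree in the dgla.\<close>

fun Linfty_of_dgla :: "('v \<Rightarrow> 'v) \<Rightarrow> ('v \<Rightarrow> 'v \<Rightarrow> 'v) \<Rightarrow> 'v::cvs word \<Rightarrow> 'v"
  where
    "Linfty_of_dgla d br [(e, x)] = - d x"
  | "Linfty_of_dgla d br [(e, x), (e', y)] = ((-1) powi (e + 1)) *\<^sub>C br x y"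
  | "Linfty_of_dgla d br _ = 0"


section \<open>Compact complex manifolds and holomorphic vector bundles\<close>

fun Ck_on :: "nat \<Rightarrow> 'a::real_normed_vector set \<Rightarrow> ('a \<Rightarrow> 'b::real_normed_vector) \<Rightarrow> bool"
  where
    "Ck_on 0 S f \<longleftrightarrow> continuous_on S f"
  | "Ck_on (Suc k) S f \<longleftrightarrow> (\<forall>z\<in>S. f differentiable at z) \<and>
       (\<forall>v. Ck_on k S (\<lambda>z. frechet_derivative f (at z) v))"

definition smooth_on :: "'a::real_normed_vector set \<Rightarrow> ('a \<Rightarrow> 'b::real_normed_vector) \<Rightarrow> bool"
  where "smooth_on S f \<longleftrightarrow> (\<forall>k. Ck_on k S f)"

text \<open>Holomorphic functions of several variables (on open sets): smooth functions satisfying the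
  Cauchy-Riemann equations, i.e. with complex linear derivative.\<close>

definition hol_on :: "'a::{real_normed_vector,cvs} set \<Rightarrow> ('a \<Rightarrow> 'b::{real_normed_vector,cvs}) \<Rightarrow> bool"
  where "hol_on S f \<longleftrightarrow> smooth_on S f \<and>
    (\<forall>z\<in>S. \<forall>c v. frechet_derivative f (at z) (c *\<^sub>C v) = c *\<^sub>C frechet_derivative f (at z) v)"

text \<open>The points of the manifold are the elements of the type \<open>'x\<close>, its dimension is \<open>CARD('m)\<close>.\<close>

record ('x, 'c, 'm) atlas =
  charts :: "'c set"
  cdom :: "'c \<Rightarrow> 'x set"
  chart :: "'c \<Rightarrow> 'x \<Rightarrow> complex^'m"

definition pchart :: "('x, 'c, 'm::finite) atlas \<Rightarrow> 'c \<Rightarrow> complex^'m \<Rightarrow> 'x"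
  where "pchart X c = inv_into (cdom X c) (chart X c)"

definition compact_complex_manifold :: "('x::t2_space, 'c, 'm::finite) atlas \<Rightarrow> bool"
  where "compact_complex_manifold X \<longleftrightarrow>
    compact (UNIV :: 'x set) \<and>
    (\<Union>c\<in>charts X. cdom X c) = UNIV \<and>
    (\<forall>c\<in>charts X. open (cdom X c) \<and> open (chart X c ` cdom X c) \<and>
       homeomorphism (cdom X c) (chart X c ` cdom X c) (chart X c) (pchart X c)) \<and>
    (\<forall>c\<in>charts X. \<forall>c'\<in>charts X.
       hol_on (chart X c ` (cdom X c \<inter> cdom X c')) (\<lambda>z. chart X c' (pchart X c z)))"

text \<open>A holomorphic vector bundle of rank \<open>CARD('r)\<close>, given by the transition functions of a
  trivialising open cover: components of sections satisfy \<open>s\<^sub>i = transf i j \<cdot> s\<^sub>j\<close>. The cover need not be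
  related to the atlas.\<close>

record ('x, 'i, 'r) vbundle =
  trivs :: "'i set"
  tdom :: "'i \<Rightarrow> 'x set"
  transf :: "'i \<Rightarrow> 'i \<Rightarrow> 'x \<Rightarrow> complex^'r^'r"

definition holomorphic_bundle ::
    "('x::t2_space, 'c, 'm::finite) atlas \<Rightarrow> ('x, 'i, 'r::finite) vbundle \<Rightarrow> bool"
  where "holomorphic_bundle X E \<longleftrightarrow>
    (\<Union>i\<in>trivs E. tdom E i) = UNIV \<and>
    (\<forall>i\<in>trivs E. open (tdom E i)) \<and>
    (\<forall>i\<in>trivs E. \<forall>x\<in>tdom E i. transf E i i x = mat 1) \<and>
    (\<forall>i\<in>trivs E. \<forall>j\<in>trivs E. \<forall>k\<in>trivs E. \<forall>x\<in>tdom E i \<inter> tdom E j \<inter> tdom E k.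
       transf E i j x ** transf E j k x = transf E i k x) \<and>
    (\<forall>i\<in>trivs E. \<forall>j\<in>trivs E. \<forall>c\<in>charts X.
       hol_on (chart X c ` (cdom X c \<inter> tdom E i \<inter> tdom E j)) (\<lambda>z. transf E i j (pchart X c z)))"


section \<open>Forms with values in \<open>End(E) \<otimes> \<And>L\<close> and in \<open>Sym L\<close>\<close>

text \<open>Models of the fibres at a point \<open>x\<close>, in a chart and local frames:
  a \<open>(0,p)\<close>-form is an alternating map of \<open>p\<close> tangent vectors, antilinear in each of them;
  \<open>\<And>\<^sup>q L\<close> consists of the alternating multilinear maps of \<open>q\<close> vectors of \<open>L\<^sup>*\<close>, with
  \<open>(l\<^sub>1 \<and> \<dots> \<and> l\<^sub>q)(\<xi>\<^sub>1,\<dots>,\<xi>\<^sub>q) = det (\<xi>\<^sub>a(l\<^sub>b))\<close> (likewise for forms);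
  \<open>Sym\<^sup>k L\<close> consists of the homogeneous polynomial functions of degree \<open>k\<close> on \<open>L\<^sup>*\<close>, so that the product
  of the symmetric algebra is the pointwise product.
  Arguments \<open>vs\<close> are lists of tangent vectors, arguments \<open>ls\<close> are lists of elements of \<open>L\<^sup>*\<close>.
  A form on \<open>X\<close> is the family of its local expressions, indexed by a chart \<open>c\<close> and by trivialisations
  \<open>i\<close> of \<open>E\<close> and \<open>j\<close> of \<open>L\<close> (extended by \<open>0\<close>).\<close>

definition alt_multilinear :: "(complex \<Rightarrow> complex) \<Rightarrow> ('v::cvs list \<Rightarrow> 'w::cvs) \<Rightarrow> bool"
  where "alt_multilinear \<tau> f \<longleftrightarrow>
    (\<forall>us ws v w a b. f (us @ (a *\<^sub>C v + b *\<^sub>C w) # ws) = \<tau> a *\<^sub>C f (us @ v # ws) + \<tau> b *\<^sub>C f (us @ w # ws)) \<and>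
    (\<forall>vs. \<not> distinct vs \<longrightarrow> f vs = 0)"

definition hom_polys :: "nat \<Rightarrow> (complex^'s::finite \<Rightarrow> complex) set"
  where "hom_polys k = cvs.span {\<lambda>\<xi>. (\<Prod>l\<leftarrow>ls. \<Sum>a\<in>UNIV. \<xi> $ a * l $ a) | ls. length ls = k}"

definition jac :: "('x, 'c, 'm::finite) atlas \<Rightarrow> 'c \<Rightarrow> 'c \<Rightarrow> 'x \<Rightarrow> complex^'m \<Rightarrow> complex^'m"
  where "jac X c c' x = frechet_derivative (\<lambda>z. chart X c' (pchart X c z)) (at (chart X c x))"

definition dual_trans :: "('x, 'j, 's::finite) vbundle \<Rightarrow> 'j \<Rightarrow> 'j \<Rightarrow> 'x \<Rightarrow> complex^'s \<Rightarrow> complex^'s"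
  where "dual_trans L j j' x \<xi> = transpose (transf L j j' x) *v \<xi>"

type_synonym ('x, 'c, 'm, 'i, 'r, 'j, 's) End_form =
  "'c \<Rightarrow> 'i \<Rightarrow> 'j \<Rightarrow> 'x \<Rightarrow> (complex^'m) list \<Rightarrow> (complex^'s) list \<Rightarrow> complex^'r^'r"

type_synonym ('x, 'c, 'm, 'j, 's) Sym_form =
  "'c \<Rightarrow> 'j \<Rightarrow> 'x \<Rightarrow> (complex^'m) list \<Rightarrow> complex^'s \<Rightarrow> complex"

definition dom_EL :: "('x, 'c, 'm::finite) atlas \<Rightarrow> ('x, 'i, 'r::finite) vbundle \<Rightarrow> ('x, 'j, 's::finite) vbundle \<Rightarrow>
    'c \<Rightarrow> 'i \<Rightarrow> 'j \<Rightarrow> 'x set"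
  where "dom_EL X E L c i j =
    (if c \<in> charts X \<and> i \<in> trivs E \<and> j \<in> trivs L then cdom X c \<inter> tdom E i \<inter> tdom L j else {})"

definition dom_L :: "('x, 'c, 'm::finite) atlas \<Rightarrow> ('x, 'j, 's::finite) vbundle \<Rightarrow> 'c \<Rightarrow> 'j \<Rightarrow> 'x set"
  where "dom_L X L c j = (if c \<in> charts X \<and> j \<in> trivs L then cdom X c \<inter> tdom L j else {})"

definition A_End :: "('x, 'c, 'm::finite) atlas \<Rightarrow> ('x, 'i, 'r::finite) vbundle \<Rightarrow> ('x, 'j, 's::finite) vbundle \<Rightarrow>
    nat \<Rightarrow> nat \<Rightarrow> ('x, 'c, 'm, 'i, 'r, 'j, 's) End_form set"  \<comment> \<open>\<open>A\<^sup>0\<^sup>,\<^sup>p(End(E) \<otimes> \<And>\<^sup>q L)\<close>\<close>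
  where "A_End X E L p q = {\<alpha>.
    (\<forall>c i j x vs ls. x \<notin> dom_EL X E L c i j \<or> length vs \<noteq> p \<or> length ls \<noteq> q \<longrightarrow> \<alpha> c i j x vs ls = 0) \<and>
    (\<forall>c i j x ls. alt_multilinear cnj (\<lambda>vs. \<alpha> c i j x vs ls)) \<and>
    (\<forall>c i j x vs. alt_multilinear id (\<lambda>ls. \<alpha> c i j x vs ls)) \<and>
    (\<forall>c i j vs ls. smooth_on (chart X c ` dom_EL X E L c i j) (\<lambda>z. \<alpha> c i j (pchart X c z) vs ls)) \<and>
    (\<forall>c i j c' i' j'. \<forall>x\<in>dom_EL X E L c i j \<inter> dom_EL X E L c' i' j'. \<forall>vs ls.
       \<alpha> c i j x vs ls =
       transf E i i' x ** \<alpha> c' i' j' x (map (jac X c c' x) vs) (map (dual_trans L j j' x) ls) ** transf E i' i x)}"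

definition A_Sym :: "('x, 'c, 'm::finite) atlas \<Rightarrow> ('x, 'j, 's::finite) vbundle \<Rightarrow>
    nat \<Rightarrow> nat \<Rightarrow> ('x, 'c, 'm, 'j, 's) Sym_form set"  \<comment> \<open>\<open>A\<^sup>0\<^sup>,\<^sup>p(Sym\<^sup>k L)\<close>\<close>
  where "A_Sym X L p k = {\<beta>.
    (\<forall>c j x vs \<xi>. x \<notin> dom_L X L c j \<or> length vs \<noteq> p \<longrightarrow> \<beta> c j x vs \<xi> = 0) \<and>
    (\<forall>c j x \<xi>. alt_multilinear cnj (\<lambda>vs. \<beta> c j x vs \<xi>)) \<and>
    (\<forall>c j x vs. \<beta> c j x vs \<in> hom_polys k) \<and>
    (\<forall>c j vs \<xi>. smooth_on (chart X c ` dom_L X L c j) (\<lambda>z. \<beta> c j (pchart X c z) vs \<xi>)) \<and>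
    (\<forall>c j c' j'. \<forall>x\<in>dom_L X L c j \<inter> dom_L X L c' j'. \<forall>vs \<xi>.
       \<beta> c j x vs \<xi> = \<beta> c' j' x (map (jac X c c' x) vs) (dual_trans L j j' x \<xi>))}"

text \<open>The antilinear part of the derivative at \<open>z\<close>. On \<open>(0,p)\<close>-forms in a chart, the Dolbeault operator is
  the alternating sum of the \<open>dbar_dir\<close> of \<open>\<omega>(v\<^sub>0,\<dots>,v\<^sub>p)\<close> with \<open>v\<^sub>a\<close> omitted, in direction \<open>v\<^sub>a\<close>.\<close>

definition dbar_dir :: "('a::{real_normed_vector,cvs} \<Rightarrow> 'b::{real_normed_vector,cvs}) \<Rightarrow> 'a \<Rightarrow> 'a \<Rightarrow> 'b"
  where "dbar_dir f z v =
    (1/2) *\<^sub>C (frechet_derivative f (at z) v + \<i> *\<^sub>C frechet_derivative f (at z) (\<i> *\<^sub>C v))"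

definition dbar_End :: "('x, 'c, 'm::finite) atlas \<Rightarrow> ('x, 'i, 'r::finite) vbundle \<Rightarrow> ('x, 'j, 's::finite) vbundle \<Rightarrow>
    ('x, 'c, 'm, 'i, 'r, 'j, 's) End_form \<Rightarrow> ('x, 'c, 'm, 'i, 'r, 'j, 's) End_form"
  where "dbar_End X E L \<alpha> = (\<lambda>c i j x vs ls. if x \<in> dom_EL X E L c i j then
      (\<Sum>a<length vs. ((-1) ^ a) *\<^sub>C
         dbar_dir (\<lambda>z. \<alpha> c i j (pchart X c z) (take a vs @ drop (Suc a) vs) ls) (chart X c x) (vs ! a))
    else 0)"

definition dbar_Sym :: "('x, 'c, 'm::finite) atlas \<Rightarrow> ('x, 'j, 's::finite) vbundle \<Rightarrow>
    ('x, 'c, 'm, 'j, 's) Sym_form \<Rightarrow> ('x, 'c, 'm, 'j, 's) Sym_form"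
  where "dbar_Sym X L \<beta> = (\<lambda>c j x vs \<xi>. if x \<in> dom_L X L c j then
      (\<Sum>a<length vs. ((-1) ^ a) *\<^sub>C
         dbar_dir (\<lambda>z. \<beta> c j (pchart X c z) (take a vs @ drop (Suc a) vs) \<xi>) (chart X c x) (vs ! a))
    else 0)"

text \<open>For a bilinear operation \<open>\<mu>\<close> on matrices, the bilinear extension of
  \<open>(\<omega> \<otimes> \<phi> \<otimes> h, \<omega>' \<otimes> \<psi> \<otimes> l) \<mapsto> (-1)\<^bsup>deg \<omega>' deg h\<^esup> (\<omega> \<and> \<omega>') \<otimes> \<mu>(\<phi>,\<psi>) \<otimes> (h \<and> l)\<close>,
  both wedge products being written as sums over shuffles of the arguments.\<close>

definition form_prod :: "(complex^'r^'r \<Rightarrow> complex^'r^'r \<Rightarrow> complex^'r^'r) \<Rightarrow>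
    ('x, 'c, 'm::finite, 'i, 'r::finite, 'j, 's::finite) End_form \<Rightarrow>
    ('x, 'c, 'm, 'i, 'r, 'j, 's) End_form \<Rightarrow> ('x, 'c, 'm, 'i, 'r, 'j, 's) End_form"
  where "form_prod \<mu> \<alpha> \<beta> = (\<lambda>c i j x vs ls.
    \<Sum>A\<in>Pow {..<length vs}. \<Sum>B\<in>Pow {..<length ls}.
      (koszul2 (\<lambda>_. 1) (length vs) A * koszul2 (\<lambda>_. 1) (length ls) B *
        (-1) ^ (length (nths vs (- A)) * length (nths ls B))) *\<^sub>C
      \<mu> (\<alpha> c i j x (nths vs A) (nths ls B)) (\<beta> c i j x (nths vs (- A)) (nths ls (- B))))"

text \<open>On \<open>\<theta> \<in> H\<^sup>0(End(E) \<otimes> L)\<close>, the usual \<open>\<theta> \<and> \<theta>\<close>: composition in \<open>End(E)\<close>, wedge product in \<open>\<And>L\<close>.\<close>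

definition hitchin_pair :: "('x::t2_space, 'c, 'm::finite) atlas \<Rightarrow> ('x, 'i, 'r::finite) vbundle \<Rightarrow>
    ('x, 'j, 's::finite) vbundle \<Rightarrow> ('x, 'c, 'm, 'i, 'r, 'j, 's) End_form \<Rightarrow> bool"
  where "hitchin_pair X E L \<theta> \<longleftrightarrow>
    holomorphic_bundle X E \<and> holomorphic_bundle X L \<and>
    \<theta> \<in> A_End X E L 0 1 \<and>
    (\<forall>c i j \<xi>. hol_on (chart X c ` dom_EL X E L c i j) (\<lambda>z. \<theta> c i j (pchart X c z) [] [\<xi>])) \<and>
    form_prod (**) \<theta> \<theta> = 0"


section \<open>The two dglas and the maps between them\<close>

definition M_dgla :: "('x, 'c, 'm::finite) atlas \<Rightarrow> ('x, 'i, 'r::finite) vbundle \<Rightarrow> ('x, 'j, 's::finite) vbundle \<Rightarrow>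
    ('x, 'c, 'm, 'i, 'r, 'j, 's) End_form graded"
  where "M_dgla X E L n = (if n < 0 then {0} else
    {\<Sum>p\<le>nat n. \<alpha> p | \<alpha>. \<forall>p\<le>nat n. \<alpha> p \<in> A_End X E L p (nat n - p)})"

definition M_bracket :: "('x, 'c, 'm::finite, 'i, 'r::finite, 'j, 's::finite) End_form \<Rightarrow>
    ('x, 'c, 'm, 'i, 'r, 'j, 's) End_form \<Rightarrow> ('x, 'c, 'm, 'i, 'r, 'j, 's) End_form"
  where "M_bracket = form_prod (\<lambda>\<phi> \<psi>. \<phi> ** \<psi> - \<psi> ** \<phi>)"

text \<open>The term \<open>(-1)\<^bsup>deg \<omega>\<^esup> \<omega> \<otimes> [\<theta>,f]\<close> is \<open>[1 \<otimes> \<theta>, \<omega> \<otimes> f]\<close>.\<close>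

definition M_diff :: "('x, 'c, 'm::finite) atlas \<Rightarrow> ('x, 'i, 'r::finite) vbundle \<Rightarrow> ('x, 'j, 's::finite) vbundle \<Rightarrow>
    ('x, 'c, 'm, 'i, 'r, 'j, 's) End_form \<Rightarrow>
    ('x, 'c, 'm, 'i, 'r, 'j, 's) End_form \<Rightarrow> ('x, 'c, 'm, 'i, 'r, 'j, 's) End_form"
  where "M_diff X E L \<theta> \<alpha> = dbar_End X E L \<alpha> + M_bracket \<theta> \<alpha>"

text \<open>The graded space \<open>\<Oplus>\<^sub>k\<^sub>=\<^sub>1\<^sup>r A\<^sup>0\<^sup>,\<^sup>*(Sym\<^sup>k L)\<close>; elements are families indexed by \<open>k\<close>.\<close>

definition Sym_forms :: "nat \<Rightarrow> ('x, 'c, 'm::finite) atlas \<Rightarrow> ('x, 'j, 's::finite) vbundle \<Rightarrow>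
    (nat \<Rightarrow> ('x, 'c, 'm, 'j, 's) Sym_form) graded"
  where "Sym_forms r X L n = (if n < 0 then {0} else
    {\<beta>. \<forall>k. if k \<in> {1..r} then \<beta> k \<in> A_Sym X L (nat n) k else \<beta> k = 0})"

definition Sym_diff :: "('x, 'c, 'm::finite) atlas \<Rightarrow> ('x, 'j, 's::finite) vbundle \<Rightarrow>
    (nat \<Rightarrow> ('x, 'c, 'm, 'j, 's) Sym_form) \<Rightarrow> (nat \<Rightarrow> ('x, 'c, 'm, 'j, 's) Sym_form)"
  where "Sym_diff X L \<beta> = (\<lambda>k. dbar_Sym X L (\<beta> k))"

text \<open>The coefficient of \<open>t\<^sub>0 \<cdots> t\<^sub>n\<^sub>-\<^sub>1\<close> in \<open>Tr ((\<Theta> + t\<^sub>0 B\<^sub>0 + \<dots> + t\<^sub>n\<^sub>-\<^sub>1 B\<^sub>n\<^sub>-\<^sub>1)\<^sup>k)\<close>, computed in matrices over the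
  polynomial ring in the variables \<open>t\<^sub>a\<close>.\<close>

definition tr_coeff :: "nat \<Rightarrow> complex^'r^'r \<Rightarrow> nat \<Rightarrow> (nat \<Rightarrow> complex^'r^'r) \<Rightarrow> complex"
  where "tr_coeff k \<Theta> n B =
    (let P = (\<chi> a b. Poly_Mapping.single 0 (\<Theta> $ a $ b)
                + (\<Sum>l<n. Poly_Mapping.single (Poly_Mapping.single l 1) (B l $ a $ b)))
             :: ((nat \<Rightarrow>\<^sub>0 nat) \<Rightarrow>\<^sub>0 complex)^'r^'r
     in Poly_Mapping.lookup (trace ((((**) P) ^^ k) (mat 1))) (\<Sum>l<n. Poly_Mapping.single l 1))"

text \<open>The component of an argument in \<open>A\<^sup>0\<^sup>,\<^sup>p(End(E) \<otimes> \<And>\<^sup>q L)\<close> with \<open>q = 1\<close> is its restriction to lists \<open>[\<xi>]\<close>.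
  The wedge product of the \<open>n\<close> form parts is a sum over unshuffles of the tangent vectors. Since the
  trace is invariant under conjugation, any trivialisation \<open>i\<close> of \<open>E\<close> around \<open>x\<close> may be used.\<close>

definition g_map :: "('x, 'i, 'r::finite) vbundle \<Rightarrow> ('x, 'c, 'm::finite, 'i, 'r, 'j, 's::finite) End_form \<Rightarrow>
    nat \<Rightarrow> ('x, 'c, 'm, 'i, 'r, 'j, 's) End_form word \<Rightarrow> ('x, 'c, 'm, 'j, 's) Sym_form"
  where "g_map E \<theta> k w = (\<lambda>c j x vs \<xi>.
    let i = (SOME i. i \<in> trivs E \<and> x \<in> tdom E i) in
    \<Sum>b\<in>{..<length vs} \<rightarrow>\<^sub>E {..<length w}.
      koszul (\<lambda>_. 1) (length vs) b *
      tr_coeff k (\<theta> c i j x [] [\<xi>]) (length w) (\<lambda>l. snd (w ! l) c i j x (nths vs {a. b a = l}) [\<xi>]))"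

definition h_map :: "('x, 'i, 'r::finite) vbundle \<Rightarrow> ('x, 'c, 'm::finite, 'i, 'r, 'j, 's::finite) End_form \<Rightarrow>
    ('x, 'c, 'm, 'i, 'r, 'j, 's) End_form word \<Rightarrow> (nat \<Rightarrow> ('x, 'c, 'm, 'j, 's) Sym_form)"
  where "h_map E \<theta> w = (\<lambda>k. if k \<in> {1..CARD('r)} then g_map E \<theta> k w else 0)"

end

theory Submission
  imports Defs "HOL-Library.Multiset"
begin

text \<open>The target is an abelian dgla, so only its differential matters, and the equation
  \<open>F \<circ> Q = Q' \<circ> F\<close> between maps of symmetric coalgebras reduces to its component of word length one
  (\<open>Linfty_morphism_abelianI\<close>): for every word \<open>w\<close> of homogeneous elements of \<open>M[1]\<close>,
  the sum over all nonempty subwords \<open>w\<^sub>S\<close> of \<open>\<plusminus> h (q w\<^sub>S \<odot> w\<^sub>-\<^sub>S)\<close> has to equal \<open>- \<partial>\<close>-bar of \<open>h w\<close>.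
  On the left, \<open>q\<close> contributes three kinds of terms, one for each summand of the structure of \<open>M\<close>.

  The terms with the Dolbeault differential of a letter add up to the right hand side: \<open>h w\<close> is, up to the
  wedge product, a polynomial in the letters and in \<open>\<theta>\<close>, and \<open>\<theta>\<close> is holomorphic
  (\<open>dbar_local_g\<close>).

  The terms with \<open>[\<theta>, _]\<close> and with brackets of two letters cancel. The map \<open>h\<close> sees only the
  components of degree one in \<open>\<And>L\<close>, so exactly one letter of such a bracket enters through its component
  \<open>\<phi>\<close> of degree zero. Collecting the terms with a fixed \<open>\<phi>\<close> gives, with
  \<open>\<Theta>\<^sub>t = \<theta> + \<Sum> t\<^sub>j f\<^sub>j\<close>, the coefficient of \<open>\<Prod> t\<^sub>j\<close> in the derivative of \<open>Tr (\<Theta>\<^sub>t\<^sup>k)\<close> in the direction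
  \<open>[\<phi>, \<Theta>\<^sub>t]\<close>: the summand \<open>[\<phi>, \<theta>]\<close> comes from the differential, the summands \<open>[\<phi>, f\<^sub>j]\<close> come
  from the bracket. This derivative is the trace of a commutator (\<open>trace_pcoeff_invariant\<close>,
  \<open>local_g_bracket_cancel\<close>).

  Two further points need work. All signs are Koszul signs of unshuffles, of letters as well as of tangent
  vectors; they are organised by the recursive sum \<open>shuf\<close>, whose associativity
  \<open>shuf_shuf_block\<close> is used for the coalgebra morphism, for the Leibniz rule and for the brackets. And the
  identities between monomials hold in the symmetric coalgebra of the target only if all letters lie in the
  correct spaces of forms; this requires that \<open>M\<close> is closed under its operations, in particular that
  \<open>\<partial>\<close>-bar does not depend on charts and frames (\<open>dbar_End_trans\<close>).\<close>

section \<open>Koszul signs and sums over unshuffles\<close>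

text \<open>Products of signs are compared only through the parities of their exponents (\<open>eps_mult\<close>,
  \<open>eps_eqI\<close>).\<close>

definition eps :: "int \<Rightarrow> complex"
  where "eps k = (-1) powi k"

lemma eps_parity: "eps k = (if even k then 1 else -1)"
  by (auto simp: eps_def power_int_minus_left)

lemma eps_eqI: "even (a - b) \<Longrightarrow> eps a = eps b"
  by (auto simp: eps_parity)

lemma eps_mult: "eps a * eps b = eps (a + b)"
  by (auto simp: eps_parity)

lemma eps_0 [simp]: "eps 0 = 1"
  by (simp add: eps_parity)

lemma eps_1 [simp]: "eps 1 = -1"
  by (simp add: eps_parity)

lemma minus_eps: "- eps a = eps (a + 1)"
  by (auto simp: eps_parity)

definition ldeg :: "('a \<Rightarrow> int) \<Rightarrow> 'a list \<Rightarrow> int"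
  where "ldeg dg u = sum_list (map dg u)"

lemma ldeg_simps [simp]:
  "ldeg dg [] = 0" "ldeg dg (a # u) = dg a + ldeg dg u" "ldeg dg (u @ v) = ldeg dg u + ldeg dg v"
  by (simp_all add: ldeg_def)

lemma ldeg_const1 [simp]: "ldeg (\<lambda>_. 1) u = int (length u)"
  by (induction u) auto

text \<open>The degree of everything that an entry has to pass on its way to block \<open>m\<close>.\<close>

definition predeg :: "('a \<Rightarrow> int) \<Rightarrow> (nat \<Rightarrow> 'a list) \<Rightarrow> nat \<Rightarrow> int"
  where "predeg dg Ls m = (\<Sum>l<m. ldeg dg (Ls l))"

lemma predeg_simps [simp]:
  "predeg dg Ls 0 = 0" "predeg dg Ls (Suc m) = predeg dg Ls m + ldeg dg (Ls m)"
  by (simp_all add: predeg_def)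

lemma predeg_upd:
  "predeg dg (Ls(l := u)) m = predeg dg Ls m + (if l < m then ldeg dg u - ldeg dg (Ls l) else 0)"
  by (induction m) (auto simp: less_Suc_eq)

text \<open>The sum of \<open>T\<close> over all distributions of the entries of a list to \<open>n\<close> blocks, with Koszul signs; the
  order of the entries is kept inside each block. The first entry \<open>v\<close> goes to some block \<open>l\<close> and passes all later
  entries that go to the blocks before \<open>l\<close>. The recursion allows identities between nested sums over
  unshuffles to be proved by induction on the list, with \<open>T\<close> arbitrary, where a proof in terms of
  sets of positions would need a bijection for each of them.\<close>

fun shuf :: "('a \<Rightarrow> int) \<Rightarrow> nat \<Rightarrow> ((nat \<Rightarrow> 'a list) \<Rightarrow> 'w::cvs) \<Rightarrow> 'a list \<Rightarrow> 'w"
  where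
    "shuf dg n T [] = T (\<lambda>_. [])"
  | "shuf dg n T (v # vs) =
       (\<Sum>l<n. shuf dg n (\<lambda>Ls. eps (dg v * predeg dg Ls l) *\<^sub>C T (Ls(l := v # Ls l))) vs)"

text \<open>A property of all families of blocks that occur in \<open>shuf\<close>; it forgets the order of the entries, which
  is irrelevant for degrees, lengths and membership.\<close>

definition splits :: "nat \<Rightarrow> 'a list \<Rightarrow> (nat \<Rightarrow> 'a list) \<Rightarrow> bool"
  where "splits n vs Ls \<longleftrightarrow> (\<Sum>l<n. mset (Ls l)) = mset vs \<and> (\<forall>l\<ge>n. Ls l = [])"

lemma splits_Nil: "splits n [] (\<lambda>_. [])"
  by (simp add: splits_def)

lemma splits_Cons: "splits n vs Ls \<Longrightarrow> l < n \<Longrightarrow> splits n (v # vs) (Ls(l := v # Ls l))"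
proof -
  assume a: "splits n vs Ls" "l < n"
  have "(\<Sum>k<n. mset ((Ls(l := v # Ls l)) k)) = (\<Sum>k<n. mset (Ls k) + (if k = l then {#v#} else {#}))"
    by (rule sum.cong) auto
  also have "\<dots> = add_mset v (\<Sum>k<n. mset (Ls k))"
    using a(2) by (simp add: sum.distrib sum.delta)
  finally show ?thesis using a by (auto simp: splits_def)
qed

lemma splits_length: "splits n vs Ls \<Longrightarrow> (\<Sum>l<n. length (Ls l)) = length vs"
proof -
  assume a: "splits n vs Ls"
  have "size (\<Sum>l<n. mset (Ls l)) = (\<Sum>l<n. length (Ls l))"
    by (induction n) auto
  then show ?thesis using a by (metis size_mset splits_def)
qed

lemma splits_set: "splits n vs Ls \<Longrightarrow> set (Ls l) \<subseteq> set vs"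
proof
  fix x assume a: "splits n vs Ls" "x \<in> set (Ls l)"
  then have l: "l < n" by (metis empty_iff list.set(1) not_le_imp_less splits_def)
  have "x \<in># mset (Ls l)" using a by simp
  then have "x \<in># (\<Sum>l<n. mset (Ls l))"
    using l by (metis finite_lessThan lessThan_iff mset_subset_eqD sum.remove mset_subset_eq_add_left)
  then show "x \<in> set vs" using a by (simp add: splits_def)
qed

lemma splits_predeg: "splits n vs Ls \<Longrightarrow> predeg dg Ls n = ldeg dg vs"
proof -
  assume a: "splits n vs Ls"
  have l: "ldeg dg u = (\<Sum>x\<in>#mset u. dg x)" for u
    by (induction u) auto
  have "(\<Sum>l<n. \<Sum>x\<in>#mset (Ls l). dg x) = (\<Sum>x\<in>#(\<Sum>l<n. mset (Ls l)). dg x)"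
    by (induction n) auto
  then show ?thesis using a by (simp add: predeg_def l splits_def)
qed

lemma shuf_cong:
  "(\<And>Ls. splits n vs Ls \<Longrightarrow> T Ls = T' Ls) \<Longrightarrow> shuf dg n T vs = shuf dg n T' vs"
proof (induction vs arbitrary: T T')
  case Nil
  then show ?case by (simp add: splits_Nil)
next
  case (Cons v vs)
  show ?case unfolding shuf.simps
    by (intro sum.cong refl Cons.IH arg_cong[where f="\<lambda>x. _ *\<^sub>C x"] Cons.prems splits_Cons) auto
qed

lemma shuf_add: "shuf dg n (\<lambda>Ls. T Ls + T' Ls) vs = shuf dg n T vs + shuf dg n T' vs"
  by (induction vs arbitrary: T T') (simp_all add: scaleC_add_right sum.distrib)

lemma shuf_zero [simp]: "shuf dg n (\<lambda>Ls. 0) vs = 0"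
  by (induction vs) simp_all

lemma shuf_scale: "shuf dg n (\<lambda>Ls. c *\<^sub>C T Ls) vs = c *\<^sub>C shuf dg n T vs"
proof (induction vs arbitrary: T)
  case (Cons v vs)
  have "shuf dg n (\<lambda>Ls. c *\<^sub>C T Ls) (v # vs) =
      (\<Sum>l<n. shuf dg n (\<lambda>Ls. c *\<^sub>C eps (dg v * predeg dg Ls l) *\<^sub>C T (Ls(l := v # Ls l))) vs)"
    by (simp add: mult.commute)
  also have "\<dots> = c *\<^sub>C shuf dg n T (v # vs)"
    unfolding Cons.IH by (simp add: cvs.scale_sum_right)
  finally show ?case .
qed simp

lemma shuf_minus: "shuf dg n (\<lambda>Ls. - T Ls) vs = - shuf dg n T vs"
  using shuf_scale[of dg n "-1" T vs] by (simp)

lemma shuf_diff: "shuf dg n (\<lambda>Ls. T Ls - T' Ls) vs = shuf dg n T vs - shuf dg n T' vs"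
  using shuf_add[of dg n T "\<lambda>Ls. - T' Ls" vs] by (simp add: shuf_minus)

lemma shuf_sum: "shuf dg n (\<lambda>Ls. \<Sum>i\<in>I. T i Ls) vs = (\<Sum>i\<in>I. shuf dg n (T i) vs)"
  by (induction I rule: infinite_finite_induct) (simp_all add: shuf_add)

lemma shuf_linear:
  assumes add: "\<And>x y. h (x + y) = h x + h y" and scale: "\<And>c x. h (c *\<^sub>C x) = c *\<^sub>C h x"
  shows "h (shuf dg n T vs) = shuf dg n (\<lambda>Ls. h (T Ls)) vs"
proof (induction vs arbitrary: T)
  case (Cons v vs)
  have 0: "h 0 = 0" using scale[of 0 0] by simp
  have "h (sum f {..<k}) = (\<Sum>l<k. h (f l))" for f :: "nat \<Rightarrow> _" and k
    by (induction k) (simp_all add: add 0)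
  then show ?case by (simp add: Cons.IH scale)
qed simp

lemma shuf_in_subspace:
  assumes V: "cvs.subspace V" and T: "\<And>Ls. splits n vs Ls \<Longrightarrow> T Ls \<in> V"
  shows "shuf dg n T vs \<in> V"
  using T
proof (induction vs arbitrary: T)
  case Nil
  then show ?case by (simp add: splits_Nil)
next
  case (Cons v vs)
  show ?case unfolding shuf.simps
    by (intro cvs.subspace_sum[OF V] Cons.IH cvs.subspace_scale[OF V] Cons.prems splits_Cons) auto
qed

text \<open>Position \<open>0\<close> is split off from the block map \<open>b\<close>: its inversions are the later positions that lie in
  a block before \<open>b 0\<close>, which gives the sign in the recursion of \<open>shuf\<close>.\<close>

lemma shuf_eq_koszul_sum:
  "(\<Sum>b\<in>{..<length vs} \<rightarrow>\<^sub>E {..<n}. koszul (\<lambda>i. dg (vs ! i)) (length vs) b *\<^sub>C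
      T (\<lambda>l. nths vs {i. b i = l})) = shuf dg n T vs"
proof (induction vs arbitrary: T)
  case Nil
  then show ?case by (simp add: koszul_def)
next
  case (Cons v vs)
  let ?m = "length vs"
  define ext where "ext = (\<lambda>(l::nat, b::nat \<Rightarrow> nat). case_nat l b)"
  have bij: "bij_betw ext ({..<n} \<times> ({..<?m} \<rightarrow>\<^sub>E {..<n})) ({..<Suc ?m} \<rightarrow>\<^sub>E {..<n})"
  proof (rule bij_betw_byWitness[where f'="\<lambda>b. (b 0, b \<circ> Suc)"])
    show "\<forall>a\<in>{..<n} \<times> ({..<?m} \<rightarrow>\<^sub>E {..<n}). (ext a 0, ext a \<circ> Suc) = a"
      by (auto simp: ext_def comp_def)
    show "\<forall>b\<in>{..<Suc ?m} \<rightarrow>\<^sub>E {..<n}. ext (b 0, b \<circ> Suc) = b"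
      by (auto simp: ext_def fun_eq_iff split: nat.split)
    show "ext ` ({..<n} \<times> ({..<?m} \<rightarrow>\<^sub>E {..<n})) \<subseteq> {..<Suc ?m} \<rightarrow>\<^sub>E {..<n}"
    proof (rule image_subsetI)
      fix a assume a: "a \<in> {..<n} \<times> ({..<?m} \<rightarrow>\<^sub>E {..<n})"
      show "ext a \<in> {..<Suc ?m} \<rightarrow>\<^sub>E {..<n}"
      proof (rule PiE_I)
        fix i show "i \<in> {..<Suc ?m} \<Longrightarrow> ext a i \<in> {..<n}" and "i \<notin> {..<Suc ?m} \<Longrightarrow> ext a i = undefined"
          using a by (cases i; force simp: ext_def PiE_def extensional_def)+
      qed
    qed
    show "(\<lambda>b. (b 0, b \<circ> Suc)) ` ({..<Suc ?m} \<rightarrow>\<^sub>E {..<n}) \<subseteq> {..<n} \<times> ({..<?m} \<rightarrow>\<^sub>E {..<n})"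
    proof (rule image_subsetI)
      fix b assume b: "b \<in> {..<Suc ?m} \<rightarrow>\<^sub>E {..<n}"
      have "b \<circ> Suc \<in> {..<?m} \<rightarrow>\<^sub>E {..<n}"
        by (rule PiE_I) (use b in \<open>auto simp: PiE_def extensional_def\<close>)
      then show "(b 0, b \<circ> Suc) \<in> {..<n} \<times> ({..<?m} \<rightarrow>\<^sub>E {..<n})" using b by auto
    qed
  qed
  have kos: "koszul (\<lambda>i. dg ((v # vs) ! i)) (Suc ?m) (case_nat l b) =
      eps (dg v * predeg dg (\<lambda>l. nths vs {i. b i = l}) l) * koszul (\<lambda>i. dg (vs ! i)) ?m b" for l b
  proof -
    let ?f = "\<lambda>(i, j). eps (dg ((v # vs) ! i) * dg ((v # vs) ! j))"
    let ?A = "{j. j < ?m \<and> b j < l}" and ?B = "{(i, j). i < j \<and> j < ?m \<and> b j < b i}"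
    have set: "{(i, j). i < j \<and> j < Suc ?m \<and> case_nat l b j < case_nat l b i} =
        (\<lambda>j. (0, Suc j)) ` ?A \<union> map_prod Suc Suc ` ?B"
    proof (rule set_eqI)
      fix p :: "nat \<times> nat"
      obtain i j where "p = (i, j)" by (cases p)
      then show "p \<in> {(i, j). i < j \<and> j < Suc ?m \<and> case_nat l b j < case_nat l b i} \<longleftrightarrow>
          p \<in> (\<lambda>j. (0, Suc j)) ` ?A \<union> map_prod Suc Suc ` ?B"
        by (cases i; cases j; auto simp: image_iff)
    qed
    have fin: "finite ?A" "finite ?B"
      by simp (rule finite_subset[of _ "{..<?m} \<times> {..<?m}"], auto)
    have e: "(\<Prod>j\<in>J. eps (c * g j)) = eps (c * sum g J)" if "finite J" for J :: "nat set" and g c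
      using that by induction (auto simp: eps_mult distrib_left)
    have sumA: "(\<Sum>j\<in>?A. dg (vs ! j)) = predeg dg (\<lambda>l. nths vs {i. b i = l}) l"
    proof -
      have n: "ldeg dg (nths vs I) = (\<Sum>j\<in>{j. j < length vs \<and> j \<in> I}. dg (vs ! j))" for I vs
      proof (induction vs arbitrary: I)
        case (Cons a vs)
        have "{j. j < length (a # vs) \<and> j \<in> I} = (if 0 \<in> I then {0} else {}) \<union>
            Suc ` {j. j < length vs \<and> j \<in> {j. Suc j \<in> I}}"
          by (auto simp: image_iff less_Suc_eq_0_disj)
        then show ?case
          by (simp only:, subst sum.union_disjoint) (auto simp: nths_Cons Cons.IH sum.reindex)
      qed simp
      have "?A = (\<Union>k<l. {j. j < length vs \<and> j \<in> {i. b i = k}})" by auto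
      then show ?thesis
        unfolding predeg_def n by (simp only:) (subst sum.UNION_disjoint, auto)
    qed
    have "koszul (\<lambda>i. dg ((v # vs) ! i)) (Suc ?m) (case_nat l b) =
        prod ?f ((\<lambda>j. (0, Suc j)) ` ?A \<union> map_prod Suc Suc ` ?B)"
      unfolding koszul_def set eps_def ..
    also have "\<dots> = prod ?f ((\<lambda>j. (0, Suc j)) ` ?A) * prod ?f (map_prod Suc Suc ` ?B)"
      using fin by (intro prod.union_disjoint) auto
    also have "prod ?f ((\<lambda>j. (0, Suc j)) ` ?A) = (\<Prod>j\<in>?A. eps (dg v * dg (vs ! j)))"
      by (subst prod.reindex) (auto simp: inj_on_def)
    also have "\<dots> = eps (dg v * predeg dg (\<lambda>l. nths vs {i. b i = l}) l)"
      using e[OF fin(1)] sumA by simp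
    also have "prod ?f (map_prod Suc Suc ` ?B) = koszul (\<lambda>i. dg (vs ! i)) ?m b"
      unfolding koszul_def eps_def
      by (subst prod.reindex) (auto simp: inj_on_def intro!: prod.cong)
    finally show ?thesis .
  qed
  have blocks: "(\<lambda>k. nths (v # vs) {i. case_nat l b i = k}) =
      (\<lambda>k. nths vs {i. b i = k})(l := v # nths vs {i. b i = l})" for l b
    by (auto simp: nths_Cons fun_eq_iff)
  have "(\<Sum>b\<in>{..<length (v # vs)} \<rightarrow>\<^sub>E {..<n}. koszul (\<lambda>i. dg ((v # vs) ! i)) (length (v # vs)) b *\<^sub>C
      T (\<lambda>l. nths (v # vs) {i. b i = l})) =
     (\<Sum>(l, b)\<in>{..<n} \<times> ({..<?m} \<rightarrow>\<^sub>E {..<n}). koszul (\<lambda>i. dg ((v # vs) ! i)) (Suc ?m) (case_nat l b) *\<^sub>C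
      T (\<lambda>k. nths (v # vs) {i. case_nat l b i = k}))"
    using sum.reindex_bij_betw[OF bij, symmetric, of "\<lambda>b. koszul (\<lambda>i. dg ((v # vs) ! i)) (Suc ?m) b *\<^sub>C
      T (\<lambda>l. nths (v # vs) {i. b i = l})"]
    by (simp add: ext_def case_prod_beta)
  also have "\<dots> = (\<Sum>l<n. \<Sum>b\<in>{..<?m} \<rightarrow>\<^sub>E {..<n}. koszul (\<lambda>i. dg (vs ! i)) ?m b *\<^sub>C
      (eps (dg v * predeg dg (\<lambda>l. nths vs {i. b i = l}) l) *\<^sub>C
      T ((\<lambda>k. nths vs {i. b i = k})(l := v # nths vs {i. b i = l}))))"
    unfolding sum.cartesian_product[symmetric] kos blocks by (simp add: mult.commute)
  also have "\<dots> = shuf dg n T (v # vs)"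
    unfolding shuf.simps by (intro sum.cong refl) (simp only: Cons.IH[symmetric])
  finally show ?case .
qed

text \<open>A subset is the block with number \<open>0\<close> of a distribution to two blocks.\<close>

lemma shuf2_eq_koszul2_sum:
  "(\<Sum>S\<in>Pow {..<length vs}. koszul2 (\<lambda>i. dg (vs ! i)) (length vs) S *\<^sub>C
      G (nths vs S) (nths vs (- S))) = shuf dg 2 (\<lambda>Ls. G (Ls 0) (Ls 1)) vs"
proof -
  let ?m = "length vs"
  define lab where "lab = (\<lambda>S. \<lambda>i\<in>{..<?m}. if i \<in> S then 0 else 1 :: nat)"
  have bij: "bij_betw lab (Pow {..<?m}) ({..<?m} \<rightarrow>\<^sub>E {..<2})"
  proof (rule bij_betw_byWitness[where f'="\<lambda>b. {i\<in>{..<?m}. b i = 0}"])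
    show "\<forall>b\<in>{..<?m} \<rightarrow>\<^sub>E {..<2}. lab {i \<in> {..<?m}. b i = 0} = b"
    proof
      fix b assume b: "b \<in> {..<?m} \<rightarrow>\<^sub>E {..<2::nat}"
      show "lab {i \<in> {..<?m}. b i = 0} = b"
      proof
        fix i show "lab {i \<in> {..<?m}. b i = 0} i = b i"
        proof (cases "i < ?m")
          case True
          then have "b i < 2" using b by auto
          then show ?thesis using True by (auto simp: lab_def)
        next
          case False
          then show ?thesis using b by (auto simp: lab_def PiE_iff extensional_def)
        qed
      qed
    qed
  next
    have "{i \<in> {..<?m}. lab S i = 0} = S" if "S \<subseteq> {..<?m}" for S
    proof (intro set_eqI iffI)
      fix i assume "i \<in> {i \<in> {..<?m}. lab S i = 0}"
      then show "i \<in> S" by (cases "i \<in> S") (auto simp: lab_def)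
    next
      fix i assume "i \<in> S"
      then show "i \<in> {i \<in> {..<?m}. lab S i = 0}" using that by (auto simp: lab_def)
    qed
    then show "\<forall>S\<in>Pow {..<?m}. {i \<in> {..<?m}. lab S i = 0} = S" by blast
    show "lab ` Pow {..<?m} \<subseteq> {..<?m} \<rightarrow>\<^sub>E {..<2}"
      by (rule image_subsetI) (simp add: lab_def)
  qed blast
  have "koszul2 (\<lambda>i. dg (vs ! i)) ?m S *\<^sub>C G (nths vs S) (nths vs (- S)) =
      koszul (\<lambda>i. dg (vs ! i)) ?m (lab S) *\<^sub>C G (nths vs {i. lab S i = 0}) (nths vs {i. lab S i = 1})"
    if S: "S \<subseteq> {..<?m}" for S
  proof -
    have "koszul2 (\<lambda>i. dg (vs ! i)) ?m S = koszul (\<lambda>i. dg (vs ! i)) ?m (lab S)"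
    proof -
      have "{(i, j). i < j \<and> j < ?m \<and> (if j \<in> S then 0 else 1 :: nat) < (if i \<in> S then 0 else 1)} =
          {(i, j). i < j \<and> j < ?m \<and> lab S j < lab S i}"
        by (intro Collect_cong) (clarsimp simp: lab_def, linarith)
      then show ?thesis unfolding koszul2_def koszul_def by metis
    qed
    moreover have c: "nths vs I = nths vs J" if "\<And>i. i < ?m \<Longrightarrow> i \<in> I \<longleftrightarrow> i \<in> J" for I J
      unfolding nths_def using that by (intro arg_cong[where f="map fst"] filter_cong) (auto simp: in_set_zip)
    have "nths vs {i. lab S i = 0} = nths vs S" "nths vs {i. lab S i = 1} = nths vs (- S)"
      by (rule c, simp add: lab_def)+
    ultimately show ?thesis by simp
  qed
  then have "(\<Sum>S\<in>Pow {..<?m}. koszul2 (\<lambda>i. dg (vs ! i)) ?m S *\<^sub>C G (nths vs S) (nths vs (- S))) =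
      (\<Sum>S\<in>Pow {..<?m}. koszul (\<lambda>i. dg (vs ! i)) ?m (lab S) *\<^sub>C
        G (nths vs {i. lab S i = 0}) (nths vs {i. lab S i = 1}))"
    by (intro sum.cong refl) blast
  also have "\<dots> = (\<Sum>b\<in>{..<?m} \<rightarrow>\<^sub>E {..<2}. koszul (\<lambda>i. dg (vs ! i)) ?m b *\<^sub>C
        G (nths vs {i. b i = 0}) (nths vs {i. b i = 1}))"
    by (rule sum.reindex_bij_betw[OF bij])
  also have "\<dots> = shuf dg 2 (\<lambda>Ls. G (Ls 0) (Ls 1)) vs"
    by (rule shuf_eq_koszul_sum)
  finally show ?thesis .
qed

lemma predeg_swap:
  "predeg dg (Ls(p := Ls (Suc p), Suc p := Ls p)) m =
     predeg dg Ls m + (if m = Suc p then ldeg dg (Ls (Suc p)) - ldeg dg (Ls p) else 0)"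
  by (auto simp: predeg_upd)

text \<open>Renumbering two neighbouring blocks moves their whole contents past each other.\<close>

lemma shuf_swap:
  fixes T :: "(nat \<Rightarrow> 'a list) \<Rightarrow> 'w::cvs"
  assumes p: "Suc p < n"
  shows "shuf dg n T vs = shuf dg n (\<lambda>Ls. eps (ldeg dg (Ls p) * ldeg dg (Ls (Suc p))) *\<^sub>C
    T (Ls(p := Ls (Suc p), Suc p := Ls p))) vs"
proof (induction vs arbitrary: T)
  case Nil
  have "T ((\<lambda>_. [])(p := [], Suc p := [])) = T (\<lambda>_. [])" by (rule arg_cong[where f=T]) auto
  then show ?case by (simp del: fun_upd_apply)
next
  case (Cons v vs)
  \<comment> \<open>Sending \<open>v\<close> to block \<open>l\<close> before the exchange means sending it to block \<open>\<tau> l\<close> afterwards.\<close>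
  define \<tau> where "\<tau> = (id :: nat \<Rightarrow> nat)(p := Suc p, Suc p := p)"
  have bij: "bij_betw \<tau> {..<n} {..<n}"
    by (rule bij_betw_byWitness[where f'=\<tau>]) (use p in \<open>auto simp: \<tau>_def\<close>)
  define R where "R = (\<lambda>l. shuf dg n (\<lambda>Ls. eps (dg v * predeg dg Ls l) *\<^sub>C
      eps (ldeg dg ((Ls(l := v # Ls l)) p) * ldeg dg ((Ls(l := v # Ls l)) (Suc p))) *\<^sub>C
      T ((Ls(l := v # Ls l))(p := (Ls(l := v # Ls l)) (Suc p), Suc p := (Ls(l := v # Ls l)) p))) vs)"
  have "shuf dg n (\<lambda>Ls. eps (dg v * predeg dg Ls l) *\<^sub>C T (Ls(l := v # Ls l))) vs = R (\<tau> l)" for l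
  proof -
    have upd: "(Ls(p := Ls (Suc p), Suc p := Ls p))(l := v # (Ls(p := Ls (Suc p), Suc p := Ls p)) l) =
      (Ls(\<tau> l := v # Ls (\<tau> l)))(p := (Ls(\<tau> l := v # Ls (\<tau> l))) (Suc p), Suc p := (Ls(\<tau> l := v # Ls (\<tau> l))) p)"
      for Ls :: "nat \<Rightarrow> 'a list"
      by (auto simp: \<tau>_def fun_eq_iff)
    have sgn: "eps (ldeg dg (Ls p) * ldeg dg (Ls (Suc p))) *
        eps (dg v * predeg dg (Ls(p := Ls (Suc p), Suc p := Ls p)) l) =
      eps (dg v * predeg dg Ls (\<tau> l)) *
        eps (ldeg dg ((Ls(\<tau> l := v # Ls (\<tau> l))) p) * ldeg dg ((Ls(\<tau> l := v # Ls (\<tau> l))) (Suc p)))"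
      for Ls :: "nat \<Rightarrow> 'a list"
      unfolding eps_mult predeg_swap by (rule eps_eqI) (auto simp: \<tau>_def algebra_simps)
    show ?thesis
      unfolding R_def by (subst Cons.IH) (simp only: cvs.scale_scale upd sgn)
  qed
  then have "shuf dg n T (v # vs) = (\<Sum>l<n. R (\<tau> l))" by simp
  also have "\<dots> = (\<Sum>l<n. R l)" by (rule sum.reindex_bij_betw[OF bij])
  finally show ?case by (simp only: R_def shuf.simps)
qed

lemma two_labels: "{..<2::nat} = {0, 1}"
  by auto

text \<open>Associativity of unshuffles. One may first extract a subword \<open>Ks 0\<close> and distribute the remaining
  entries, or first distribute everything and then extract \<open>Ks 0\<close> from one block \<open>a\<close>. In the second case
  \<open>Ks 0\<close> still has to pass the blocks before \<open>a\<close>. The induction compares the fates of the first entry \<open>v\<close>: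
  it is extracted (which matches only \<open>l = a\<close>), or it goes to block \<open>l\<close>.\<close>

lemma shuf_shuf_block:
  fixes G :: "'a list \<Rightarrow> (nat \<Rightarrow> 'a list) \<Rightarrow> 'w::cvs"
  assumes a: "a < n"
  shows "shuf dg 2 (\<lambda>Ks. shuf dg n (\<lambda>Ls. G (Ks 0) Ls) (Ks 1)) vs =
    shuf dg n (\<lambda>Ls. shuf dg 2 (\<lambda>Ks. eps (ldeg dg (Ks 0) * predeg dg Ls a) *\<^sub>C
      G (Ks 0) (Ls(a := Ks 1))) (Ls a)) vs"
proof (induction vs arbitrary: G)
  case Nil
  have "G [] ((\<lambda>_. [])(a := [])) = G [] (\<lambda>_. [])" by (rule arg_cong[where f="G []"]) auto
  then show ?case by (simp del: fun_upd_apply)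
next
  case (Cons v vs)
  define R where "R = (\<lambda>G :: 'a list \<Rightarrow> (nat \<Rightarrow> 'a list) \<Rightarrow> 'w. shuf dg n (\<lambda>Ls. shuf dg 2 (\<lambda>Ks. eps (ldeg dg (Ks 0) * predeg dg Ls a) *\<^sub>C
      G (Ks 0) (Ls(a := Ks 1))) (Ls a)) vs)"
  define G1 where "G1 = (\<lambda>l K Ls. (eps (dg v * ldeg dg K) * eps (dg v * predeg dg Ls l)) *\<^sub>C
      G K (Ls(l := v # Ls l)))"
  have IH: "shuf dg 2 (\<lambda>Ks. shuf dg n (\<lambda>Ls. G (Ks 0) Ls) (Ks 1)) vs = R G" for G :: "'a list \<Rightarrow> (nat \<Rightarrow> 'a list) \<Rightarrow> 'w"
    unfolding R_def by (rule Cons.IH)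
  have "shuf dg 2 (\<lambda>Ks. shuf dg n (\<lambda>Ls. G (Ks 0) Ls) (Ks 1)) (v # vs) =
      shuf dg 2 (\<lambda>Ks. shuf dg n (\<lambda>Ls. G (v # Ks 0) Ls) (Ks 1)) vs +
      shuf dg 2 (\<lambda>Ks. \<Sum>l<n. shuf dg n (\<lambda>Ls. G1 l (Ks 0) Ls) (Ks 1)) vs"
    by (simp add: two_labels G1_def shuf_scale[symmetric] cvs.scale_sum_right mult.commute)
  also have "\<dots> = R (\<lambda>K. G (v # K)) + (\<Sum>l<n. R (G1 l))"
    using IH[of "\<lambda>K. G (v # K)"] by (simp only: shuf_sum IH)
  also have "\<dots> = (\<Sum>l<n. R (G1 l) + (if l = a then R (\<lambda>K. G (v # K)) else 0))"
    using a by (simp add: sum.distrib sum.delta)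
  also have "\<dots> = shuf dg n (\<lambda>Ls. shuf dg 2 (\<lambda>Ks. eps (ldeg dg (Ks 0) * predeg dg Ls a) *\<^sub>C
      G (Ks 0) (Ls(a := Ks 1))) (Ls a)) (v # vs)"
    unfolding shuf.simps
  proof (rule sum.cong[OF refl])
    fix l assume "l \<in> {..<n}"
    show "R (G1 l) + (if l = a then R (\<lambda>K. G (v # K)) else 0) =
      shuf dg n (\<lambda>Ls. eps (dg v * predeg dg Ls l) *\<^sub>C
        shuf dg 2 (\<lambda>Ks. eps (ldeg dg (Ks 0) * predeg dg (Ls(l := v # Ls l)) a) *\<^sub>C
          G (Ks 0) ((Ls(l := v # Ls l))(a := Ks 1))) ((Ls(l := v # Ls l)) a)) vs"
    proof (cases "l = a")
      case True
      have "R (G1 a) + R (\<lambda>K. G (v # K)) = shuf dg n (\<lambda>Ls.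
         shuf dg 2 (\<lambda>Ks. eps (ldeg dg (Ks 0) * predeg dg Ls a) *\<^sub>C G1 a (Ks 0) (Ls(a := Ks 1)) ) (Ls a) +
         shuf dg 2 (\<lambda>Ks. eps (ldeg dg (Ks 0) * predeg dg Ls a) *\<^sub>C G (v # Ks 0) (Ls(a := Ks 1))) (Ls a)) vs"
        unfolding R_def shuf_add ..
      also have "\<dots> = shuf dg n (\<lambda>Ls. eps (dg v * predeg dg Ls a) *\<^sub>C
        shuf dg 2 (\<lambda>Ks. eps (ldeg dg (Ks 0) * predeg dg (Ls(a := v # Ls a)) a) *\<^sub>C
          G (Ks 0) ((Ls(a := v # Ls a))(a := Ks 1))) ((Ls(a := v # Ls a)) a)) vs"
      proof (rule shuf_cong)
        fix Ls
        have sgn: "eps (i * p) * (eps (d * i) * eps (d * p)) = eps (d * p) * (eps (d * i) * eps (i * p))"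
          "eps (i * p) = eps (d * p) * eps ((d + i) * p)" for i d p
          unfolding eps_mult by (rule eps_eqI; simp add: algebra_simps)+
        show "shuf dg 2 (\<lambda>Ks. eps (ldeg dg (Ks 0) * predeg dg Ls a) *\<^sub>C G1 a (Ks 0) (Ls(a := Ks 1))) (Ls a) +
         shuf dg 2 (\<lambda>Ks. eps (ldeg dg (Ks 0) * predeg dg Ls a) *\<^sub>C G (v # Ks 0) (Ls(a := Ks 1))) (Ls a) =
         eps (dg v * predeg dg Ls a) *\<^sub>C
        shuf dg 2 (\<lambda>Ks. eps (ldeg dg (Ks 0) * predeg dg (Ls(a := v # Ls a)) a) *\<^sub>C
          G (Ks 0) ((Ls(a := v # Ls a))(a := Ks 1))) ((Ls(a := v # Ls a)) a)"
          by (simp add: two_labels G1_def predeg_upd scaleC_add_right shuf_scale[symmetric] sgn add.commute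
              flip: sgn(2) del: mult_minus_left)
      qed
      finally show ?thesis using True by simp
    next
      case False
      have sgn: "eps (k * predeg dg Ls a) * (eps (dg v * k) * eps (dg v * predeg dg (Ls(a := u)) l)) =
          eps (dg v * predeg dg Ls l) * eps (k * predeg dg (Ls(l := v # Ls l)) a)"
        if "ldeg dg (Ls a) = k + ldeg dg u" for k u Ls
        using False that unfolding eps_mult predeg_upd by (intro eps_eqI) (auto simp: algebra_simps)
      have d: "ldeg dg u = ldeg dg (Ks 0) + ldeg dg (Ks 1)" if "splits 2 u Ks" for u Ks
        using splits_predeg[OF that, of dg] by (simp add: numeral_2_eq_2)
      have upd: "(Ls(a := u))(l := v # (Ls(a := u)) l) = (Ls(l := v # Ls l))(a := u)" for Ls u
        using False by (simp add: fun_upd_twist)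
      have "R (G1 l) = shuf dg n (\<lambda>Ls. eps (dg v * predeg dg Ls l) *\<^sub>C
        shuf dg 2 (\<lambda>Ks. eps (ldeg dg (Ks 0) * predeg dg (Ls(l := v # Ls l)) a) *\<^sub>C
          G (Ks 0) ((Ls(l := v # Ls l))(a := Ks 1))) ((Ls(l := v # Ls l)) a)) vs"
        unfolding R_def G1_def shuf_scale[symmetric] using False
      proof (intro shuf_cong)
        fix Ls
        have e: "(Ls(l := v # Ls l)) a = Ls a" using False by simp
        show "shuf dg 2 (\<lambda>Ks. eps (ldeg dg (Ks 0) * predeg dg Ls a) *\<^sub>C
            (eps (dg v * ldeg dg (Ks 0)) * eps (dg v * predeg dg (Ls(a := Ks 1)) l)) *\<^sub>C
            G (Ks 0) (Ls(a := Ks 1, l := v # (Ls(a := Ks 1)) l))) (Ls a) =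
          shuf dg 2 (\<lambda>Ks. eps (dg v * predeg dg Ls l) *\<^sub>C
            eps (ldeg dg (Ks 0) * predeg dg (Ls(l := v # Ls l)) a) *\<^sub>C
            G (Ks 0) (Ls(l := v # Ls l, a := Ks 1))) ((Ls(l := v # Ls l)) a)"
          unfolding e upd by (rule shuf_cong) (simp only: cvs.scale_scale sgn[OF d])
      qed
      then show ?thesis using False by simp
    qed
  qed
  finally show ?case .
qed

text \<open>The other bracketing: the block with number \<open>0\<close> is extracted first.\<close>

lemma shuf_Suc_eq_shuf2:
  "shuf dg (Suc n) T vs = shuf dg 2 (\<lambda>Ks. shuf dg n (\<lambda>Ls. T (case_nat (Ks 0) Ls)) (Ks 1)) vs"
proof (induction vs arbitrary: T)
  case Nil
  have "T (case_nat [] (\<lambda>_. [])) = T (\<lambda>_. [])"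
    by (rule arg_cong[where f=T]) (auto simp: fun_eq_iff split: nat.split)
  then show ?case by simp
next
  case (Cons v vs)
  have u: "(case_nat K Ls)(0 := v # K) = case_nat (v # K) Ls"
    "(case_nat K Ls)(Suc l := v # Ls l) = case_nat K (Ls(l := v # Ls l))" for K Ls l
    by (auto split: nat.split)
  have p: "predeg dg (case_nat K Ls) (Suc l) = ldeg dg K + predeg dg Ls l" for K Ls l
    by (induction l) auto
  have "shuf dg (Suc n) T (v # vs) =
      shuf dg 2 (\<lambda>Ks. shuf dg n (\<lambda>Ls. T (case_nat (v # Ks 0) Ls)) (Ks 1)) vs +
      (\<Sum>l<n. shuf dg 2 (\<lambda>Ks. shuf dg n (\<lambda>Ls. eps (dg v * (ldeg dg (Ks 0) + predeg dg Ls l)) *\<^sub>C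
        T (case_nat (Ks 0) (Ls(l := v # Ls l)))) (Ks 1)) vs)"
    unfolding shuf.simps(2) sum.lessThan_Suc_shift Cons.IH
    by (simp add: u p del: predeg_simps(2) fun_upd_apply)
  also have "(\<Sum>l<n. shuf dg 2 (\<lambda>Ks. shuf dg n (\<lambda>Ls. eps (dg v * (ldeg dg (Ks 0) + predeg dg Ls l)) *\<^sub>C
        T (case_nat (Ks 0) (Ls(l := v # Ls l)))) (Ks 1)) vs) =
      shuf dg 2 (\<lambda>Ks. eps (dg v * ldeg dg (Ks 0)) *\<^sub>C shuf dg n (\<lambda>Ls. T (case_nat (Ks 0) Ls)) (v # Ks 1)) vs"
    unfolding shuf_sum[symmetric] shuf.simps(2) cvs.scale_sum_right shuf_scale[symmetric]
    by (simp add: eps_mult distrib_left)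
  finally show ?case by (simp add: two_labels)
qed

lemma shuf2_Cons:
  "shuf dg 2 (\<lambda>Ks. G (Ks 0) (Ks 1)) (v # w) = shuf dg 2 (\<lambda>Ks. G (v # Ks 0) (Ks 1)) w +
     shuf dg 2 (\<lambda>Ks. eps (dg v * ldeg dg (Ks 0)) *\<^sub>C G (Ks 0) (v # Ks 1)) w"
  by (simp add: two_labels)

lemma shuf2_Nil:
  "shuf dg 2 (\<lambda>Ks. if Ks 0 = [] then H (Ks 1) else 0) w = H w"
  by (induction w arbitrary: H) (simp_all add: two_labels if_distrib[of "\<lambda>x. _ *\<^sub>C x"] cong: if_cong)

text \<open>The sum over all choices of one entry, which is moved to the front with its Koszul sign. For entries
  of degree one this is the alternating sum in the definition of an exterior derivative
  (\<open>pick_eq_sum\<close>).\<close>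

definition pick :: "('a \<Rightarrow> int) \<Rightarrow> ('a \<Rightarrow> 'a list \<Rightarrow> 'w::cvs) \<Rightarrow> 'a list \<Rightarrow> 'w"
  where "pick dg H w = shuf dg 2 (\<lambda>Ks. if length (Ks 0) = 1 then H (hd (Ks 0)) (Ks 1) else 0) w"

lemma pick_Nil [simp]: "pick dg H [] = 0"
  by (simp add: pick_def)

lemma pick_Cons:
  "pick dg H (v # w) = H v w + pick dg (\<lambda>u us. eps (dg v * dg u) *\<^sub>C H u (v # us)) w"
proof -
  have *: "eps (dg v * ldeg dg K) *\<^sub>C (if length K = 1 then H (hd K) us else 0) =
     (if length K = 1 then eps (dg v * dg (hd K)) *\<^sub>C H (hd K) us else 0)" for K us
    by (cases K) auto
  show ?thesis
  proof -
    define G where "G = (\<lambda>K us. if length K = 1 then H (hd K) us else 0)"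
    have g: "G (v # K) us = (if K = [] then H v us else 0)" for K us
      by (auto simp: G_def)
    have "pick dg H (v # w) = shuf dg 2 (\<lambda>Ks. G (Ks 0) (Ks 1)) (v # w)"
      by (simp only: pick_def G_def)
    then have "pick dg H (v # w) = shuf dg 2 (\<lambda>Ks. if Ks 0 = [] then H v (Ks 1) else 0) w +
        shuf dg 2 (\<lambda>Ks. eps (dg v * ldeg dg (Ks 0)) *\<^sub>C
          (if length (Ks 0) = 1 then H (hd (Ks 0)) (v # Ks 1) else 0)) w"
      unfolding shuf2_Cons g by (simp only: G_def)
    then show ?thesis unfolding shuf2_Nil * by (simp only: pick_def)
  qed
qed

lemma pick_cong:
  assumes "\<And>v us. mset w = add_mset v (mset us) \<Longrightarrow> H v us = H' v us"
  shows "pick dg H w = pick dg H' w"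
  unfolding pick_def
proof (rule shuf_cong)
  fix Ks assume "splits 2 w Ks"
  then have "mset w = mset (Ks 0) + mset (Ks 1)"
    by (simp add: splits_def two_labels)
  moreover have "mset (Ks 0) = {#hd (Ks 0)#}" if "length (Ks 0) = 1"
    using that by (cases "Ks 0") auto
  ultimately show "(if length (Ks 0) = 1 then H (hd (Ks 0)) (Ks 1) else 0) =
      (if length (Ks 0) = 1 then H' (hd (Ks 0)) (Ks 1) else 0)"
    by (auto intro!: assms)
qed

lemma pick_add: "pick dg (\<lambda>v us. H v us + H' v us) w = pick dg H w + pick dg H' w"
  unfolding pick_def shuf_add[symmetric] by (rule shuf_cong) auto

lemma pick_zero [simp]: "pick dg (\<lambda>v us. 0) w = 0"
  by (simp add: pick_def)

lemma pick_scale: "pick dg (\<lambda>v us. c *\<^sub>C H v us) w = c *\<^sub>C pick dg H w"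
  unfolding pick_def shuf_scale[symmetric] by (rule shuf_cong) auto

lemma pick_sum: "pick dg (\<lambda>v us. \<Sum>i\<in>I. H i v us) w = (\<Sum>i\<in>I. pick dg (H i) w)"
  by (induction I rule: infinite_finite_induct) (simp_all add: pick_add)

text \<open>Two entries chosen one after the other are an unordered pair, taken in both orders.\<close>

lemma pick_pick:
  fixes H :: "'a \<Rightarrow> 'a \<Rightarrow> 'a list \<Rightarrow> 'b::cvs"
  shows
  "pick dg (\<lambda>a. pick dg (\<lambda>b us. H a b us)) w =
    shuf dg 2 (\<lambda>Ks. if length (Ks 0) = 2 then H (Ks 0 ! 0) (Ks 0 ! 1) (Ks 1) +
      eps (dg (Ks 0 ! 0) * dg (Ks 0 ! 1)) *\<^sub>C H (Ks 0 ! 1) (Ks 0 ! 0) (Ks 1) else 0) w"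
proof (induction w arbitrary: H)
  case (Cons v w)
  define H' where "H' = (\<lambda>a b us. eps (dg v * (dg a + dg b)) *\<^sub>C H a b (v # us))"
  define T where "T = (\<lambda>(H :: 'a \<Rightarrow> 'a \<Rightarrow> 'a list \<Rightarrow> 'b) K us. if length K = 2 then H (K ! 0) (K ! 1) us +
      eps (dg (K ! 0) * dg (K ! 1)) *\<^sub>C H (K ! 1) (K ! 0) us else 0)"
  have "pick dg (\<lambda>a. pick dg (\<lambda>b us. H a b us)) (v # w) =
     pick dg (\<lambda>b us. H v b us) w + pick dg (\<lambda>a us. eps (dg v * dg a) *\<^sub>C H a v us) w +
     pick dg (\<lambda>a. pick dg (\<lambda>b us. H' a b us)) w"
    by (simp add: pick_Cons scaleC_add_right pick_add pick_scale[symmetric] H'_def eps_mult distrib_left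
        add.assoc)
  also have "pick dg (\<lambda>a. pick dg (\<lambda>b us. H' a b us)) w = shuf dg 2 (\<lambda>Ks. T H' (Ks 0) (Ks 1)) w"
    unfolding Cons.IH T_def ..
  also have "\<dots> = shuf dg 2 (\<lambda>Ks. eps (dg v * ldeg dg (Ks 0)) *\<^sub>C T H (Ks 0) (v # Ks 1)) w"
  proof (rule shuf_cong)
    fix Ks
    have "K = [K ! 0, K ! 1]" if "length K = 2" for K :: "'a list"
      using that by (cases K; cases "tl K") auto
    then have l: "ldeg dg K = dg (K ! 0) + dg (K ! 1)" if "length K = 2" for K :: "'a list"
      using that by (metis ldeg_simps(1,2) add_0_right)
    show "T H' (Ks 0) (Ks 1) = eps (dg v * ldeg dg (Ks 0)) *\<^sub>C T H (Ks 0) (v # Ks 1)"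
      by (cases "length (Ks 0) = 2")
        (simp_all add: T_def H'_def l scaleC_add_right eps_mult algebra_simps)
  qed
  also have "pick dg (\<lambda>b us. H v b us) w + pick dg (\<lambda>a us. eps (dg v * dg a) *\<^sub>C H a v us) w =
      shuf dg 2 (\<lambda>Ks. T H (v # Ks 0) (Ks 1)) w"
    unfolding pick_def shuf_add[symmetric]
    by (rule shuf_cong) (auto simp: T_def length_Suc_conv numeral_2_eq_2)
  finally show ?case
    unfolding shuf2_Cons[of dg "T H", symmetric] by (simp only: T_def)
qed simp

lemma pick_eq_sum:
  "pick (\<lambda>_. 1) H w = (\<Sum>a<length w. (-1) ^ a *\<^sub>C H (w ! a) (take a w @ drop (Suc a) w))"
proof (induction w arbitrary: H)
  case (Cons v w)
  show ?case unfolding pick_Cons Cons.IH length_Cons sum.lessThan_Suc_shift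
    by (simp)
qed simp

text \<open>The case of a single extracted entry in \<open>shuf_shuf_block\<close>; it becomes the Leibniz rule for wedge
  products.\<close>

lemma pick_shuf:
  assumes "a < n"
  shows "pick dg (\<lambda>v us. shuf dg n (U v) us) vs =
    shuf dg n (\<lambda>Ls. pick dg (\<lambda>v us. eps (dg v * predeg dg Ls a) *\<^sub>C U v (Ls(a := us))) (Ls a)) vs"
proof -
  define G where "G = (\<lambda>K Ls. if length K = 1 then U (hd K) Ls else 0)"
  have "pick dg (\<lambda>v us. shuf dg n (U v) us) vs = shuf dg 2 (\<lambda>Ks. shuf dg n (\<lambda>Ls. G (Ks 0) Ls) (Ks 1)) vs"
    unfolding pick_def by (rule shuf_cong) (auto simp: G_def)
  also have "\<dots> = shuf dg n (\<lambda>Ls. pick dg (\<lambda>v us. eps (dg v * predeg dg Ls a) *\<^sub>C U v (Ls(a := us))) (Ls a)) vs"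
    unfolding shuf_shuf_block[OF assms] pick_def
  proof (intro shuf_cong)
    fix Ls Ks
    show "eps (ldeg dg (Ks 0) * predeg dg Ls a) *\<^sub>C G (Ks 0) (Ls(a := Ks 1)) =
      (if length (Ks 0) = 1 then eps (dg (hd (Ks 0)) * predeg dg Ls a) *\<^sub>C U (hd (Ks 0)) (Ls(a := Ks 1)) else 0)"
      by (cases "Ks 0") (auto simp: G_def)
  qed
  finally show ?thesis .
qed

lemma predeg_const1_cong:
  "(\<And>l. length (Ls l) = length (Ls' l)) \<Longrightarrow> predeg (\<lambda>_. 1) Ls m = predeg (\<lambda>_. 1) Ls' m"
  by (simp add: predeg_def)

lemma shuf_multilinear:
  fixes T :: "(nat \<Rightarrow> 'a::cvs list) \<Rightarrow> 'w::cvs"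
  assumes "\<And>l Ls us ws. l < n \<Longrightarrow> T (Ls(l := us @ (a *\<^sub>C v + b *\<^sub>C w) # ws)) =
    c *\<^sub>C T (Ls(l := us @ v # ws)) + d *\<^sub>C T (Ls(l := us @ w # ws))"
  shows "shuf (\<lambda>_. 1) n T (us @ (a *\<^sub>C v + b *\<^sub>C w) # ws) =
    c *\<^sub>C shuf (\<lambda>_. 1) n T (us @ v # ws) + d *\<^sub>C shuf (\<lambda>_. 1) n T (us @ w # ws)"
  using assms
proof (induction us arbitrary: T)
  case Nil
  have "T (Ls(l := (a *\<^sub>C v + b *\<^sub>C w) # Ls l)) = c *\<^sub>C T (Ls(l := v # Ls l)) + d *\<^sub>C T (Ls(l := w # Ls l))"
    if "l < n" for l Ls using Nil[OF that, of Ls "[]" "Ls l"] by (simp only: append_Nil)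
  then show ?case
    unfolding append_Nil shuf.simps cvs.scale_sum_right sum.distrib[symmetric]
      shuf_add[symmetric] shuf_scale[symmetric]
    by (intro sum.cong refl shuf_cong) (simp add: scaleC_add_right mult.commute del: fun_upd_apply)
next
  case (Cons u us)
  have "shuf (\<lambda>_. 1) n (\<lambda>Ls. eps (predeg (\<lambda>_. 1) Ls m) *\<^sub>C T (Ls(m := u # Ls m))) (us @ (a *\<^sub>C v + b *\<^sub>C w) # ws) =
    c *\<^sub>C shuf (\<lambda>_. 1) n (\<lambda>Ls. eps (predeg (\<lambda>_. 1) Ls m) *\<^sub>C T (Ls(m := u # Ls m))) (us @ v # ws) +
    d *\<^sub>C shuf (\<lambda>_. 1) n (\<lambda>Ls. eps (predeg (\<lambda>_. 1) Ls m) *\<^sub>C T (Ls(m := u # Ls m))) (us @ w # ws)" for m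
  proof (rule Cons.IH)
    fix l Ls us ws assume l: "l < n"
    have p: "predeg (\<lambda>_. 1) (Ls(l := us @ x # ws)) m = predeg (\<lambda>_. 1) (Ls(l := us @ v # ws)) m" for x
      by (rule predeg_const1_cong) auto
    have upd: "(Ls(l := us @ x # ws))(m := u # (Ls(l := us @ x # ws)) m) =
      (if l = m then Ls(l := (u # us) @ x # ws) else (Ls(m := u # Ls m))(l := us @ x # ws))" for x
      by auto
    show "eps (predeg (\<lambda>_. 1) (Ls(l := us @ (a *\<^sub>C v + b *\<^sub>C w) # ws)) m) *\<^sub>C
        T ((Ls(l := us @ (a *\<^sub>C v + b *\<^sub>C w) # ws))(m := u # (Ls(l := us @ (a *\<^sub>C v + b *\<^sub>C w) # ws)) m)) =
      c *\<^sub>C eps (predeg (\<lambda>_. 1) (Ls(l := us @ v # ws)) m) *\<^sub>C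
        T ((Ls(l := us @ v # ws))(m := u # (Ls(l := us @ v # ws)) m)) +
      d *\<^sub>C eps (predeg (\<lambda>_. 1) (Ls(l := us @ w # ws)) m) *\<^sub>C
        T ((Ls(l := us @ w # ws))(m := u # (Ls(l := us @ w # ws)) m))"
      unfolding upd p[of w] p[of "a *\<^sub>C v + b *\<^sub>C w"]
      using Cons.prems[OF l, of Ls "u # us" ws] Cons.prems[OF l, of "Ls(m := u # Ls m)" us ws]
      by (cases "l = m")
        (simp_all only: if_True if_False refl scaleC_add_right cvs.scale_scale mult.commute)
  qed
  then show ?case
    by (simp add: sum.distrib cvs.scale_sum_right)
qed

text \<open>If both copies of \<open>v\<close> go to the same block, \<open>T\<close> vanishes; the terms in which they go to different
  blocks \<open>l\<close> and \<open>m\<close> cancel against those with \<open>l\<close> and \<open>m\<close> exchanged.\<close>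

lemma shuf_adjacent_dup:
  assumes "\<And>l Ls us ws. l < n \<Longrightarrow> Ls l = us @ v # v # ws \<Longrightarrow> T Ls = 0"
  shows "shuf (\<lambda>_. 1) n T (us @ v # v # ws) = 0"
  using assms
proof (induction us arbitrary: T)
  case Nil
  define R where "R = (\<lambda>l m. shuf (\<lambda>_. 1) n (\<lambda>Ls. eps (predeg (\<lambda>_. 1) Ls m) *\<^sub>C
      eps (predeg (\<lambda>_. 1) (Ls(m := v # Ls m)) l) *\<^sub>C
      T ((Ls(m := v # Ls m))(l := v # (Ls(m := v # Ls m)) l))) ws)"
  have anti: "R l m = - R m l" if "l < n" "m < n" for l m
  proof (cases "l = m")
    case True
    have "T ((Ls(l := v # Ls l))(l := v # (Ls(l := v # Ls l)) l)) = 0" for Ls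
      by (rule Nil[OF \<open>l < n\<close>, of _ "[]" "Ls l"]) simp
    then show ?thesis by (simp add: R_def True)
  next
    case False
    have upd: "(Ls(m := v # Ls m))(l := v # (Ls(m := v # Ls m)) l) = (Ls(l := v # Ls l))(m := v # (Ls(l := v # Ls l)) m)" for Ls
      using False by auto
    have "eps (predeg (\<lambda>_. 1) Ls m) * eps (predeg (\<lambda>_. 1) (Ls(m := v # Ls m)) l) =
       - (eps (predeg (\<lambda>_. 1) Ls l) * eps (predeg (\<lambda>_. 1) (Ls(l := v # Ls l)) m))" for Ls
      unfolding eps_mult minus_eps using False by (intro eps_eqI) (auto simp: predeg_upd)
    then show ?thesis
      unfolding R_def shuf_minus[symmetric]
      by (intro shuf_cong) (simp only: cvs.scale_scale upd cvs.scale_minus_left)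
  qed
  have "shuf (\<lambda>_. 1) n T ([] @ v # v # ws) = (\<Sum>l<n. \<Sum>m<n. R l m)"
    by (simp add: R_def)
  moreover have "(\<Sum>l<n. \<Sum>m<n. R l m) = - (\<Sum>l<n. \<Sum>m<n. R l m)"
  proof -
    have "(\<Sum>l<n. \<Sum>m<n. R l m) = (\<Sum>l<n. \<Sum>m<n. - R m l)"
      by (intro sum.cong refl anti) auto
    also have "\<dots> = - (\<Sum>l<n. \<Sum>m<n. R l m)"
      unfolding sum_negf by (subst sum.swap) simp
    finally show ?thesis .
  qed
  ultimately show ?case
    by (metis (no_types) add.right_inverse cvs.scale_eq_0_iff one_add_one scaleC_add_left scaleC_one zero_neq_numeral)
next
  case (Cons u us)
  have "shuf (\<lambda>_. 1) n (\<lambda>Ls. eps (predeg (\<lambda>_. 1) Ls m) *\<^sub>C T (Ls(m := u # Ls m))) (us @ v # v # ws) = 0" for m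
  proof (rule Cons.IH)
    fix l Ls us ws assume l: "l < n" "Ls l = us @ v # v # ws"
    have "(Ls(m := u # Ls m)) l = (if l = m then u # us else us) @ v # v # ws"
      using l by auto
    then have "T (Ls(m := u # Ls m)) = 0"
      by (rule Cons.prems[OF l(1)])
    then show "eps (predeg (\<lambda>_. 1) Ls m) *\<^sub>C T (Ls(m := u # Ls m)) = 0"
      by simp
  qed
  then show ?case by simp
qed

text \<open>It suffices to test equal neighbours: by polarisation the map changes its sign when two neighbours
  are exchanged, and so equal entries can be moved next to each other.\<close>

lemma alt_multilinearI:
  assumes lin: "\<And>us ws v w a b. f (us @ (a *\<^sub>C v + b *\<^sub>C w) # ws) = \<tau> a *\<^sub>C f (us @ v # ws) + \<tau> b *\<^sub>C f (us @ w # ws)"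
    and dup: "\<And>us v ws. f (us @ v # v # ws) = 0" and \<tau>: "\<tau> 1 = 1"
  shows "alt_multilinear \<tau> f"
proof -
  have skew: "f (us @ v # w # ws) = - f (us @ w # v # ws)" for us v w ws
  proof -
    have 1: "f (us @ (v + w) # ws) = f (us @ v # ws) + f (us @ w # ws)" for us ws v w
      using lin[of us 1 v 1 w ws] by (simp add: \<tau>)
    have "f (us @ (v + w) # (v + w) # ws) = f (us @ v # w # ws) + f (us @ w # v # ws)"
      using 1[of "us @ [v + w]" v w ws] by (simp add: 1 dup add.commute)
    then have "f (us @ v # w # ws) + f (us @ w # v # ws) = 0" by (simp only: dup)
    then show ?thesis by (rule eq_neg_iff_add_eq_0[THEN iffD2])
  qed
  have "f (xs @ y # ys @ y # zs) = 0" for xs y ys zs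
  proof (induction ys arbitrary: xs)
    case (Cons z ys)
    have "f ((xs @ [z]) @ y # ys @ y # zs) = 0" by (rule Cons)
    then show ?case using skew[of xs y z "ys @ y # zs"] by simp
  qed (use dup in simp)
  then have "f vs = 0" if "\<not> distinct vs" for vs
    using not_distinct_decomp[OF that] by auto
  with lin show ?thesis by (simp add: alt_multilinear_def)
qed

lemma alt_multilinear_shuf:
  assumes "\<And>Ls l. l < n \<Longrightarrow> alt_multilinear \<tau> (\<lambda>L. T (Ls(l := L)))" and "\<tau> 1 = 1"
  shows "alt_multilinear \<tau> (shuf (\<lambda>_. 1) n T)"
proof (rule alt_multilinearI)
  fix us ws v w a b
  show "shuf (\<lambda>_. 1) n T (us @ (a *\<^sub>C v + b *\<^sub>C w) # ws) =
    \<tau> a *\<^sub>C shuf (\<lambda>_. 1) n T (us @ v # ws) + \<tau> b *\<^sub>C shuf (\<lambda>_. 1) n T (us @ w # ws)"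
    by (rule shuf_multilinear) (use assms in \<open>simp add: alt_multilinear_def\<close>)
next
  fix us v ws
  show "shuf (\<lambda>_. 1) n T (us @ v # v # ws) = 0"
  proof (rule shuf_adjacent_dup)
    fix l Ls us ws assume "l < n" "Ls l = us @ v # v # ws"
    moreover have "T (Ls(l := L)) = 0" if "\<not> distinct L" "l < n" for L
      using assms(1)[OF that(2)] that(1) by (simp add: alt_multilinear_def)
    ultimately show "T Ls = 0" by (metis distinct_append distinct_length_2_or_more fun_upd_triv)
  qed
qed (rule assms)

section \<open>Morphisms into abelian dglas\<close>

lemma lookup_scaleC: "Poly_Mapping.lookup (a *\<^sub>C p) k = a *\<^sub>C Poly_Mapping.lookup p k"
  for p :: "'a \<Rightarrow>\<^sub>0 'b::cvs"
  by (simp add: scaleC_poly_mapping_def map.rep_eq when_def)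

lemma lin_ext_superset:
  assumes "finite A" "Poly_Mapping.keys x \<subseteq> A"
  shows "lin_ext \<phi> x = (\<Sum>w\<in>A. Poly_Mapping.lookup x w *\<^sub>C \<phi> w)"
  unfolding lin_ext_def
  by (rule sum.mono_neutral_left) (use assms in \<open>auto simp: in_keys_iff\<close>)

lemma lin_ext_add: "lin_ext \<phi> (x + y) = lin_ext \<phi> x + lin_ext \<phi> y"
proof -
  let ?A = "Poly_Mapping.keys x \<union> Poly_Mapping.keys y"
  have "lin_ext \<phi> z = (\<Sum>w\<in>?A. Poly_Mapping.lookup z w *\<^sub>C \<phi> w)" if "Poly_Mapping.keys z \<subseteq> ?A" for z
    using that by (intro lin_ext_superset) auto
  then show ?thesis
    by (simp add: keys_add lookup_add scaleC_add_left sum.distrib)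
qed

lemma lin_ext_scale: "lin_ext \<phi> (c *\<^sub>C x) = c *\<^sub>C lin_ext \<phi> x"
proof -
  have "Poly_Mapping.keys (c *\<^sub>C x) \<subseteq> Poly_Mapping.keys x"
    by (auto simp: in_keys_iff lookup_scaleC)
  then show ?thesis
    by (subst lin_ext_superset[of "Poly_Mapping.keys x"])
      (simp_all add: lookup_scaleC lin_ext_def cvs.scale_sum_right scaleC_complex_def)
qed

lemma lin_ext_zero [simp]: "lin_ext \<phi> 0 = 0"
  by (simp add: lin_ext_def)

lemma lin_ext_mono1 [simp]: "lin_ext \<phi> (mono1 w) = \<phi> w"
  by (simp add: lin_ext_def)

lemma lin_ext_sum: "lin_ext \<phi> (\<Sum>i\<in>I. x i) = (\<Sum>i\<in>I. lin_ext \<phi> (x i))"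
  by (induction I rule: infinite_finite_induct) (simp_all add: lin_ext_add)

lemma lin_ext_shuf: "lin_ext \<phi> (shuf dg n T w) = shuf dg n (\<lambda>Ls. lin_ext \<phi> (T Ls)) w"
  by (rule shuf_linear) (simp_all add: lin_ext_add lin_ext_scale)

lemma lin_ext_subspace:
  assumes "cvs.subspace R" "\<And>w. w \<in> Poly_Mapping.keys x \<Longrightarrow> \<phi> w \<in> R"
  shows "lin_ext \<phi> x \<in> R"
  unfolding lin_ext_def by (intro cvs.subspace_sum cvs.subspace_scale assms)

lemma wdeg_eq_ldeg: "wdeg w = ldeg fst w"
  by (simp add: wdeg_def ldeg_def)

lemma coderivation_eq_shuf:
  "coderivation q w = shuf fst 2 (\<lambda>Ks. if Ks 0 = [] then 0 else
     mono1 ((wdeg (Ks 0) + 1, q (Ks 0)) # Ks 1)) w"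
proof -
  define G where "G = (\<lambda>K us. if K = [] then 0 else mono1 ((wdeg K + 1, q K) # us))"
  let ?k = "koszul2 (\<lambda>i. fst (w ! i)) (length w)"
  have ne: "nths w S \<noteq> []" if S: "S \<subseteq> {..<length w}" "S \<noteq> {}" for S
  proof -
    obtain i where "i \<in> S" "i < length w" using S by auto
    then have "w ! i \<in> set (nths w S)" unfolding set_nths by blast
    then show ?thesis by auto
  qed
  have "coderivation q w = (\<Sum>S\<in>{S. S \<subseteq> {..<length w} \<and> S \<noteq> {}}. ?k S *\<^sub>C G (nths w S) (nths w (- S)))"
    unfolding coderivation_def by (intro sum.cong refl) (use ne in \<open>auto simp: G_def\<close>)
  also have "\<dots> = (\<Sum>S\<in>Pow {..<length w}. ?k S *\<^sub>C G (nths w S) (nths w (- S)))"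
    by (rule sum.mono_neutral_left) (auto simp: G_def)
  also have "\<dots> = shuf fst 2 (\<lambda>Ks. G (Ks 0) (Ks 1)) w"
    by (rule shuf2_eq_koszul2_sum)
  finally show ?thesis by (simp only: G_def)
qed

definition images :: "('v word \<Rightarrow> 'w) \<Rightarrow> nat \<Rightarrow> (nat \<Rightarrow> 'v word) \<Rightarrow> 'w word"
  where "images f s Ls = map (\<lambda>a. (wdeg (Ls a), f (Ls a))) [0..<s]"

text \<open>The monomial \<open>f(Ls 0) \<odot> \<dots> \<odot> f(Ls (s - 1))\<close>. Its value \<open>0\<close> in the presence of an empty block restricts
  sums over all distributions to the surjective ones.\<close>

definition mono_images :: "('v word \<Rightarrow> 'w) \<Rightarrow> nat \<Rightarrow> (nat \<Rightarrow> 'v word) \<Rightarrow> ('w word \<Rightarrow>\<^sub>0 complex)"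
  where "mono_images f s Ls = (if \<forall>l<s. Ls l \<noteq> [] then mono1 (images f s Ls) else 0)"

text \<open>For \<open>s > length w\<close> some block is always empty, so that any larger bound gives the same sum. This
  makes the sums over words of different lengths comparable.\<close>

lemma coalg_morphism_eq_shuf:
  assumes "length w \<le> N"
  shows "coalg_morphism f w = (\<Sum>s=1..N. (1 / fact s) *\<^sub>C shuf fst s (mono_images f s) w)"
proof -
  let ?n = "length w"
  have inner: "(\<Sum>b\<in>{b \<in> {..<?n} \<rightarrow>\<^sub>E {..<s}. b ` {..<?n} = {..<s}}.
       (koszul (\<lambda>i. fst (w ! i)) ?n b / fact s) *\<^sub>C
       mono1 (map (\<lambda>a. (wdeg (nths w {i. b i = a}), f (nths w {i. b i = a}))) [0..<s])) =
     (1 / fact s) *\<^sub>C shuf fst s (mono_images f s) w" for s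
  proof -
    have eq: "(b ` {..<?n} = {..<s}) = (\<forall>l<s. nths w {i. b i = l} \<noteq> [])" if b: "b \<in> {..<?n} \<rightarrow>\<^sub>E {..<s}" for b
    proof -
      have "nths w {i. b i = l} \<noteq> [] \<longleftrightarrow> l \<in> b ` {..<?n}" for l
      proof -
        have "nths w {i. b i = l} \<noteq> [] \<longleftrightarrow> set (nths w {i. b i = l}) \<noteq> {}" by simp
        also have "\<dots> \<longleftrightarrow> l \<in> b ` {..<?n}" unfolding set_nths by blast
        finally show ?thesis .
      qed
      then show ?thesis using b by auto
    qed
    have "(\<Sum>b\<in>{b \<in> {..<?n} \<rightarrow>\<^sub>E {..<s}. b ` {..<?n} = {..<s}}.
       (koszul (\<lambda>i. fst (w ! i)) ?n b / fact s) *\<^sub>C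
       mono1 (map (\<lambda>a. (wdeg (nths w {i. b i = a}), f (nths w {i. b i = a}))) [0..<s])) =
      (\<Sum>b\<in>{..<?n} \<rightarrow>\<^sub>E {..<s}. (koszul (\<lambda>i. fst (w ! i)) ?n b / fact s) *\<^sub>C
       mono_images f s (\<lambda>l. nths w {i. b i = l}))"
    proof (rule sum.mono_neutral_cong_left)
      show "finite ({..<?n} \<rightarrow>\<^sub>E {..<s})" by (simp add: finite_PiE)
    next
      show "\<forall>b\<in>({..<?n} \<rightarrow>\<^sub>E {..<s}) - {b \<in> {..<?n} \<rightarrow>\<^sub>E {..<s}. b ` {..<?n} = {..<s}}.
        (koszul (\<lambda>i. fst (w ! i)) ?n b / fact s) *\<^sub>C mono_images f s (\<lambda>l. nths w {i. b i = l}) = 0"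
      proof
        fix b assume "b \<in> ({..<?n} \<rightarrow>\<^sub>E {..<s}) - {b \<in> {..<?n} \<rightarrow>\<^sub>E {..<s}. b ` {..<?n} = {..<s}}"
        then have "\<not> (\<forall>l<s. nths w {i. b i = l} \<noteq> [])" using eq by blast
        then show "(koszul (\<lambda>i. fst (w ! i)) ?n b / fact s) *\<^sub>C mono_images f s (\<lambda>l. nths w {i. b i = l}) = 0"
          unfolding mono_images_def by (simp only: if_False cvs.scale_zero_right)
      qed
      fix b assume "b \<in> {b \<in> {..<?n} \<rightarrow>\<^sub>E {..<s}. b ` {..<?n} = {..<s}}"
      then have "\<forall>l<s. nths w {i. b i = l} \<noteq> []" using eq by blast
      then show "(koszul (\<lambda>i. fst (w ! i)) ?n b / fact s) *\<^sub>C
          mono1 (map (\<lambda>a. (wdeg (nths w {i. b i = a}), f (nths w {i. b i = a}))) [0..<s]) =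
        (koszul (\<lambda>i. fst (w ! i)) ?n b / fact s) *\<^sub>C mono_images f s (\<lambda>l. nths w {i. b i = l})"
        by (simp add: mono_images_def images_def)
    qed blast
    also have "\<dots> = (1 / fact s) *\<^sub>C (\<Sum>b\<in>{..<?n} \<rightarrow>\<^sub>E {..<s}. koszul (\<lambda>i. fst (w ! i)) ?n b *\<^sub>C
       mono_images f s (\<lambda>l. nths w {i. b i = l}))"
      by (simp add: cvs.scale_sum_right)
    finally show ?thesis by (simp only: shuf_eq_koszul_sum)
  qed
  have "shuf fst s (mono_images f s) w = 0" if "s > ?n" for s
  proof -
    have "mono_images f s Ls = 0" if sp: "splits s w Ls" for Ls
    proof (rule ccontr)
      assume "\<not> ?thesis"
      then have "\<forall>l<s. Ls l \<noteq> []" by (auto simp: mono_images_def split: if_splits)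
      then have "(\<Sum>l<s. 1) \<le> (\<Sum>l<s. length (Ls l))" by (intro sum_mono) (auto simp: Suc_le_eq)
      then show False using splits_length[OF sp] that \<open>s > ?n\<close> by simp
    qed
    then have "shuf fst s (mono_images f s) w = shuf fst s (\<lambda>_. 0) w" by (rule shuf_cong)
    then show ?thesis by simp
  qed
  then have "(\<Sum>s=1..N. (1 / fact s) *\<^sub>C shuf fst s (mono_images f s) w) =
      (\<Sum>s=1..?n. (1 / fact s) *\<^sub>C shuf fst s (mono_images f s) w)"
    using assms by (intro sum.mono_neutral_right) auto
  then show ?thesis unfolding coalg_morphism_def inner by simp
qed

lemma subspace_sym_rel: "cvs.subspace (sym_rel W)"
  unfolding sym_rel_def by (rule cvs.subspace_span)

text \<open>Equality of representatives in the symmetric coalgebra.\<close>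

definition sym_eq :: "'w::cvs graded \<Rightarrow> ('w word \<Rightarrow>\<^sub>0 complex) \<Rightarrow> ('w word \<Rightarrow>\<^sub>0 complex) \<Rightarrow> bool"
  where "sym_eq W x y \<longleftrightarrow> x - y \<in> sym_rel W"

lemma sym_eq_refl [simp]: "sym_eq W x x"
  by (simp add: sym_eq_def cvs.subspace_0 subspace_sym_rel)

lemma sym_eq_trans [trans]: "sym_eq W x y \<Longrightarrow> sym_eq W y z \<Longrightarrow> sym_eq W x z"
  using cvs.subspace_add[OF subspace_sym_rel, of "x - y" W "y - z"] by (simp add: sym_eq_def)

lemma sym_eq_sym: "sym_eq W x y \<Longrightarrow> sym_eq W y x"
  using cvs.subspace_neg[OF subspace_sym_rel, of "x - y" W] by (simp add: sym_eq_def)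

lemma sym_eq_add: "sym_eq W x y \<Longrightarrow> sym_eq W x' y' \<Longrightarrow> sym_eq W (x + x') (y + y')"
  using cvs.subspace_add[OF subspace_sym_rel, of "x - y" W "x' - y'"] by (simp add: sym_eq_def algebra_simps)

lemma sym_eq_scale: "sym_eq W x y \<Longrightarrow> sym_eq W (c *\<^sub>C x) (c *\<^sub>C y)"
  using cvs.subspace_scale[OF subspace_sym_rel, of "x - y" W c] by (simp add: sym_eq_def cvs.scale_right_diff_distrib)

lemma sym_eq_sum: "(\<And>i. i \<in> I \<Longrightarrow> sym_eq W (x i) (y i)) \<Longrightarrow> sym_eq W (\<Sum>i\<in>I. x i) (\<Sum>i\<in>I. y i)"
  by (simp add: sym_eq_def sum_subtractf[symmetric] cvs.subspace_sum subspace_sym_rel)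

lemma sym_eq_shuf:
  "(\<And>Ls. splits n w Ls \<Longrightarrow> sym_eq W (T Ls) (T' Ls)) \<Longrightarrow> sym_eq W (shuf dg n T w) (shuf dg n T' w)"
  unfolding sym_eq_def shuf_diff[symmetric] by (rule shuf_in_subspace[OF subspace_sym_rel])

lemma sym_eq_pick:
  assumes "\<And>v us. mset w = add_mset v (mset us) \<Longrightarrow> sym_eq W (H v us) (H' v us)"
  shows "sym_eq W (pick dg H w) (pick dg H' w)"
  unfolding pick_def
proof (rule sym_eq_shuf)
  fix Ks assume "splits 2 w Ks"
  then have "mset w = mset (Ks 0) + mset (Ks 1)"
    by (simp add: splits_def two_labels)
  moreover have "mset (Ks 0) = {#hd (Ks 0)#}" if "length (Ks 0) = 1"
    using that by (cases "Ks 0") auto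
  ultimately show "sym_eq W (if length (Ks 0) = 1 then H (hd (Ks 0)) (Ks 1) else 0)
      (if length (Ks 0) = 1 then H' (hd (Ks 0)) (Ks 1) else 0)"
    by (auto intro!: assms)
qed

lemma words_iff: "w \<in> words V \<longleftrightarrow> w \<noteq> [] \<and> (\<forall>x\<in>set w. snd x \<in> V (fst x))"
  by (auto simp: words_def split: prod.splits)

lemma sym_eq_linear:
  assumes "P @ (d, x) # S \<in> words W" "y \<in> W d"
  shows "sym_eq W (mono1 (P @ (d, a *\<^sub>C x + b *\<^sub>C y) # S))
    (a *\<^sub>C mono1 (P @ (d, x) # S) + b *\<^sub>C mono1 (P @ (d, y) # S))"
proof -
  have "mono1 (P @ (d, a *\<^sub>C x + b *\<^sub>C y) # S) - a *\<^sub>C mono1 (P @ (d, x) # S) - b *\<^sub>C mono1 (P @ (d, y) # S)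
      \<in> sym_rel W"
    unfolding sym_rel_def by (rule cvs.span_base) (use assms in blast)
  then show ?thesis by (simp add: sym_eq_def diff_diff_eq)
qed

lemma sym_eq_swap:
  assumes "P @ x # y # S \<in> words W"
  shows "sym_eq W (mono1 (P @ x # y # S)) (eps (fst x * fst y) *\<^sub>C mono1 (P @ y # x # S))"
proof -
  obtain d e x' y' where xy: "x = (d, x')" "y = (e, y')" by (cases x, cases y)
  show ?thesis
    unfolding sym_eq_def sym_rel_def eps_def xy fst_conv
    by (rule cvs.span_base) (use assms in \<open>auto simp: xy\<close>)
qed

context
  fixes W :: "'w::cvs graded" and P S :: "'w word" and e :: int
  assumes sub: "cvs.subspace (W e)" and PS: "\<And>x. x \<in> set P \<union> set S \<Longrightarrow> snd x \<in> W (fst x)"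
begin

lemma word_slot: "y \<in> W e \<Longrightarrow> P @ (e, y) # S \<in> words W"
  using PS by (auto simp: words_iff)

lemma sym_eq_slot_zero: "sym_eq W (mono1 (P @ (e, 0) # S)) 0"
  using sym_eq_linear[OF word_slot, of 0 0 0 0] sub by (simp add: cvs.subspace_0)

lemma sym_eq_slot_scale: "y \<in> W e \<Longrightarrow> sym_eq W (mono1 (P @ (e, c *\<^sub>C y) # S)) (c *\<^sub>C mono1 (P @ (e, y) # S))"
  using sym_eq_linear[OF word_slot, of y 0 c 0] sub by (simp add: cvs.subspace_0)

lemma sym_eq_slot_sum:
  assumes "\<And>i. i \<in> I \<Longrightarrow> y i \<in> W e"
  shows "sym_eq W (mono1 (P @ (e, \<Sum>i\<in>I. y i) # S)) (\<Sum>i\<in>I. mono1 (P @ (e, y i) # S))"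
  using assms
proof (induction I rule: infinite_finite_induct)
  case (insert i I)
  have "sym_eq W (mono1 (P @ (e, y i + (\<Sum>i\<in>I. y i)) # S))
     (mono1 (P @ (e, y i) # S) + mono1 (P @ (e, \<Sum>i\<in>I. y i) # S))"
    using sym_eq_linear[OF word_slot, of "y i" "\<Sum>i\<in>I. y i" 1 1] insert.prems
    by (simp add: cvs.subspace_sum[OF sub])
  also have "sym_eq W \<dots> (mono1 (P @ (e, y i) # S) + (\<Sum>i\<in>I. mono1 (P @ (e, y i) # S)))"
    by (intro sym_eq_add insert.IH insert.prems) auto
  finally show ?case using insert.hyps by simp
qed (use sym_eq_slot_zero in auto)

text \<open>A letter that is a sum over unshuffles may be expanded, provided that all summands lie in the graded
  piece of the letter.\<close>

lemma sym_eq_slot_shuf: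
  assumes "\<And>Ls. splits n w Ls \<Longrightarrow> T Ls \<in> W e"
  shows "sym_eq W (mono1 (P @ (e, shuf dg n T w) # S)) (shuf dg n (\<lambda>Ls. mono1 (P @ (e, T Ls) # S)) w)"
  using assms
proof (induction w arbitrary: T)
  case (Cons v w)
  define T' where "T' = (\<lambda>l Ls. eps (dg v * predeg dg Ls l) *\<^sub>C T (Ls(l := v # Ls l)))"
  have T: "T (Ls(l := v # Ls l)) \<in> W e" if "splits n w Ls" "l < n" for l Ls
    by (rule Cons.prems[OF splits_Cons[OF that]])
  have "sym_eq W (mono1 (P @ (e, \<Sum>l<n. shuf dg n (T' l) w) # S))
      (\<Sum>l<n. mono1 (P @ (e, shuf dg n (T' l) w) # S))"
    by (intro sym_eq_slot_sum shuf_in_subspace[OF sub]) (auto simp: T'_def intro!: cvs.subspace_scale[OF sub] T)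
  also have "sym_eq W \<dots> (\<Sum>l<n. shuf dg n (\<lambda>Ls. mono1 (P @ (e, T' l Ls) # S)) w)"
    by (intro sym_eq_sum Cons.IH) (auto simp: T'_def intro!: cvs.subspace_scale[OF sub] T)
  also have "sym_eq W \<dots> (\<Sum>l<n. shuf dg n (\<lambda>Ls. eps (dg v * predeg dg Ls l) *\<^sub>C
      mono1 (P @ (e, T (Ls(l := v # Ls l))) # S)) w)"
    unfolding T'_def by (intro sym_eq_sum sym_eq_shuf sym_eq_slot_scale T) auto
  finally show ?case by (simp add: T'_def)
qed simp

end

text \<open>A letter \<open>x\<close> is chosen, moved to the front, replaced by \<open>g x\<close> and moved back. The two moves have
  the same sign up to the degree \<open>s\<close> of \<open>g\<close>, which remains as \<open>eps (s * _)\<close>.\<close>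

lemma sym_eq_pick_move:
  assumes "\<And>x. x \<in> set w \<Longrightarrow> snd x \<in> W (fst x) \<and> fst (g x) = fst x + s \<and> snd (g x) \<in> W (fst x + s)"
    and "\<And>x. x \<in> set P \<Longrightarrow> snd x \<in> W (fst x)"
  shows "sym_eq W (pick fst (\<lambda>x us. mono1 (P @ g x # us)) w)
    (\<Sum>a<length w. eps (s * ldeg fst (take a w)) *\<^sub>C mono1 (P @ take a w @ g (w ! a) # drop (Suc a) w))"
  using assms
proof (induction w arbitrary: P)
  case (Cons v w)
  have IH: "sym_eq W (pick fst (\<lambda>x us. mono1 ((P @ [v]) @ g x # us)) w)
    (\<Sum>a<length w. eps (s * ldeg fst (take a w)) *\<^sub>C mono1 ((P @ [v]) @ take a w @ g (w ! a) # drop (Suc a) w))"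
    by (rule Cons.IH) (use Cons.prems in auto)
  have "sym_eq W (pick fst (\<lambda>u us. eps (fst v * fst u) *\<^sub>C mono1 (P @ g u # v # us)) w)
     (pick fst (\<lambda>u us. eps (s * fst v) *\<^sub>C mono1 (P @ v # g u # us)) w)"
  proof (rule sym_eq_pick)
    fix u us assume m: "mset w = add_mset u (mset us)"
    then have in_w: "u \<in> set w" "set us \<subseteq> set w"
      by (metis insert_iff set_mset_add_mset_insert set_mset_mset,
          metis set_mset_add_mset_insert set_mset_mset subset_insertI)
    have "sym_eq W (eps (fst v * fst u) *\<^sub>C mono1 (P @ g u # v # us))
       (eps (fst v * fst u) *\<^sub>C eps (fst (g u) * fst v) *\<^sub>C mono1 (P @ v # g u # us))"
      by (intro sym_eq_scale sym_eq_swap)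
        (use Cons.prems in_w in \<open>auto simp: words_iff\<close>)
    also have "eps (fst v * fst u) *\<^sub>C eps (fst (g u) * fst v) *\<^sub>C mono1 (P @ v # g u # us) =
        eps (s * fst v) *\<^sub>C mono1 (P @ v # g u # us)"
      using Cons.prems(1)[of u] in_w
      by (auto simp: eps_mult intro!: arg_cong[where f="\<lambda>c. c *\<^sub>C _"] eps_eqI simp: algebra_simps)
    finally show "sym_eq W (eps (fst v * fst u) *\<^sub>C mono1 (P @ g u # v # us))
        (eps (s * fst v) *\<^sub>C mono1 (P @ v # g u # us))" .
  qed
  also have "sym_eq W (pick fst (\<lambda>u us. eps (s * fst v) *\<^sub>C mono1 (P @ v # g u # us)) w)
     (eps (s * fst v) *\<^sub>C (\<Sum>a<length w. eps (s * ldeg fst (take a w)) *\<^sub>C mono1 (P @ v # take a w @ g (w ! a) # drop (Suc a) w)))"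
    unfolding pick_scale using IH by (intro sym_eq_scale) simp
  finally have "sym_eq W (pick fst (\<lambda>u us. eps (fst v * fst u) *\<^sub>C mono1 (P @ g u # v # us)) w)
     (eps (s * fst v) *\<^sub>C (\<Sum>a<length w. eps (s * ldeg fst (take a w)) *\<^sub>C mono1 (P @ v # take a w @ g (w ! a) # drop (Suc a) w)))" .
  then have "sym_eq W (mono1 (P @ g v # w) + pick fst (\<lambda>u us. eps (fst v * fst u) *\<^sub>C mono1 (P @ g u # v # us)) w)
     (mono1 (P @ g v # w) + eps (s * fst v) *\<^sub>C (\<Sum>a<length w. eps (s * ldeg fst (take a w)) *\<^sub>C mono1 (P @ v # take a w @ g (w ! a) # drop (Suc a) w)))"
    by (intro sym_eq_add) auto
  then show ?case
    unfolding pick_Cons length_Cons sum.lessThan_Suc_shift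
    by (simp add: cvs.scale_sum_right eps_mult distrib_left)
qed simp

text \<open>Both sides of \<open>F \<circ> Q = Q' \<circ> F\<close> are expanded into sums over \<open>s\<close> blocks with a distinguished block \<open>a\<close>.
  In \<open>F (Q w)\<close> the block \<open>a\<close> is the one that receives the letter \<open>q w\<^sub>S\<close>; by \<open>shuf_shuf_block\<close> one may
  choose the blocks first and then \<open>S\<close> inside the block \<open>a\<close>. In \<open>Q' (F w)\<close> the coderivation hits only
  single letters, and the block \<open>a\<close> is the one to which it is applied. The hypothesis \<open>main\<close>, applied to the
  block \<open>a\<close>, then identifies the two sums, because monomials are multilinear in their letters. Multilinearity and
  graded commutativity are available only for letters in the right spaces, which is why the
  summands, too, have to lie in \<open>W\<close>.\<close>

lemma Linfty_morphism_abelianI: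
  fixes f :: "'v::cvs word \<Rightarrow> 'w::cvs"
  assumes f: "sym_maps (shift V 1) (shift W 1) 0 f"
    and W: "\<And>n. cvs.subspace (W n)"
    and q: "\<And>w. w \<in> words (shift V 1) \<Longrightarrow> q w \<in> shift V 1 (wdeg w + 1)"
    and main: "\<And>w. w \<in> words (shift V 1) \<Longrightarrow>
      shuf fst 2 (\<lambda>Ks. if Ks 0 = [] then 0 else f ((wdeg (Ks 0) + 1, q (Ks 0)) # Ks 1)) w = - \<delta> (f w)"
  shows "Linfty_morphism V q W (Linfty_of_dgla \<delta> (\<lambda>_ _. 0)) f"
proof -
  define V' where "V' = shift V 1"
  define W' where "W' = shift W 1"
  define q' where "q' = (Linfty_of_dgla \<delta> (\<lambda>_ _. 0) :: 'w word \<Rightarrow> 'w)"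
  define qx where "qx = (\<lambda>K. (wdeg K + 1, q K))"
  define y where "y = (\<lambda>K. (wdeg K, f K))"
  define z where "z = (\<lambda>K. (wdeg K + 1, - \<delta> (f K)))"
  have W': "cvs.subspace (W' n)" for n
    using W by (simp add: W'_def shift_def)
  have fW: "f w \<in> W' (wdeg w)" if "w \<in> words V'" for w
    using f that by (simp add: sym_maps_def V'_def W'_def)
  have sub_word: "u \<in> words V'" if "w \<in> words V'" "set u \<subseteq> set w" "u \<noteq> []" for u w
    using that by (auto simp: words_iff)
  have q_word: "qx K # us \<in> words V'" if "w \<in> words V'" "set K \<subseteq> set w" "set us \<subseteq> set w" "K \<noteq> []" for w K us
    using q[of K] that sub_word[of w K] by (auto simp: words_iff qx_def V'_def)
  have fq: "f (qx K # us) \<in> W' (wdeg K + 1 + wdeg us)"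
    if "w \<in> words V'" "set K \<subseteq> set w" "set us \<subseteq> set w" "K \<noteq> []" for w K us
    using fW[OF q_word[OF that]] by (simp add: wdeg_def qx_def)
  have fq': "f (qx (Ks 0) # Ks 1) \<in> W' (wdeg w + 1)"
    if w: "w \<in> words V'" and s: "splits 2 w Ks" and ne: "Ks 0 \<noteq> []" for w Ks
    using fq[OF w splits_set[OF s] splits_set[OF s] ne, of 1] splits_predeg[OF s, of fst]
    by (simp add: wdeg_eq_ldeg numeral_2_eq_2 algebra_simps)
  have \<delta>W: "- \<delta> (f w) \<in> W' (wdeg w + 1)" if w: "w \<in> words V'" for w
    unfolding main[OF w[unfolded V'_def], symmetric]
  proof (rule shuf_in_subspace[OF W'])
    fix Ks assume "splits 2 w Ks"
    from fq'[OF w this] show "(if Ks 0 = [] then 0 else f ((wdeg (Ks 0) + 1, q (Ks 0)) # Ks 1)) \<in> W' (wdeg w + 1)"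
      using W' by (simp add: cvs.subspace_0 qx_def)
  qed
  have word: "sym_eq W' (lin_ext (coalg_morphism f) (coderivation q w))
      (lin_ext (coderivation q') (coalg_morphism f w))" if w: "w \<in> words V'" for w
  proof -
    define N where "N = length w"
    define B where "B = (\<lambda>a s Ls. eps (predeg fst Ls a) *\<^sub>C
      shuf fst 2 (\<lambda>Ks. if Ks 0 = [] then 0 else mono_images f s (Ls(a := qx (Ks 0) # Ks 1))) (Ls a))"
    define C where "C = (\<lambda>s Ls. if \<forall>l<s. Ls l \<noteq> [] then
      \<Sum>a<s. eps (predeg fst Ls a) *\<^sub>C mono1 (map (y \<circ> Ls) [0..<a] @ z (Ls a) # map (y \<circ> Ls) [Suc a..<s]) else 0)"
    \<comment> \<open>Choose \<open>S\<close>, then the block \<open>a\<close> of the new letter; exchanging the two choices leaves the sign of a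
      differential of degree one that passes the blocks before \<open>a\<close>.\<close>
    have lhs: "lin_ext (coalg_morphism f) (coderivation q w) =
      (\<Sum>s=1..N. (1 / fact s) *\<^sub>C shuf fst s (\<lambda>Ls. \<Sum>a<s. B a s Ls) w)"
    proof -
      define G where "G = (\<lambda>a s K Ls. if K = [] then 0 else eps ((wdeg K + 1) * predeg fst Ls a) *\<^sub>C
         mono_images f s (Ls(a := qx K # Ls a)))"
      have "lin_ext (coalg_morphism f) (coderivation q w) =
        shuf fst 2 (\<lambda>Ks. if Ks 0 = [] then 0 else coalg_morphism f (qx (Ks 0) # Ks 1)) w"
        unfolding coderivation_eq_shuf lin_ext_shuf qx_def by (rule shuf_cong) simp
      also have "\<dots> = shuf fst 2 (\<lambda>Ks. \<Sum>s=1..N. (1 / fact s) *\<^sub>C (\<Sum>a<s. shuf fst s (\<lambda>Ls. G a s (Ks 0) Ls) (Ks 1))) w"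
      proof (rule shuf_cong)
        fix Ks assume s: "splits 2 w Ks"
        show "(if Ks 0 = [] then 0 else coalg_morphism f (qx (Ks 0) # Ks 1)) =
          (\<Sum>s=1..N. (1 / fact s) *\<^sub>C (\<Sum>a<s. shuf fst s (\<lambda>Ls. G a s (Ks 0) Ls) (Ks 1)))"
        proof (cases "Ks 0 = []")
          case True then show ?thesis by (simp add: G_def)
        next
          case False
          then have "length (qx (Ks 0) # Ks 1) \<le> N"
            using splits_length[OF s] by (cases "Ks 0") (auto simp: N_def numeral_2_eq_2)
          then show ?thesis using False
            by (simp add: coalg_morphism_eq_shuf G_def qx_def)
        qed
      qed
      also have "\<dots> = (\<Sum>s=1..N. (1 / fact s) *\<^sub>C (\<Sum>a<s. shuf fst 2 (\<lambda>Ks. shuf fst s (\<lambda>Ls. G a s (Ks 0) Ls) (Ks 1)) w))"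
        by (simp only: shuf_sum shuf_scale)
      also have "\<dots> = (\<Sum>s=1..N. (1 / fact s) *\<^sub>C (\<Sum>a<s. shuf fst s (B a s) w))"
      proof (intro sum.cong refl arg_cong[where f="\<lambda>x. _ *\<^sub>C x"])
        fix a s :: nat assume a: "a \<in> {..<s}"
        have "eps (ldeg fst K * predeg fst Ls a) *\<^sub>C G a s K (Ls(a := us)) =
          eps (predeg fst Ls a) *\<^sub>C (if K = [] then 0 else mono_images f s (Ls(a := qx K # us)))" for K us Ls
        proof -
          have "eps (ldeg fst K * predeg fst Ls a) * eps ((ldeg fst K + 1) * predeg fst Ls a) = eps (predeg fst Ls a)"
            unfolding eps_mult by (rule eps_eqI) (simp add: algebra_simps)
          then show ?thesis by (simp add: G_def predeg_upd wdeg_eq_ldeg)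
        qed
        then show "shuf fst 2 (\<lambda>Ks. shuf fst s (\<lambda>Ls. G a s (Ks 0) Ls) (Ks 1)) w = shuf fst s (B a s) w"
          unfolding shuf_shuf_block[OF a[unfolded lessThan_iff], of fst "G a s"] B_def by (simp only: shuf_scale)
      qed
      finally show ?thesis by (simp only: shuf_sum)
    qed
    \<comment> \<open>Words of length at least two are mapped to zero by \<open>q'\<close>; the others are moved back to their places.\<close>
    have rhs: "sym_eq W' (lin_ext (coderivation q') (coalg_morphism f w))
      (\<Sum>s=1..N. (1 / fact s) *\<^sub>C shuf fst s (C s) w)"
    proof -
      have "lin_ext (coderivation q') (coalg_morphism f w) =
        (\<Sum>s=1..N. (1 / fact s) *\<^sub>C shuf fst s (\<lambda>Ls. lin_ext (coderivation q') (mono_images f s Ls)) w)"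
        unfolding coalg_morphism_eq_shuf[of w N f, OF eq_refl[OF N_def[symmetric]]]
        by (simp only: lin_ext_sum lin_ext_scale lin_ext_shuf)
      also have "sym_eq W' \<dots> (\<Sum>s=1..N. (1 / fact s) *\<^sub>C shuf fst s (C s) w)"
      proof (intro sym_eq_sum sym_eq_scale sym_eq_shuf)
        fix s Ls assume sp: "splits s w Ls"
        show "sym_eq W' (lin_ext (coderivation q') (mono_images f s Ls)) (C s Ls)"
        proof (cases "\<forall>l<s. Ls l \<noteq> []")
          case True
          define Y where "Y = images f s Ls"
          have Y: "Y = map (y \<circ> Ls) [0..<s]" by (simp add: Y_def images_def y_def)
          have wl: "Ls l \<in> words V'" if "l < s" for l
            by (rule sub_word[OF w splits_set[OF sp]]) (use True that in auto)
          have YW: "snd x \<in> W' (fst x)" if "x \<in> set Y" for x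
            using that wl fW by (auto simp: Y y_def)
          define g where "g = (\<lambda>x :: int \<times> 'w. (fst x + 1, - \<delta> (snd x)))"
          have gy: "g (y (Ls l)) = z (Ls l)" for l
            by (simp add: g_def y_def z_def)
          have "sym_eq W' (coderivation q' Y) (pick fst (\<lambda>x us. mono1 ([] @ g x # us)) Y)"
            unfolding coderivation_eq_shuf pick_def
          proof (rule sym_eq_shuf)
            fix Ks assume sY: "splits 2 Y Ks"
            show "sym_eq W' (if Ks 0 = [] then 0 else mono1 ((wdeg (Ks 0) + 1, q' (Ks 0)) # Ks 1))
              (if length (Ks 0) = 1 then mono1 ([] @ g (hd (Ks 0)) # Ks 1) else 0)"
            proof (cases "length (Ks 0) \<le> 1")
              case True
              then show ?thesis
                by (cases "Ks 0") (auto simp: q'_def g_def wdeg_def)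
            next
              case False
              then have "q' (Ks 0) = 0"
                unfolding q'_def by (cases "Ks 0"; cases "tl (Ks 0)"; cases "tl (tl (Ks 0))") auto
              moreover have "sym_eq W' (mono1 ([] @ (wdeg (Ks 0) + 1, 0) # Ks 1)) 0"
                by (rule sym_eq_slot_zero[OF W']) (use splits_set[OF sY, of 1] YW in auto)
              ultimately show ?thesis using False by auto
            qed
          qed
          also have "sym_eq W' (pick fst (\<lambda>x us. mono1 ([] @ g x # us)) Y)
            (\<Sum>a<length Y. eps (1 * ldeg fst (take a Y)) *\<^sub>C mono1 ([] @ take a Y @ g (Y ! a) # drop (Suc a) Y))"
          proof (rule sym_eq_pick_move)
            fix x assume "x \<in> set Y"
            then obtain l where l: "l < s" "x = y (Ls l)" by (auto simp: Y)
            then have "snd (g x) \<in> W' (fst x + 1)"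
              using \<delta>W[OF wl[of l]] by (simp add: y_def g_def)
            then show "snd x \<in> W' (fst x) \<and> fst (g x) = fst x + 1 \<and> snd (g x) \<in> W' (fst x + 1)"
              using YW[OF \<open>x \<in> set Y\<close>] by (simp add: g_def)
          qed simp
          also have "(\<Sum>a<length Y. eps (1 * ldeg fst (take a Y)) *\<^sub>C mono1 ([] @ take a Y @ g (Y ! a) # drop (Suc a) Y)) = C s Ls"
          proof -
            have "ldeg fst (take a Y) = predeg fst Ls a" if "a < s" for a
            proof -
              have "ldeg fst (map (y \<circ> Ls) [0..<a]) = predeg fst Ls a"
                by (induction a) (auto simp: y_def wdeg_eq_ldeg)
              then show ?thesis using that by (simp add: Y take_map)
            qed
            then show ?thesis using True
              by (simp add: C_def Y take_map drop_map gy)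
          qed
          finally show ?thesis using True by (simp add: mono_images_def Y_def)
        qed (auto simp: mono_images_def C_def)
      qed
      finally show ?thesis .
    qed
    have BC: "sym_eq W' (\<Sum>a<s. B a s Ls) (C s Ls)" if sp: "splits s w Ls" for s Ls
    proof (cases "\<forall>l<s. Ls l \<noteq> []")
      case True
      have wl: "Ls l \<in> words V'" if "l < s" for l
        by (rule sub_word[OF w splits_set[OF sp]]) (use True that in auto)
      have "sym_eq W' (B a s Ls)
        (eps (predeg fst Ls a) *\<^sub>C mono1 (map (y \<circ> Ls) [0..<a] @ z (Ls a) # map (y \<circ> Ls) [Suc a..<s]))"
        if a: "a < s" for a
        unfolding B_def
      proof (rule sym_eq_scale)
        let ?P = "map (y \<circ> Ls) [0..<a]" and ?S = "map (y \<circ> Ls) [Suc a..<s]" and ?e = "wdeg (Ls a) + 1"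
        define T where "T = (\<lambda>Ks :: nat \<Rightarrow> _. if Ks 0 = [] then 0 else f (qx (Ks 0) # Ks 1))"
        have PS: "snd x \<in> W' (fst x)" if "x \<in> set ?P \<union> set ?S" for x
          using that wl fW a by (auto simp: y_def)
        have TW: "T Ks \<in> W' ?e" if "splits 2 (Ls a) Ks" for Ks
          using fq'[OF wl[OF a] that] W' by (simp add: T_def cvs.subspace_0)
        have "sym_eq W' (shuf fst 2 (\<lambda>Ks. if Ks 0 = [] then 0 else mono_images f s (Ls(a := qx (Ks 0) # Ks 1))) (Ls a))
          (shuf fst 2 (\<lambda>Ks. mono1 (?P @ (?e, T Ks) # ?S)) (Ls a))"
        proof (rule sym_eq_shuf)
          fix Ks assume sK: "splits 2 (Ls a) Ks"
          show "sym_eq W' (if Ks 0 = [] then 0 else mono_images f s (Ls(a := qx (Ks 0) # Ks 1)))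
            (mono1 (?P @ (?e, T Ks) # ?S))"
          proof (cases "Ks 0 = []")
            case c: True
            have "sym_eq W' (mono1 (?P @ (?e, 0) # ?S)) 0"
              by (rule sym_eq_slot_zero[OF W']) (rule PS)
            then show ?thesis using c sym_eq_sym by (simp add: T_def)
          next
            case False
            have d: "wdeg (qx (Ks 0) # Ks 1) = ?e"
              using splits_predeg[OF sK, of fst] by (simp add: wdeg_eq_ldeg qx_def numeral_2_eq_2)
            have "[0..<s] = [0..<a] @ a # [Suc a..<s]"
              using a by (metis upt_conv_Cons upt_add_eq_append le_add_diff_inverse less_or_eq_imp_le zero_le)
            then have "images f s (Ls(a := qx (Ks 0) # Ks 1)) = ?P @ (?e, T Ks) # ?S"
              using d False by (simp add: images_def y_def T_def)
            moreover have "\<forall>l<s. (Ls(a := qx (Ks 0) # Ks 1)) l \<noteq> []" using True by auto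
            then have "mono_images f s (Ls(a := qx (Ks 0) # Ks 1)) = mono1 (images f s (Ls(a := qx (Ks 0) # Ks 1)))"
              unfolding mono_images_def by (rule if_P)
            ultimately have "mono_images f s (Ls(a := qx (Ks 0) # Ks 1)) = mono1 (?P @ (?e, T Ks) # ?S)"
              by (simp only:)
            then show ?thesis using False by simp
          qed
        qed
        also have "sym_eq W' \<dots> (mono1 (?P @ (?e, shuf fst 2 T (Ls a)) # ?S))"
          by (rule sym_eq_sym, rule sym_eq_slot_shuf[OF W']) (rule PS TW, assumption)+
        also have "shuf fst 2 T (Ls a) = - \<delta> (f (Ls a))"
          unfolding T_def qx_def by (rule main[OF wl[OF a, unfolded V'_def]])
        finally show "sym_eq W' (shuf fst 2 (\<lambda>Ks. if Ks 0 = [] then 0 else mono_images f s (Ls(a := qx (Ks 0) # Ks 1))) (Ls a))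
          (mono1 (?P @ z (Ls a) # ?S))" by (simp add: z_def comp_def)
      qed
      then show ?thesis using True by (auto simp: C_def intro!: sym_eq_sum)
    next
      case False
      then obtain l where l: "l < s" "Ls l = []" by auto
      have "B a s Ls = 0" if "a < s" for a
      proof (cases "a = l")
        case True then show ?thesis using l by (simp add: B_def)
      next
        case False
        then have "mono_images f s (Ls(a := u)) = 0" for u
          using l by (auto simp: mono_images_def)
        then show ?thesis by (simp only: B_def if_cancel shuf_zero cvs.scale_zero_right)
      qed
      then show ?thesis using False by (auto simp: C_def)
    qed
    have "sym_eq W' (lin_ext (coalg_morphism f) (coderivation q w)) (\<Sum>s=1..N. (1 / fact s) *\<^sub>C shuf fst s (C s) w)"
      unfolding lhs by (intro sym_eq_sum sym_eq_scale sym_eq_shuf BC)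
    then show ?thesis using sym_eq_sym[OF rhs] by (rule sym_eq_trans)
  qed
  have "lin_ext (coalg_morphism f) (lin_ext (coderivation q) x) -
      lin_ext (coderivation q') (lin_ext (coalg_morphism f) x) \<in> sym_rel W'" if x: "x \<in> sym_pre V'" for x
  proof -
    have "lin_ext (coalg_morphism f) (lin_ext (coderivation q) x) -
        lin_ext (coderivation q') (lin_ext (coalg_morphism f) x) =
      lin_ext (\<lambda>w. lin_ext (coalg_morphism f) (coderivation q w) - lin_ext (coderivation q') (coalg_morphism f w)) x"
      unfolding lin_ext_def[of _ x]
      by (simp add: lin_ext_sum lin_ext_scale sum_subtractf cvs.scale_right_diff_distrib)
    also have "\<dots> \<in> sym_rel W'"
      by (rule lin_ext_subspace[OF subspace_sym_rel]) (use x word in \<open>auto simp: sym_pre_def sym_eq_def\<close>)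
    finally show ?thesis .
  qed
  then show ?thesis
    using f by (simp add: Linfty_morphism_def V'_def W'_def q'_def)
qed

section \<open>Coefficients of traces of powers\<close>

lemma matrix_add_rdistrib: "(A + B) ** C = A ** C + B ** (C::'a::semiring_1^'n^'m)"
  by (simp add: vec_eq_iff matrix_matrix_mult_def distrib_right sum.distrib)

lemma matrix_diff_distrib:
  "(A - B) ** C = A ** C - B ** (C::'a::ring_1^'n^'m)" "D ** (F - G) = D ** F - D ** (G::'a::ring_1^'n^'m)"
  by (simp_all add: vec_eq_iff matrix_matrix_mult_def left_diff_distrib right_diff_distrib sum_subtractf)

lemma matrix_mul_zero_right [simp]: "B ** (0::'a::semiring_1^'n^'m) = 0"
  by (simp add: vec_eq_iff matrix_matrix_mult_def)

lemma matrix_mul_sum_left: "(\<Sum>i\<in>I. A i) ** B = (\<Sum>i\<in>I. A i ** (B::'a::semiring_1^'n^'m))"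
  by (induction I rule: infinite_finite_induct) (simp_all add: matrix_add_rdistrib)

lemma matrix_mul_sum_right: "B ** (\<Sum>i\<in>I. A i) = (\<Sum>i\<in>I. B ** (A i::'a::semiring_1^'n^'m))"
  by (induction I rule: infinite_finite_induct) (simp_all add: matrix_add_ldistrib)

lemma matrix_mul_scaleC:
  "(c *\<^sub>C A) ** B = c *\<^sub>C (A ** (B::complex^'n^'m))" "A ** (c *\<^sub>C B) = c *\<^sub>C (A ** (B::complex^'n^'m))"
  by (simp_all add: vec_eq_iff matrix_matrix_mult_def scaleC_vec_def scaleC_complex_def sum_distrib_left mult.left_commute mult.assoc)

lemma trace_scaleC: "trace (c *\<^sub>C A) = c *\<^sub>C trace (A::complex^'n^'n)"
  by (simp add: trace_def scaleC_vec_def scaleC_complex_def sum_distrib_left)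

lemma trace_sum: "trace (\<Sum>i\<in>I. A i) = (\<Sum>i\<in>I. trace (A i :: 'a::comm_semiring_1^'n^'n))"
  unfolding trace_def by (simp add: sum.swap[of _ I])

definition commutator :: "complex^'r^'r \<Rightarrow> complex^'r^'r \<Rightarrow> complex^'r^'r"
  where "commutator A B = A ** B - B ** A"

lemma trace_commutator: "trace (commutator A B) = 0"
  unfolding commutator_def trace_sub using trace_mul_sym[of A B] by simp

text \<open>The matrix coefficient of \<open>\<Prod>\<^sub>l\<^sub>\<in>\<^sub>S t\<^sub>l\<close> in \<open>(\<Theta> + \<Sum> t\<^sub>l B\<^sub>l)\<^sup>k\<close>; the recursion splits off the leftmost factor.\<close>

fun pcoeff :: "complex^'r^'r \<Rightarrow> (nat \<Rightarrow> complex^'r^'r) \<Rightarrow> nat \<Rightarrow> nat set \<Rightarrow> complex^'r^'r"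
  where
    "pcoeff \<Theta> B 0 S = (if S = {} then mat 1 else 0)"
  | "pcoeff \<Theta> B (Suc k) S = \<Theta> ** pcoeff \<Theta> B k S + (\<Sum>l\<in>S. B l ** pcoeff \<Theta> B k (S - {l}))"

lemma pcoeff_cong:
  "(\<And>l. l \<in> S \<Longrightarrow> B l = B' l) \<Longrightarrow> pcoeff \<Theta> B k S = pcoeff \<Theta> B' k S"
proof (induction k arbitrary: S)
  case (Suc k)
  have "pcoeff \<Theta> B k S' = pcoeff \<Theta> B' k S'" if "S' \<subseteq> S" for S'
    by (rule Suc.IH) (use Suc.prems that in blast)
  then show ?case using Suc.prems by (simp cong: sum.cong)
qed simp

lemma pcoeff_image:
  "inj_on \<pi> S \<Longrightarrow> pcoeff \<Theta> B k (\<pi> ` S) = pcoeff \<Theta> (\<lambda>l. B (\<pi> l)) k S"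
proof (induction k arbitrary: S)
  case (Suc k)
  have "pcoeff \<Theta> B k (\<pi> ` S - {\<pi> l}) = pcoeff \<Theta> (\<lambda>l. B (\<pi> l)) k (S - {l})" if "l \<in> S" for l
  proof -
    have "\<pi> ` S - {\<pi> l} = \<pi> ` (S - {l})" using that Suc.prems by (auto simp: inj_on_def)
    then show ?thesis using Suc.IH[of "S - {l}"] Suc.prems inj_on_subset by fastforce
  qed
  then show ?case using Suc by (simp add: sum.reindex cong: sum.cong)
qed simp

lemma pcoeff_linear:
  assumes "finite S" "m \<in> S"
  shows "pcoeff \<Theta> (B(m := a *\<^sub>C x + b *\<^sub>C y)) k S =
    a *\<^sub>C pcoeff \<Theta> (B(m := x)) k S + b *\<^sub>C pcoeff \<Theta> (B(m := y)) k S"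
  using assms
proof (induction k arbitrary: S)
  case (Suc k)
  have S: "sum f S = f m + sum f (S - {m})" for f :: "nat \<Rightarrow> complex^'a^'a"
    using Suc.prems by (simp add: sum.remove)
  have 1: "pcoeff \<Theta> (B(m := z)) k (S - {m}) = pcoeff \<Theta> B k (S - {m})" for z
    by (rule pcoeff_cong) auto
  have 2: "(\<Sum>l\<in>S - {m}. (B(m := z)) l ** pcoeff \<Theta> (B(m := z)) k (S - {l})) =
     (\<Sum>l\<in>S - {m}. B l ** pcoeff \<Theta> (B(m := z)) k (S - {l}))" for z
    by (rule sum.cong) auto
  have 3: "(\<Sum>l\<in>S - {m}. B l ** pcoeff \<Theta> (B(m := a *\<^sub>C x + b *\<^sub>C y)) k (S - {l})) =
     a *\<^sub>C (\<Sum>l\<in>S - {m}. B l ** pcoeff \<Theta> (B(m := x)) k (S - {l})) +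
     b *\<^sub>C (\<Sum>l\<in>S - {m}. B l ** pcoeff \<Theta> (B(m := y)) k (S - {l}))"
    unfolding cvs.scale_sum_right sum.distrib[symmetric]
  proof (rule sum.cong[OF refl])
    fix l assume l: "l \<in> S - {m}"
    have "pcoeff \<Theta> (B(m := a *\<^sub>C x + b *\<^sub>C y)) k (S - {l}) =
        a *\<^sub>C pcoeff \<Theta> (B(m := x)) k (S - {l}) + b *\<^sub>C pcoeff \<Theta> (B(m := y)) k (S - {l})"
      by (rule Suc.IH) (use l Suc.prems in auto)
    then show "B l ** pcoeff \<Theta> (B(m := a *\<^sub>C x + b *\<^sub>C y)) k (S - {l}) =
        a *\<^sub>C (B l ** pcoeff \<Theta> (B(m := x)) k (S - {l})) + b *\<^sub>C (B l ** pcoeff \<Theta> (B(m := y)) k (S - {l}))"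
      by (simp only: matrix_add_ldistrib matrix_mul_scaleC)
  qed
  have 4: "pcoeff \<Theta> (B(m := z)) (Suc k) S = \<Theta> ** pcoeff \<Theta> (B(m := z)) k S +
      (z ** pcoeff \<Theta> B k (S - {m}) + (\<Sum>l\<in>S - {m}. B l ** pcoeff \<Theta> (B(m := z)) k (S - {l})))" for z
    unfolding pcoeff.simps S 2 1 by simp
  show ?case
    unfolding 4 3 Suc.IH[OF Suc.prems]
    by (simp add: matrix_add_ldistrib matrix_add_rdistrib matrix_mul_scaleC scaleC_add_right)
qed auto

lemma pcoeff_zero:
  assumes "finite S" "m \<in> S" "B m = 0"
  shows "pcoeff \<Theta> B k S = 0"
  using pcoeff_linear[OF assms(1,2), of \<Theta> B 0 0 0 0 k] assms(3) by (simp add: fun_upd_idem)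

lemma pcoeff_conjugate:
  assumes g: "g ** h = mat 1" "h ** g = mat 1"
  shows "pcoeff (g ** \<Theta> ** h) (\<lambda>l. g ** B l ** h) k S = g ** pcoeff \<Theta> B k S ** h"
proof (induction k arbitrary: S)
  case (Suc k)
  have *: "(g ** A ** h) ** (g ** C ** h) = g ** (A ** C) ** h" for A C
    by (metis g(2) matrix_mul_assoc matrix_mul_rid)
  show ?case
    unfolding pcoeff.simps Suc *
    by (simp add: matrix_add_ldistrib matrix_add_rdistrib matrix_mul_sum_left matrix_mul_sum_right)
qed (simp add: g)

lemma commutator_mult: "commutator \<phi> (A ** B) = commutator \<phi> A ** B + A ** commutator \<phi> B"
  by (simp add: commutator_def matrix_diff_distrib matrix_mul_assoc)

lemma commutator_add: "commutator \<phi> (A + B) = commutator \<phi> A + commutator \<phi> B"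
  by (simp add: commutator_def matrix_add_ldistrib matrix_add_rdistrib)

lemma commutator_zero [simp]: "commutator \<phi> 0 = 0" "commutator 0 \<phi> = 0"
  by (simp_all add: commutator_def)

lemma commutator_sum: "commutator \<phi> (\<Sum>i\<in>I. A i) = (\<Sum>i\<in>I. commutator \<phi> (A i))"
  by (induction I rule: infinite_finite_induct) (simp_all add: commutator_add)

text \<open>The map \<open>[\<phi>, _]\<close> is a derivation and is applied to one factor of each product at a time. Applying it to a
  factor \<open>\<Theta>\<close> amounts to adding a new letter \<open>[\<phi>, \<Theta>]\<close>, in the variable \<open>i\<close>.\<close>

lemma commutator_pcoeff:
  assumes "finite S" "i \<notin> S"
  shows "commutator \<phi> (pcoeff \<Theta> B k S) =
    pcoeff \<Theta> (B(i := commutator \<phi> \<Theta>)) k (insert i S) +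
    (\<Sum>j\<in>S. pcoeff \<Theta> (B(j := commutator \<phi> (B j))) k S)"
  using assms
proof (induction k arbitrary: S)
  case 0
  then show ?case by (simp add: commutator_def)
next
  case (Suc k)
  let ?R = "pcoeff \<Theta>"
  let ?Bi = "B(i := commutator \<phi> \<Theta>)" and ?Bj = "\<lambda>j. B(j := commutator \<phi> (B j))"
  have IH: "commutator \<phi> (?R B k (S - {l})) = ?R ?Bi k (insert i (S - {l})) +
     (\<Sum>j\<in>S - {l}. ?R (?Bj j) k (S - {l}))" for l
    by (rule Suc.IH) (use Suc.prems in auto)
  have e1: "?R ?Bi (Suc k) (insert i S) = \<Theta> ** ?R ?Bi k (insert i S) + (commutator \<phi> \<Theta> ** ?R B k S +
      (\<Sum>l\<in>S. B l ** ?R ?Bi k (insert i (S - {l}))))"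
  proof -
    have "?R ?Bi k (insert i S - {i}) = ?R B k S"
      using Suc.prems by (subst pcoeff_cong[of _ ?Bi B]) auto
    moreover have "(\<Sum>l\<in>S. ?Bi l ** ?R ?Bi k (insert i S - {l})) = (\<Sum>l\<in>S. B l ** ?R ?Bi k (insert i (S - {l})))"
      using Suc.prems by (intro sum.cong refl) (auto simp: insert_Diff_if)
    ultimately show ?thesis using Suc.prems by simp
  qed
  have e2: "?R (?Bj j) (Suc k) S = \<Theta> ** ?R (?Bj j) k S + (commutator \<phi> (B j) ** ?R B k (S - {j}) +
      (\<Sum>l\<in>S - {j}. B l ** ?R (?Bj j) k (S - {l})))" if "j \<in> S" for j
  proof -
    have "?R (?Bj j) k (S - {j}) = ?R B k (S - {j})"
      by (rule pcoeff_cong) auto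
    moreover have "(\<Sum>l\<in>S - {j}. ?Bj j l ** ?R (?Bj j) k (S - {l})) = (\<Sum>l\<in>S - {j}. B l ** ?R (?Bj j) k (S - {l}))"
      by (rule sum.cong) auto
    ultimately show ?thesis using that Suc.prems by (simp add: sum.remove)
  qed
  have e3: "(\<Sum>j\<in>S. \<Sum>l\<in>S - {j}. B l ** ?R (?Bj j) k (S - {l})) =
      (\<Sum>l\<in>S. B l ** (\<Sum>j\<in>S - {l}. ?R (?Bj j) k (S - {l})))"
  proof -
    have "(\<Sum>j\<in>S. \<Sum>l\<in>S - {j}. B l ** ?R (?Bj j) k (S - {l})) =
       (\<Sum>l\<in>S. \<Sum>j\<in>S - {l}. B l ** ?R (?Bj j) k (S - {l}))"
      by (subst (1 2) sum.Sigma) (use Suc.prems in \<open>auto intro!: sum.reindex_bij_witness[where i=prod.swap and j=prod.swap]\<close>)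
    then show ?thesis by (simp add: matrix_mul_sum_right)
  qed
  have "(\<Sum>j\<in>S. ?R (?Bj j) (Suc k) S) = (\<Sum>j\<in>S. \<Theta> ** ?R (?Bj j) k S + (commutator \<phi> (B j) ** ?R B k (S - {j}) +
      (\<Sum>l\<in>S - {j}. B l ** ?R (?Bj j) k (S - {l}))))"
    by (rule sum.cong[OF refl e2])
  also have "\<dots> = \<Theta> ** (\<Sum>j\<in>S. ?R (?Bj j) k S) + ((\<Sum>j\<in>S. commutator \<phi> (B j) ** ?R B k (S - {j})) +
      (\<Sum>l\<in>S. B l ** (\<Sum>j\<in>S - {l}. ?R (?Bj j) k (S - {l}))))"
    unfolding sum.distrib e3 by (simp only: matrix_mul_sum_right)
  finally have e4: "(\<Sum>j\<in>S. ?R (?Bj j) (Suc k) S) = \<dots>" .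
  show ?case
    unfolding e1 e4 pcoeff.simps(2)[of \<Theta> B]
    by (simp add: commutator_add commutator_mult commutator_sum IH Suc.IH[OF Suc.prems]
        matrix_add_ldistrib sum.distrib add_ac del: fun_upd_apply)
qed

text \<open>The infinitesimal form of the invariance of \<open>Tr (\<Theta>\<^sub>t\<^sup>k)\<close> under conjugation. This is the algebraic
  reason for the cancellation of all brackets.\<close>

lemma trace_pcoeff_invariant:
  assumes "finite S" "i \<notin> S"
  shows "trace (pcoeff \<Theta> (B(i := commutator \<phi> \<Theta>)) k (insert i S)) +
    (\<Sum>j\<in>S. trace (pcoeff \<Theta> (B(j := commutator \<phi> (B j))) k S)) = 0"
  using arg_cong[OF commutator_pcoeff[OF assms, of \<phi> \<Theta> B k], of trace]
  by (simp add: trace_commutator trace_add trace_sum)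

definition tmono :: "nat set \<Rightarrow> (nat \<Rightarrow>\<^sub>0 nat)"
  where "tmono S = (\<Sum>l\<in>S. Poly_Mapping.single l 1)"

lemma lookup_tmono: "finite S \<Longrightarrow> Poly_Mapping.lookup (tmono S) l = (if l \<in> S then 1 else 0)"
  unfolding tmono_def by (induction S rule: finite_induct) (auto simp: lookup_add lookup_single when_def)

lemma lookup_single_times:
  fixes p :: "('a::cancel_comm_monoid_add) \<Rightarrow>\<^sub>0 'b::semiring_0"
  shows "Poly_Mapping.lookup (Poly_Mapping.single m c * p) (m + t) = c * Poly_Mapping.lookup p t"
    and "(\<And>q. u \<noteq> m + q) \<Longrightarrow> Poly_Mapping.lookup (Poly_Mapping.single m c * p) u = 0"
proof -
  have l: "Poly_Mapping.lookup (Poly_Mapping.single m c * p) u = c * (\<Sum>q. Poly_Mapping.lookup p q when u = m + q)" for u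
  proof -
    have "Poly_Mapping.lookup (Poly_Mapping.single m c * p) u =
      (\<Sum>l. (c * (\<Sum>q. Poly_Mapping.lookup p q when u = l + q)) when l = m)"
      unfolding lookup_mult by (rule Sum_any.cong) (auto simp: lookup_single when_def)
    then show ?thesis by simp
  qed
  have "(\<Sum>q. Poly_Mapping.lookup p q when m + t = m + q) = (\<Sum>q. Poly_Mapping.lookup p q when q = t)"
    by (rule Sum_any.cong) (auto simp: when_def)
  then show "Poly_Mapping.lookup (Poly_Mapping.single m c * p) (m + t) = c * Poly_Mapping.lookup p t"
    unfolding l by simp
  show "Poly_Mapping.lookup (Poly_Mapping.single m c * p) u = 0" if "\<And>q. u \<noteq> m + q"
    unfolding l using that by simp
qed

lemma lookup_single_times_tmono:
  assumes "finite S"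
  shows "Poly_Mapping.lookup (Poly_Mapping.single (Poly_Mapping.single l 1) c * p) (tmono S) =
    (if l \<in> S then c * Poly_Mapping.lookup p (tmono (S - {l})) else 0)"
proof (cases "l \<in> S")
  case True
  then have "tmono S = Poly_Mapping.single l 1 + tmono (S - {l})"
    unfolding tmono_def by (rule sum.remove[OF assms])
  then show ?thesis using True lookup_single_times(1) by metis
next
  case False
  have "tmono S \<noteq> Poly_Mapping.single l 1 + q" for q
  proof
    assume "tmono S = Poly_Mapping.single l 1 + q"
    then have "Poly_Mapping.lookup (tmono S) l = Suc (Poly_Mapping.lookup q l)"
      by (simp add: lookup_add)
    then show False using False by (simp add: lookup_tmono[OF assms])
  qed
  then show ?thesis using False lookup_single_times(2) by metis
qed

lemma lookup_sum_poly_mapping: "Poly_Mapping.lookup (\<Sum>i\<in>I. f i) t = (\<Sum>i\<in>I. Poly_Mapping.lookup (f i) t)"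
  by (induction I rule: infinite_finite_induct) (simp_all add: lookup_add)

text \<open>Only square free monomials \<open>tmono S\<close> contribute to the coefficient of \<open>t\<^sub>0 \<cdots> t\<^sub>n\<^sub>-\<^sub>1\<close>, since every monomial
  dividing it is of this form.\<close>

lemma tr_coeff_eq: "tr_coeff k \<Theta> n B = trace (pcoeff \<Theta> B k {..<n})"
proof -
  define P where "P = ((\<chi> a b. Poly_Mapping.single 0 (\<Theta> $ a $ b)
      + (\<Sum>l<n. Poly_Mapping.single (Poly_Mapping.single l 1) (B l $ a $ b))) :: ((nat \<Rightarrow>\<^sub>0 nat) \<Rightarrow>\<^sub>0 complex)^'a^'a)"
  have P_nth: "P $ a $ c = Poly_Mapping.single 0 (\<Theta> $ a $ c)
      + (\<Sum>l<n. Poly_Mapping.single (Poly_Mapping.single l 1) (B l $ a $ c))" for a c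
    by (simp add: P_def)
  have "Poly_Mapping.lookup ((((**) P ^^ k) (mat 1)) $ a $ b) (tmono S) = pcoeff \<Theta> B k S $ a $ b"
    if "S \<subseteq> {..<n}" for S a b
    using that
  proof (induction k arbitrary: S a b)
    case 0
    have f: "finite S" using 0 finite_subset by blast
    have "tmono S = 0 \<longleftrightarrow> S = {}"
      by (auto simp: poly_mapping_eq_iff fun_eq_iff lookup_tmono[OF f])
    then show ?case by (auto simp: mat_def lookup_one when_def)
  next
    case (Suc k)
    let ?Q = "((**) P ^^ k) (mat 1)"
    have f: "finite S" using Suc.prems finite_subset by blast
    have 0: "Poly_Mapping.lookup (Poly_Mapping.single 0 c * p) (tmono S) = c * Poly_Mapping.lookup p (tmono S)"
      for c :: complex and p
      using lookup_single_times(1)[of 0 c p "tmono S"] by simp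
    have "Poly_Mapping.lookup ((((**) P ^^ Suc k) (mat 1)) $ a $ b) (tmono S) =
       (\<Sum>c\<in>UNIV. Poly_Mapping.lookup (P $ a $ c * ?Q $ c $ b) (tmono S))"
      by (simp add: matrix_matrix_mult_def lookup_sum_poly_mapping)
    also have "\<dots> = (\<Sum>c\<in>UNIV. \<Theta> $ a $ c * pcoeff \<Theta> B k S $ c $ b +
        (\<Sum>l<n. if l \<in> S then B l $ a $ c * pcoeff \<Theta> B k (S - {l}) $ c $ b else 0))"
    proof (rule sum.cong[OF refl])
      fix c
      have "Poly_Mapping.lookup (?Q $ c $ b) (tmono (S - {l})) = pcoeff \<Theta> B k (S - {l}) $ c $ b" for l
        by (rule Suc.IH) (use Suc.prems in auto)
      then show "Poly_Mapping.lookup (P $ a $ c * ?Q $ c $ b) (tmono S) = \<Theta> $ a $ c * pcoeff \<Theta> B k S $ c $ b +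
        (\<Sum>l<n. if l \<in> S then B l $ a $ c * pcoeff \<Theta> B k (S - {l}) $ c $ b else 0)"
        unfolding P_nth
        by (simp add: distrib_right sum_distrib_right lookup_add lookup_sum_poly_mapping
            lookup_single_times_tmono[OF f, simplified] 0 Suc.IH[OF Suc.prems] cong: if_cong)
    qed
    also have "\<dots> = (\<Sum>c\<in>UNIV. \<Theta> $ a $ c * pcoeff \<Theta> B k S $ c $ b) +
        (\<Sum>l<n. \<Sum>c\<in>UNIV. if l \<in> S then B l $ a $ c * pcoeff \<Theta> B k (S - {l}) $ c $ b else 0)"
      unfolding sum.distrib by (subst (2) sum.swap) simp
    also have "(\<Sum>l<n. \<Sum>c\<in>UNIV. if l \<in> S then B l $ a $ c * pcoeff \<Theta> B k (S - {l}) $ c $ b else 0) =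
       (\<Sum>l\<in>S. (B l ** pcoeff \<Theta> B k (S - {l})) $ a $ b)"
      using Suc.prems
      by (intro sum.mono_neutral_cong_right) (auto simp: matrix_matrix_mult_def)
    finally show ?case
      by (simp add: matrix_matrix_mult_def)
  qed
  then show ?thesis
    unfolding tr_coeff_def Let_def P_def[symmetric] tmono_def[symmetric] trace_def
    by (simp add: lookup_sum_poly_mapping)
qed

section \<open>Smooth functions and their antiholomorphic derivatives\<close>

text \<open>In a space that is merely both a complex vector space and a real normed space, the two scalar
  multiplications are unrelated, and complex scalars could not be pulled out of derivatives.\<close>

class complex_normed = real_normed_vector + cvs +
  assumes scaleR_eq_scaleC: "scaleR r x = complex_of_real r *\<^sub>C x"
    and norm_scaleC: "norm (c *\<^sub>C x) = cmod c * norm x"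

instance complex :: complex_normed
  by standard (simp_all add: scaleC_complex_def scaleR_conv_of_real norm_mult)

instance vec :: (complex_normed, finite) complex_normed
proof
  fix x :: "'a^'b" and r :: real and c :: complex
  show "r *\<^sub>R x = complex_of_real r *\<^sub>C x"
    by (simp add: vec_eq_iff scaleC_vec_def scaleR_eq_scaleC)
  show "norm (c *\<^sub>C x) = cmod c * norm x"
    by (simp add: norm_vec_def scaleC_vec_def norm_scaleC L2_set_right_distrib)
qed

lemma bounded_linear_scaleC: "bounded_linear (\<lambda>x :: 'a::complex_normed. c *\<^sub>C x)"
  by (rule bounded_linear_intro[where K="cmod c"])
    (simp_all add: scaleC_add_right scaleR_eq_scaleC norm_scaleC mult.commute)

lemma bounded_bilinear_scaleC: "bounded_bilinear (\<lambda>c (x :: 'a::complex_normed). c *\<^sub>C x)"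
proof
  show "\<exists>K. \<forall>a (b::'a). norm (a *\<^sub>C b) \<le> norm a * norm b * K"
    by (rule exI[of _ 1]) (simp add: norm_scaleC)
qed (simp_all add: scaleC_add_left scaleC_add_right scaleR_eq_scaleC scaleC_complex_def mult.commute)

lemma bounded_bilinear_matrix_mult: "bounded_bilinear ((**) :: complex^'n^'m \<Rightarrow> complex^'k^'n \<Rightarrow> _)"
proof -
  have s: "r *\<^sub>R A = complex_of_real r *\<^sub>C A" for r and A :: "complex^'a^'b"
    by (rule scaleR_eq_scaleC)
  have "bilinear ((**) :: complex^'n^'m \<Rightarrow> complex^'k^'n \<Rightarrow> _)"
    unfolding bilinear_def
    by (auto intro!: linearI simp: matrix_add_ldistrib matrix_add_rdistrib s matrix_mul_scaleC)
  then show ?thesis by (simp add: bilinear_conv_bounded_bilinear)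
qed

lemma bounded_linear_trace: "bounded_linear (trace :: complex^'n^'n \<Rightarrow> complex)"
  unfolding linear_conv_bounded_linear[symmetric]
  by (rule linearI) (simp_all add: trace_add scaleR_eq_scaleC trace_scaleC)

lemma differentiable_transform_open:
  assumes "f differentiable (at x)" "open S" "x \<in> S" "\<And>y. y \<in> S \<Longrightarrow> f y = g y"
  shows "g differentiable (at x)"
  using assms unfolding differentiable_def by (metis has_derivative_transform_within_open)

lemma Ck_on_cong:
  assumes "open S" "\<And>z. z \<in> S \<Longrightarrow> f z = g z" "Ck_on k S f"
  shows "Ck_on k S g"
  using assms(2,3)
proof (induction k arbitrary: f g)
  case 0
  then show ?case by (simp add: continuous_on_eq)
next
  case (Suc k)
  have f: "f differentiable (at z)" "Ck_on k S (\<lambda>z. frechet_derivative f (at z) v)" if "z \<in> S" for z v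
    using Suc.prems(2) that by simp_all
  have "frechet_derivative f (at z) v = frechet_derivative g (at z) v" if "z \<in> S" for z v
    using frechet_derivative_transform_within_open[OF f(1)[OF that] assms(1) that Suc.prems(1)] by simp
  then have "Ck_on k S (\<lambda>z. frechet_derivative g (at z) v)" for v
    by (rule Suc.IH) (use Suc.prems(2) in simp_all)
  moreover have "g differentiable (at z)" if "z \<in> S" for z
    by (rule differentiable_transform_open[OF f(1)[OF that] assms(1) that Suc.prems(1)])
  ultimately show ?case by simp
qed

lemma smooth_on_cong:
  assumes "open S" "\<And>z. z \<in> S \<Longrightarrow> f z = g z" "smooth_on S f"
  shows "smooth_on S g"
  using assms Ck_on_cong unfolding smooth_on_def by blast

lemma Ck_on_Suc_D: "Ck_on (Suc k) S f \<Longrightarrow> Ck_on k S f"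
proof (induction k arbitrary: f)
  case 0
  then show ?case
    by (auto intro!: continuous_at_imp_continuous_on differentiable_imp_continuous_within)
next
  case (Suc k)
  have "Ck_on (Suc k) S (\<lambda>z. frechet_derivative f (at z) v)" for v
    using Suc.prems unfolding Ck_on.simps(2)[of "Suc k"] by blast
  then have "Ck_on k S (\<lambda>z. frechet_derivative f (at z) v)" for v by (rule Suc.IH)
  then show ?case using Suc.prems by simp
qed

lemma Ck_on_subset: "Ck_on k S f \<Longrightarrow> T \<subseteq> S \<Longrightarrow> Ck_on k T f"
  by (induction k arbitrary: f) (auto intro: continuous_on_subset)

lemma smooth_on_subset: "smooth_on S f \<Longrightarrow> T \<subseteq> S \<Longrightarrow> smooth_on T f"
  unfolding smooth_on_def using Ck_on_subset by blast

lemma Ck_on_local: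
  assumes "\<And>z. z \<in> S \<Longrightarrow> \<exists>T. open T \<and> z \<in> T \<and> Ck_on k T f"
  shows "Ck_on k S f"
  using assms
proof (induction k arbitrary: f)
  case 0
  have "isCont f z" if "z \<in> S" for z
    using 0[OF that] by (auto simp: continuous_on_eq_continuous_at)
  then show ?case by (simp add: continuous_at_imp_continuous_on)
next
  case (Suc k)
  have "f differentiable (at z)" if "z \<in> S" for z
    using Suc.prems[OF that] by auto
  moreover have "Ck_on k S (\<lambda>z. frechet_derivative f (at z) v)" for v
    by (rule Suc.IH) (use Suc.prems in fastforce)
  ultimately show ?case by simp
qed

lemma smooth_on_local:
  assumes "\<And>z. z \<in> S \<Longrightarrow> \<exists>T. open T \<and> z \<in> T \<and> smooth_on T f"
  shows "smooth_on S f"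
  unfolding smooth_on_def
  by (intro allI Ck_on_local) (use assms in \<open>fastforce simp: smooth_on_def\<close>)

lemma smooth_on_differentiable: "smooth_on S f \<Longrightarrow> z \<in> S \<Longrightarrow> f differentiable (at z)"
  unfolding smooth_on_def by (metis Ck_on.simps(2))

lemma smooth_on_derivative: "smooth_on S f \<Longrightarrow> smooth_on S (\<lambda>z. frechet_derivative f (at z) v)"
  unfolding smooth_on_def by (metis Ck_on.simps(2))

lemma smooth_on_continuous: "smooth_on S f \<Longrightarrow> continuous_on S f"
  unfolding smooth_on_def by (metis Ck_on.simps(1))

lemma Ck_on_const: "Ck_on k S (\<lambda>z. c)"
  by (induction k arbitrary: c) auto

lemma smooth_on_const: "smooth_on S (\<lambda>z. c)"
  by (simp add: smooth_on_def Ck_on_const)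

lemma frechet_derivative_bounded_linear:
  assumes "bounded_linear h" "f differentiable (at z)"
  shows "frechet_derivative (\<lambda>z. h (f z)) (at z) = (\<lambda>v. h (frechet_derivative f (at z) v))"
  by (rule frechet_derivative_at[symmetric])
    (use assms bounded_linear.has_derivative frechet_derivative_works in blast)

lemma differentiable_bounded_linear:
  "bounded_linear h \<Longrightarrow> f differentiable (at z) \<Longrightarrow> (\<lambda>z. h (f z)) differentiable (at z)"
  unfolding differentiable_def using bounded_linear.has_derivative by blast

lemma frechet_derivative_bilinear:
  assumes "bounded_bilinear h" "f differentiable (at z)" "g differentiable (at z)"
  shows "frechet_derivative (\<lambda>z. h (f z) (g z)) (at z) =
    (\<lambda>v. h (f z) (frechet_derivative g (at z) v) + h (frechet_derivative f (at z) v) (g z))"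
  by (rule frechet_derivative_at[symmetric])
    (rule bounded_bilinear.FDERIV[OF assms(1) assms(2,3)[unfolded frechet_derivative_works]])

lemma differentiable_bilinear:
  "bounded_bilinear h \<Longrightarrow> f differentiable (at z) \<Longrightarrow> g differentiable (at z) \<Longrightarrow>
    (\<lambda>z. h (f z) (g z)) differentiable (at z)"
  unfolding differentiable_def using bounded_bilinear.FDERIV by blast

lemma frechet_derivative_add:
  assumes "f differentiable (at z)" "g differentiable (at z)"
  shows "frechet_derivative (\<lambda>z. f z + g z) (at z) =
    (\<lambda>v. frechet_derivative f (at z) v + frechet_derivative g (at z) v)"
  by (rule frechet_derivative_at[symmetric])
    (use assms has_derivative_add frechet_derivative_works in blast)

lemma Ck_on_bounded_linear:
  assumes h: "bounded_linear h" and S: "open S"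
  shows "Ck_on k S f \<Longrightarrow> Ck_on k S (\<lambda>z. h (f z))"
proof (induction k arbitrary: f)
  case 0
  then show ?case by (simp add: bounded_linear.continuous_on[OF h])
next
  case (Suc k)
  have "Ck_on k S (\<lambda>z. frechet_derivative (\<lambda>z. h (f z)) (at z) v)" for v
    by (rule Ck_on_cong[OF S, of "\<lambda>z. h (frechet_derivative f (at z) v)"])
      (use Suc in \<open>auto simp: frechet_derivative_bounded_linear[OF h]\<close>)
  then show ?case using Suc.prems by (auto intro: differentiable_bounded_linear[OF h])
qed

lemma Ck_on_add:
  assumes S: "open S"
  shows "Ck_on k S f \<Longrightarrow> Ck_on k S g \<Longrightarrow> Ck_on k S (\<lambda>z. f z + g z)"
proof (induction k arbitrary: f g)
  case 0
  then show ?case by (simp add: continuous_on_add)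
next
  case (Suc k)
  have "Ck_on k S (\<lambda>z. frechet_derivative (\<lambda>z. f z + g z) (at z) v)" for v
    by (rule Ck_on_cong[OF S, of "\<lambda>z. frechet_derivative f (at z) v + frechet_derivative g (at z) v"])
      (use Suc in \<open>auto simp: frechet_derivative_add\<close>)
  then show ?case using Suc.prems by auto
qed

lemma Ck_on_bilinear:
  assumes h: "bounded_bilinear h" and S: "open S"
  shows "Ck_on k S f \<Longrightarrow> Ck_on k S g \<Longrightarrow> Ck_on k S (\<lambda>z. h (f z) (g z))"
proof (induction k arbitrary: f g)
  case 0
  then show ?case by (simp add: bounded_bilinear.continuous_on[OF h])
next
  case (Suc k)
  have "Ck_on k S f" "Ck_on k S g" using Suc.prems Ck_on_Suc_D by blast+
  then have "Ck_on k S (\<lambda>z. h (f z) (frechet_derivative g (at z) v) + h (frechet_derivative f (at z) v) (g z))" for v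
    using Suc.prems by (intro Ck_on_add[OF S] Suc.IH) auto
  then have "Ck_on k S (\<lambda>z. frechet_derivative (\<lambda>z. h (f z) (g z)) (at z) v)" for v
    by (rule Ck_on_cong[OF S, rotated]) (use Suc.prems in \<open>auto simp: frechet_derivative_bilinear[OF h]\<close>)
  then show ?case using Suc.prems by (auto intro: differentiable_bilinear[OF h])
qed

lemma smooth_on_bounded_linear: "bounded_linear h \<Longrightarrow> open S \<Longrightarrow> smooth_on S f \<Longrightarrow> smooth_on S (\<lambda>z. h (f z))"
  by (simp add: smooth_on_def Ck_on_bounded_linear)

lemma smooth_on_add: "open S \<Longrightarrow> smooth_on S f \<Longrightarrow> smooth_on S g \<Longrightarrow> smooth_on S (\<lambda>z. f z + g z)"
  by (simp add: smooth_on_def Ck_on_add)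

lemma smooth_on_bilinear:
  "bounded_bilinear h \<Longrightarrow> open S \<Longrightarrow> smooth_on S f \<Longrightarrow> smooth_on S g \<Longrightarrow> smooth_on S (\<lambda>z. h (f z) (g z))"
  by (simp add: smooth_on_def Ck_on_bilinear)

lemma smooth_on_scaleC: "open S \<Longrightarrow> smooth_on S f \<Longrightarrow> smooth_on S (\<lambda>z. c *\<^sub>C (f z :: 'b::complex_normed))"
  by (rule smooth_on_bounded_linear[OF bounded_linear_scaleC])

lemma smooth_on_sum:
  "open S \<Longrightarrow> (\<And>i. i \<in> I \<Longrightarrow> smooth_on S (f i)) \<Longrightarrow> smooth_on S (\<lambda>z. \<Sum>i\<in>I. f i z)"
  by (induction I rule: infinite_finite_induct) (simp_all add: smooth_on_const smooth_on_add)

lemma smooth_on_matrix_mult: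
  fixes f :: "'a::real_normed_vector \<Rightarrow> complex^'n^'m" and g :: "'a \<Rightarrow> complex^'k^'n"
  shows "open S \<Longrightarrow> smooth_on S f \<Longrightarrow> smooth_on S g \<Longrightarrow> smooth_on S (\<lambda>z. f z ** g z)"
  by (rule smooth_on_bilinear[OF bounded_bilinear_matrix_mult])

lemma differentiable_scaleC:
  "f differentiable (at z) \<Longrightarrow> (\<lambda>z. c *\<^sub>C (f z :: 'b::complex_normed)) differentiable (at z)"
  by (rule differentiable_bounded_linear[OF bounded_linear_scaleC])

lemma dbar_dir_cong:
  assumes "f differentiable (at z)" "open S" "z \<in> S" "\<And>y. y \<in> S \<Longrightarrow> f y = g y"
  shows "dbar_dir f z v = dbar_dir g z v"
  using frechet_derivative_transform_within_open[OF assms] by (simp add: dbar_dir_def)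

lemma dbar_dir_const [simp]: "dbar_dir (\<lambda>z. c) z v = 0"
  by (simp add: dbar_dir_def)

lemma dbar_dir_add:
  fixes f g :: "_ \<Rightarrow> 'b::complex_normed"
  assumes "f differentiable (at z)" "g differentiable (at z)"
  shows "dbar_dir (\<lambda>z. f z + g z) z v = dbar_dir f z v + dbar_dir g z v"
  by (simp add: dbar_dir_def frechet_derivative_add[OF assms] scaleC_add_right)

lemma dbar_dir_bounded_linear:
  fixes f :: "_ \<Rightarrow> 'b::complex_normed" and h :: "'b \<Rightarrow> 'c::complex_normed"
  assumes h: "bounded_linear h" and hC: "\<And>c x. h (c *\<^sub>C x) = c *\<^sub>C h x" and f: "f differentiable (at z)"
  shows "dbar_dir (\<lambda>z. h (f z)) z v = h (dbar_dir f z v)"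
  by (simp add: dbar_dir_def frechet_derivative_bounded_linear[OF h f] hC
      linear_add[OF bounded_linear.linear[OF h]])

lemma dbar_dir_scaleC:
  fixes f :: "_ \<Rightarrow> 'b::complex_normed"
  shows "f differentiable (at z) \<Longrightarrow> dbar_dir (\<lambda>z. c *\<^sub>C f z) z v = c *\<^sub>C dbar_dir f z v"
  by (rule dbar_dir_bounded_linear[OF bounded_linear_scaleC]) (simp_all add: mult.commute)

lemma dbar_dir_sum:
  fixes f :: "_ \<Rightarrow> _ \<Rightarrow> 'b::complex_normed"
  assumes "\<And>i. i \<in> I \<Longrightarrow> f i differentiable (at z)" "finite I"
  shows "dbar_dir (\<lambda>z. \<Sum>i\<in>I. f i z) z v = (\<Sum>i\<in>I. dbar_dir (f i) z v)"
  using assms(2,1) by (induction I rule: finite_induct) (simp_all add: dbar_dir_add)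

lemma dbar_dir_bilinear:
  fixes h :: "'b::complex_normed \<Rightarrow> 'c::complex_normed \<Rightarrow> 'd::complex_normed"
  assumes h: "bounded_bilinear h" and hC: "\<And>c x y. h (c *\<^sub>C x) y = c *\<^sub>C h x y" "\<And>c x y. h x (c *\<^sub>C y) = c *\<^sub>C h x y"
    and fg: "f differentiable (at z)" "g differentiable (at z)"
  shows "dbar_dir (\<lambda>z. h (f z) (g z)) z v = h (dbar_dir f z v) (g z) + h (f z) (dbar_dir g z v)"
  by (simp add: dbar_dir_def frechet_derivative_bilinear[OF h fg] hC scaleC_add_right
      bounded_bilinear.add_left[OF h] bounded_bilinear.add_right[OF h])

lemma dbar_dir_matrix_mult:
  fixes f :: "'a::{real_normed_vector,cvs} \<Rightarrow> complex^'n^'m" and g :: "'a \<Rightarrow> complex^'k^'n"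
  assumes "f differentiable (at z)" "g differentiable (at z)"
  shows "dbar_dir (\<lambda>z. f z ** g z) z v = dbar_dir f z v ** g z + f z ** dbar_dir g z v"
  by (rule dbar_dir_bilinear[OF bounded_bilinear_matrix_mult]) (simp_all add: matrix_mul_scaleC assms)

text \<open>The combination of \<open>D v\<close> and \<open>D (\<i> v)\<close> in \<open>dbar_dir\<close> is the projection of the real linear map \<open>D\<close> to its
  antilinear part.\<close>

lemma dbar_dir_direction_antilinear:
  fixes f :: "'a::complex_normed \<Rightarrow> 'b::complex_normed"
  assumes "f differentiable (at z)"
  shows "dbar_dir f z (a *\<^sub>C v + b *\<^sub>C w) = cnj a *\<^sub>C dbar_dir f z v + cnj b *\<^sub>C dbar_dir f z w"
proof -
  let ?D = "frechet_derivative f (at z)"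
  have lin: "linear ?D" by (rule linear_frechet_derivative[OF assms])
  have add: "dbar_dir f z (v + w) = dbar_dir f z v + dbar_dir f z w" for v w
    by (simp add: dbar_dir_def scaleC_add_right linear_add[OF lin])
  have scale: "dbar_dir f z (a *\<^sub>C v) = cnj a *\<^sub>C dbar_dir f z v" for a v
  proof -
    obtain r s where a: "a = Complex r s" by (cases a)
    have r: "?D (complex_of_real r *\<^sub>C u) = complex_of_real r *\<^sub>C ?D u" for r u
      using linear_scale[OF lin, of r u] by (simp add: scaleR_eq_scaleC)
    have c: "a = complex_of_real r + complex_of_real s * \<i>" "cnj a = complex_of_real r - complex_of_real s * \<i>"
      by (simp_all add: a complex_eq_iff)
    have D: "?D (a *\<^sub>C u) = complex_of_real r *\<^sub>C ?D u + complex_of_real s *\<^sub>C ?D (\<i> *\<^sub>C u)" for u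
      unfolding c(1) scaleC_add_left linear_add[OF lin] r scaleC_scaleC[symmetric] ..
    have ii: "?D (\<i> *\<^sub>C \<i> *\<^sub>C v) = - ?D v"
      using linear_neg[OF lin, of v] by (simp)
    have comm: "?D (\<i> *\<^sub>C a *\<^sub>C v) = ?D (a *\<^sub>C \<i> *\<^sub>C v)"
      by (simp add: mult.commute)
    have "dbar_dir f z (a *\<^sub>C v) = (1/2) *\<^sub>C (complex_of_real r *\<^sub>C ?D v + complex_of_real s *\<^sub>C ?D (\<i> *\<^sub>C v)
       + \<i> *\<^sub>C (complex_of_real r *\<^sub>C ?D (\<i> *\<^sub>C v) - complex_of_real s *\<^sub>C ?D v))"
      unfolding dbar_dir_def comm D ii by simp
    also have "\<dots> = cnj a *\<^sub>C dbar_dir f z v"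
      unfolding dbar_dir_def c(2)
      by (simp add: scaleC_add_right cvs.scale_right_diff_distrib cvs.scale_left_diff_distrib algebra_simps)
    finally show ?thesis .
  qed
  show ?thesis unfolding add scale ..
qed

definition hol_at :: "('a::{real_normed_vector,cvs} \<Rightarrow> 'b::{real_normed_vector,cvs}) \<Rightarrow> 'a \<Rightarrow> bool"
  where "hol_at f z \<longleftrightarrow> f differentiable (at z) \<and>
    (\<forall>c v. frechet_derivative f (at z) (c *\<^sub>C v) = c *\<^sub>C frechet_derivative f (at z) v)"

lemma hol_on_hol_at: "hol_on S f \<Longrightarrow> z \<in> S \<Longrightarrow> hol_at f z"
  unfolding hol_on_def hol_at_def using smooth_on_differentiable by blast

lemma dbar_dir_hol:
  fixes f :: "_ \<Rightarrow> 'b::complex_normed"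
  shows "hol_at f z \<Longrightarrow> dbar_dir f z v = 0"
  by (simp add: dbar_dir_def hol_at_def)

lemma hol_at_bounded_linear:
  assumes "bounded_linear h" "\<And>c x. h (c *\<^sub>C x) = c *\<^sub>C h x" "hol_at f z"
  shows "hol_at (\<lambda>z. h (f z)) z"
  using assms by (simp add: hol_at_def frechet_derivative_bounded_linear differentiable_bounded_linear)

lemma dbar_dir_cnj_hol:
  assumes "hol_at u z"
  shows "dbar_dir (\<lambda>z. cnj (u z)) z v = cnj (frechet_derivative u (at z) v)"
    and "(\<lambda>z. cnj (u z)) differentiable (at z)"
proof -
  have u: "u differentiable (at z)" and uC: "frechet_derivative u (at z) (\<i> *\<^sub>C v) = \<i> * frechet_derivative u (at z) v" for v
    using assms by (auto simp: hol_at_def scaleC_complex_def)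
  show "dbar_dir (\<lambda>z. cnj (u z)) z v = cnj (frechet_derivative u (at z) v)"
    by (simp add: dbar_dir_def frechet_derivative_bounded_linear[OF bounded_linear_cnj u] uC scaleC_complex_def)
  show "(\<lambda>z. cnj (u z)) differentiable (at z)"
    by (rule differentiable_bounded_linear[OF bounded_linear_cnj u])
qed

lemma dbar_dir_compose_hol:
  fixes f :: "'b::complex_normed \<Rightarrow> 'c::complex_normed"
  assumes "hol_at \<phi> z" "f differentiable (at (\<phi> z))"
  shows "dbar_dir (\<lambda>z. f (\<phi> z)) z v = dbar_dir f (\<phi> z) (frechet_derivative \<phi> (at z) v)"
    and "(\<lambda>z. f (\<phi> z)) differentiable (at z)"
proof -
  have \<phi>: "\<phi> differentiable (at z)" using assms by (simp add: hol_at_def)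
  have "frechet_derivative (\<lambda>z. f (\<phi> z)) (at z) = frechet_derivative f (at (\<phi> z)) \<circ> frechet_derivative \<phi> (at z)"
    using frechet_derivative_compose[OF \<phi> assms(2)] by (simp add: comp_def)
  then show "dbar_dir (\<lambda>z. f (\<phi> z)) z v = dbar_dir f (\<phi> z) (frechet_derivative \<phi> (at z) v)"
    using assms by (simp add: dbar_dir_def hol_at_def)
  show "(\<lambda>z. f (\<phi> z)) differentiable (at z)"
    using differentiable_chain_at[OF \<phi> assms(2)] by (simp add: comp_def)
qed

lemma has_real_derivative_line:
  fixes f :: "'a::real_normed_vector \<Rightarrow> real"
  assumes "f differentiable (at (p + s *\<^sub>R v))"
  shows "((\<lambda>s. f (p + s *\<^sub>R v)) has_real_derivative frechet_derivative f (at (p + s *\<^sub>R v)) v) (at s)"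
proof -
  have l: "((\<lambda>s. p + s *\<^sub>R v) has_derivative (\<lambda>h. h *\<^sub>R v)) (at s)"
    by (auto intro!: derivative_eq_intros)
  have "((\<lambda>s. f (p + s *\<^sub>R v)) has_derivative (\<lambda>h. frechet_derivative f (at (p + s *\<^sub>R v)) (h *\<^sub>R v))) (at s)"
    using has_derivative_compose[OF l assms[unfolded frechet_derivative_works]] .
  moreover have "(\<lambda>h. frechet_derivative f (at (p + s *\<^sub>R v)) (h *\<^sub>R v)) = (*) (frechet_derivative f (at (p + s *\<^sub>R v)) v)"
    by (auto simp: fun_eq_iff linear_scale[OF linear_frechet_derivative[OF assms]])
  ultimately show ?thesis
    by (simp only: has_field_derivative_def)
qed

text \<open>The mean value theorem is applied first in direction \<open>v\<close>, to the difference of two parallel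
  translates of \<open>f\<close>, and then in direction \<open>w\<close>.\<close>

lemma second_difference:
  fixes f :: "'a::real_normed_vector \<Rightarrow> real"
  assumes S: "smooth_on S f" and h: "0 < h"
    and sq: "\<And>s t. 0 \<le> s \<Longrightarrow> s \<le> h \<Longrightarrow> 0 \<le> t \<Longrightarrow> t \<le> h \<Longrightarrow> z + s *\<^sub>R v + t *\<^sub>R w \<in> S"
  shows "\<exists>s t. 0 \<le> s \<and> s \<le> h \<and> 0 \<le> t \<and> t \<le> h \<and>
    f (z + h *\<^sub>R v + h *\<^sub>R w) - f (z + h *\<^sub>R v) - f (z + h *\<^sub>R w) + f z =
    h * (h * frechet_derivative (\<lambda>y. frechet_derivative f (at y) v) (at (z + s *\<^sub>R v + t *\<^sub>R w)) w)"
proof -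
  let ?D = "\<lambda>y. frechet_derivative f (at y) v"
  have d1: "((\<lambda>s. f (z + s *\<^sub>R v + t *\<^sub>R w)) has_real_derivative ?D (z + s *\<^sub>R v + t *\<^sub>R w)) (at s)"
    if "0 \<le> s" "s \<le> h" "0 \<le> t" "t \<le> h" for s t
    using has_real_derivative_line[of f "z + t *\<^sub>R w" s v] smooth_on_differentiable[OF S sq[OF that]]
    by (simp add: add.assoc add.commute add.left_commute)
  have "\<exists>s>0. s < h \<and> (f (z + h *\<^sub>R v + h *\<^sub>R w) - f (z + h *\<^sub>R v + 0 *\<^sub>R w)) - (f (z + 0 *\<^sub>R v + h *\<^sub>R w) - f (z + 0 *\<^sub>R v + 0 *\<^sub>R w)) =
     (h - 0) * (?D (z + s *\<^sub>R v + h *\<^sub>R w) - ?D (z + s *\<^sub>R v + 0 *\<^sub>R w))"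
    by (rule MVT2[OF h, of "\<lambda>s. f (z + s *\<^sub>R v + h *\<^sub>R w) - f (z + s *\<^sub>R v + 0 *\<^sub>R w)"])
      (use h in \<open>intro DERIV_diff d1; simp\<close>)
  then obtain s where s: "0 < s" "s < h"
    "f (z + h *\<^sub>R v + h *\<^sub>R w) - f (z + h *\<^sub>R v) - f (z + h *\<^sub>R w) + f z =
     h * (?D (z + s *\<^sub>R v + h *\<^sub>R w) - ?D (z + s *\<^sub>R v))"
    by (auto simp: algebra_simps)
  have "\<exists>t>0. t < h \<and> ?D (z + s *\<^sub>R v + h *\<^sub>R w) - ?D (z + s *\<^sub>R v + 0 *\<^sub>R w) =
     (h - 0) * frechet_derivative ?D (at (z + s *\<^sub>R v + t *\<^sub>R w)) w"
    by (rule MVT2[OF h], rule has_real_derivative_line, rule smooth_on_differentiable[OF smooth_on_derivative[OF S] sq])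
      (use s in auto)
  then obtain t where "0 < t" "t < h"
     "?D (z + s *\<^sub>R v + h *\<^sub>R w) - ?D (z + s *\<^sub>R v) = h * frechet_derivative ?D (at (z + s *\<^sub>R v + t *\<^sub>R w)) w"
    by auto
  then show ?thesis using s by (intro exI[of _ s] exI[of _ t]) auto
qed

text \<open>The second difference of \<open>f\<close> over a small parallelogram is symmetric in the two directions, and divided
  by \<open>h\<^sup>2\<close> it is near to either of the mixed derivatives.\<close>

lemma symmetric_second_derivative_real:
  fixes f :: "'a::real_normed_vector \<Rightarrow> real"
  assumes S: "smooth_on S f" "open S" "z \<in> S"
  shows "frechet_derivative (\<lambda>y. frechet_derivative f (at y) v) (at z) w =
    frechet_derivative (\<lambda>y. frechet_derivative f (at y) w) (at z) v"
proof -
  define H where "H = (\<lambda>v w y. frechet_derivative (\<lambda>y. frechet_derivative f (at y) v) (at y) w)"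
  have cont: "\<exists>d>0. \<forall>y. dist y z < d \<longrightarrow> dist (H v w y) (H v w z) < e" if "e > 0" for v w e
  proof -
    have "continuous_on S (H v w)"
      unfolding H_def by (intro smooth_on_continuous smooth_on_derivative S)
    then have "isCont (H v w) z" using S by (simp add: continuous_on_eq_continuous_at)
    then show ?thesis using that by (auto simp: continuous_at_eps_delta)
  qed
  obtain r where r: "r > 0" "ball z r \<subseteq> S" using S openE by blast
  have "dist (H v w z) (H w v z) < e" if e: "e > 0" for e
  proof -
    obtain d1 where d1: "d1 > 0" "\<And>y. dist y z < d1 \<Longrightarrow> dist (H v w y) (H v w z) < e / 2"
      using cont[of "e/2" v w] e by auto
    obtain d2 where d2: "d2 > 0" "\<And>y. dist y z < d2 \<Longrightarrow> dist (H w v y) (H w v z) < e / 2"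
      using cont[of "e/2" w v] e by auto
    define d where "d = min r (min d1 d2)"
    \<comment> \<open>so small that the whole parallelogram lies within distance \<open>d\<close> of \<open>z\<close>\<close>
    define h where "h = d / (norm v + norm w + 1)"
    have M: "norm v + norm w + 1 > 0" by (smt (verit) norm_ge_zero)
    have d: "d > 0" "d \<le> r" "d \<le> d1" "d \<le> d2" using r d1 d2 by (auto simp: d_def)
    then have h: "h > 0" using M by (simp add: h_def)
    have near: "dist (z + s *\<^sub>R v + t *\<^sub>R w) z < d" if "0 \<le> s" "s \<le> h" "0 \<le> t" "t \<le> h" for s t
    proof -
      have "norm (s *\<^sub>R v + t *\<^sub>R w) \<le> s * norm v + t * norm w"
        using norm_triangle_ineq[of "s *\<^sub>R v" "t *\<^sub>R w"] that by simp
      also have "\<dots> \<le> h * norm v + h * norm w"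
        using that by (intro add_mono mult_right_mono) auto
      also have "\<dots> < h * (norm v + norm w + 1)" using h by (simp add: algebra_simps)
      also have "\<dots> = d" using M by (simp add: h_def)
      finally show ?thesis by (simp add: dist_norm add.assoc)
    qed
    have near': "z + s *\<^sub>R v + t *\<^sub>R w \<in> S" if "0 \<le> s" "s \<le> h" "0 \<le> t" "t \<le> h" for s t
      using near[OF that] d r by (auto simp: dist_commute)
    have near'': "z + s *\<^sub>R w + t *\<^sub>R v \<in> S" if "0 \<le> s" "s \<le> h" "0 \<le> t" "t \<le> h" for s t
      using near'[of t s] that by (simp add: add.commute add.left_commute)
    obtain s t where st: "0 \<le> s" "s \<le> h" "0 \<le> t" "t \<le> h"
      "f (z + h *\<^sub>R v + h *\<^sub>R w) - f (z + h *\<^sub>R v) - f (z + h *\<^sub>R w) + f z = h * (h * H v w (z + s *\<^sub>R v + t *\<^sub>R w))"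
      using second_difference[OF S(1) h near'] unfolding H_def by blast
    obtain s' t' where st': "0 \<le> s'" "s' \<le> h" "0 \<le> t'" "t' \<le> h"
      "f (z + h *\<^sub>R w + h *\<^sub>R v) - f (z + h *\<^sub>R w) - f (z + h *\<^sub>R v) + f z = h * (h * H w v (z + s' *\<^sub>R w + t' *\<^sub>R v))"
      using second_difference[OF S(1) h near''] unfolding H_def by blast
    have comm: "z + h *\<^sub>R w + h *\<^sub>R v = z + h *\<^sub>R v + h *\<^sub>R w" "z + s' *\<^sub>R w + t' *\<^sub>R v = z + t' *\<^sub>R v + s' *\<^sub>R w"
      by (simp_all add: add.commute add.left_commute)
    have "h * (h * H v w (z + s *\<^sub>R v + t *\<^sub>R w)) = h * (h * H w v (z + t' *\<^sub>R v + s' *\<^sub>R w))"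
      using st(5) st'(5) unfolding comm by linarith
    then have "H v w (z + s *\<^sub>R v + t *\<^sub>R w) = H w v (z + t' *\<^sub>R v + s' *\<^sub>R w)" using h by simp
    moreover have "dist (H v w (z + s *\<^sub>R v + t *\<^sub>R w)) (H v w z) < e / 2"
      using near[OF st(1-4)] d by (intro d1) auto
    moreover have "dist (H w v (z + t' *\<^sub>R v + s' *\<^sub>R w)) (H w v z) < e / 2"
      using near[OF st'(3,4,1,2)] d by (intro d2) auto
    ultimately show ?thesis
      by (metis dist_commute dist_triangle_half_r)
  qed
  then have "H v w z = H w v z" by (metis dist_nz less_irrefl)
  then show ?thesis by (simp add: H_def)
qed

lemma symmetric_second_derivative:
  fixes f :: "'a::real_normed_vector \<Rightarrow> 'b::euclidean_space"
  assumes S: "smooth_on S f" "open S" "z \<in> S"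
  shows "frechet_derivative (\<lambda>y. frechet_derivative f (at y) v) (at z) w =
    frechet_derivative (\<lambda>y. frechet_derivative f (at y) w) (at z) v"
proof (rule euclidean_eqI)
  fix b :: 'b
  have b: "bounded_linear (\<lambda>x. x \<bullet> b)" by (rule bounded_linear_inner_left)
  have *: "frechet_derivative (\<lambda>y. frechet_derivative (\<lambda>y. f y \<bullet> b) (at y) v) (at z) w =
     frechet_derivative (\<lambda>y. frechet_derivative f (at y) v) (at z) w \<bullet> b" for v w
  proof -
    have e: "frechet_derivative f (at y) v \<bullet> b = frechet_derivative (\<lambda>y. f y \<bullet> b) (at y) v" if "y \<in> S" for y
      using frechet_derivative_bounded_linear[OF b smooth_on_differentiable[OF S(1) that]] by simp
    have d: "(\<lambda>y. frechet_derivative f (at y) v) differentiable (at z)"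
      by (rule smooth_on_differentiable[OF smooth_on_derivative[OF S(1)] S(3)])
    have "frechet_derivative (\<lambda>y. frechet_derivative f (at y) v \<bullet> b) (at z) =
      frechet_derivative (\<lambda>y. frechet_derivative (\<lambda>y. f y \<bullet> b) (at y) v) (at z)"
      by (rule frechet_derivative_transform_within_open[OF _ S(2,3) e])
        (rule differentiable_bounded_linear[OF b d])
    then show ?thesis using frechet_derivative_bounded_linear[OF b d] by metis
  qed
  show "frechet_derivative (\<lambda>y. frechet_derivative f (at y) v) (at z) w \<bullet> b =
    frechet_derivative (\<lambda>y. frechet_derivative f (at y) w) (at z) v \<bullet> b"
    unfolding *[symmetric]
    by (rule symmetric_second_derivative_real[OF smooth_on_bounded_linear[OF b S(2,1)] S(2,3)])
qed

lemma alt_multilinear_slot_sum: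
  assumes "alt_multilinear \<tau> f" "\<tau> 0 = 0" "finite I"
  shows "f (us @ (\<Sum>e\<in>I. c e *\<^sub>C y e) # ws) = (\<Sum>e\<in>I. \<tau> (c e) *\<^sub>C f (us @ y e # ws))"
proof -
  have lin: "f (us @ (a *\<^sub>C v + b *\<^sub>C w) # ws) = \<tau> a *\<^sub>C f (us @ v # ws) + \<tau> b *\<^sub>C f (us @ w # ws)" for a v b w
    using assms by (simp add: alt_multilinear_def)
  have \<tau>1: "\<tau> 1 *\<^sub>C f (us @ v # ws) = f (us @ v # ws)" for v
    using lin[of 1 v 0 0] assms(2) by simp
  have z: "f (us @ 0 # ws) = 0" using lin[of 0 0 0 0] assms(2) by simp
  show ?thesis using assms(3)
  proof (induction I rule: finite_induct)
    case (insert e I)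
    have "f (us @ (c e *\<^sub>C y e + (\<Sum>e\<in>I. c e *\<^sub>C y e)) # ws) =
        \<tau> (c e) *\<^sub>C f (us @ y e # ws) + f (us @ (\<Sum>e\<in>I. c e *\<^sub>C y e) # ws)"
      using lin[of "c e" "y e" 1 "\<Sum>e\<in>I. c e *\<^sub>C y e"] \<tau>1 by simp
    then show ?case using insert by simp
  qed (simp add: z)
qed

lemma vec_axis_expansion: "(x :: complex^'n) = (\<Sum>e\<in>UNIV. x $ e *\<^sub>C axis e 1)"
  by (simp add: vec_eq_iff scaleC_vec_def scaleC_complex_def axis_def if_distrib sum.delta cong: if_cong)

text \<open>A multilinear expression with holomorphically varying arguments. For \<open>\<tau> = cnj\<close> the derivatives of the
  arguments contribute (\<open>\<kappa> = 1\<close>), for linear slots they do not (\<open>\<kappa> = 0\<close>). The proof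
  expands the first argument in the standard basis, which turns it into scalar factors.\<close>

lemma dbar_dir_slots:
  fixes G :: "(complex^'m) list \<Rightarrow> 'z::complex_normed \<Rightarrow> 'w::complex_normed"
  assumes "\<And>z. alt_multilinear \<tau> (\<lambda>us. G us z)" and "\<tau> 0 = 0"
    and "\<And>us. (\<lambda>z. G us z) differentiable (at z0)"
    and \<tau>: "\<And>u. hol_at u z0 \<Longrightarrow> (\<lambda>z. \<tau> (u z)) differentiable (at z0) \<and>
      dbar_dir (\<lambda>z. \<tau> (u z)) z0 v = \<kappa> * \<tau> (frechet_derivative u (at z0) v)"
    and "\<And>u. u \<in> set us \<Longrightarrow> hol_at u z0"
  shows "(\<lambda>z. G (map (\<lambda>u. u z) us) z) differentiable (at z0) \<and>
    dbar_dir (\<lambda>z. G (map (\<lambda>u. u z) us) z) z0 v = dbar_dir (\<lambda>z. G (map (\<lambda>u. u z0) us) z) z0 v +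
      \<kappa> *\<^sub>C (\<Sum>a<length us. G ((map (\<lambda>u. u z0) us)[a := frechet_derivative (us ! a) (at z0) v]) z0)"
  using assms(1,3,5)
proof (induction us arbitrary: G)
  case Nil
  then show ?case by simp
next
  case (Cons u us)
  let ?U = "\<lambda>z. map (\<lambda>u. u z) us"
  have expand: "G (x # ws) z = (\<Sum>e\<in>UNIV. \<tau> (x $ e) *\<^sub>C G (axis e 1 # ws) z)" for x ws z
    using alt_multilinear_slot_sum[OF Cons.prems(1)[of z] assms(2), of UNIV "[]" "\<lambda>e. x $ e" "\<lambda>e. axis e 1" ws]
    by (simp add: vec_axis_expansion[symmetric])
  have alt: "alt_multilinear \<tau> (\<lambda>us. G (y # us) z)" for y z
    using Cons.prems(1)[of z] unfolding alt_multilinear_def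
    by (metis append_Cons distinct.simps(2))
  have u: "hol_at u z0" using Cons.prems by simp
  have ue: "hol_at (\<lambda>z. u z $ e) z0" for e
    by (rule hol_at_bounded_linear[OF bounded_linear_vec_nth _ u]) (simp add: scaleC_vec_def)
  have due: "frechet_derivative (\<lambda>z. u z $ e) (at z0) v = frechet_derivative u (at z0) v $ e" for e
    using frechet_derivative_bounded_linear[OF bounded_linear_vec_nth, of u z0 e] u by (simp add: hol_at_def)
  have IH: "(\<lambda>z. G (axis e 1 # ?U z) z) differentiable (at z0)"
    "dbar_dir (\<lambda>z. G (axis e 1 # ?U z) z) z0 v = dbar_dir (\<lambda>z. G (axis e 1 # ?U z0) z) z0 v +
      \<kappa> *\<^sub>C (\<Sum>a<length us. G (axis e 1 # (?U z0)[a := frechet_derivative (us ! a) (at z0) v]) z0)" for e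
    using Cons.IH[of "\<lambda>us z. G (axis e 1 # us) z"] alt Cons.prems(2,3) by auto
  have d: "(\<lambda>z. \<tau> (u z $ e) *\<^sub>C G (axis e 1 # ?U z) z) differentiable (at z0)" for e
    by (rule differentiable_bilinear[OF bounded_bilinear_scaleC _ IH(1)]) (use \<tau>[OF ue] in auto)
  have exp1: "G (map (\<lambda>u. u z) (u # us)) z = (\<Sum>e\<in>UNIV. \<tau> (u z $ e) *\<^sub>C G (axis e 1 # ?U z) z)" for z
    by (simp only: list.map) (rule expand)
  have diff: "(\<lambda>z. G (map (\<lambda>u. u z) (u # us)) z) differentiable (at z0)"
    unfolding exp1 by (rule differentiable_sum) (use d in auto)
  have dd: "dbar_dir (\<lambda>z. \<tau> (u z $ e) *\<^sub>C G (axis e 1 # ?U z) z) z0 v =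
      (\<kappa> * \<tau> (frechet_derivative u (at z0) v $ e)) *\<^sub>C G (axis e 1 # ?U z0) z0 +
      \<tau> (u z0 $ e) *\<^sub>C dbar_dir (\<lambda>z. G (axis e 1 # ?U z) z) z0 v" for e
    using \<tau>[OF ue, of e] due
    by (subst dbar_dir_bilinear[OF bounded_bilinear_scaleC _ _ _ IH(1)]) (auto simp: scaleC_complex_def mult.commute)
  have c: "dbar_dir (\<lambda>z. \<Sum>e\<in>UNIV. \<tau> (u z0 $ e) *\<^sub>C G (axis e 1 # ?U z0) z) z0 v =
     (\<Sum>e\<in>UNIV. \<tau> (u z0 $ e) *\<^sub>C dbar_dir (\<lambda>z. G (axis e 1 # ?U z0) z) z0 v)"
    by (subst dbar_dir_sum) (auto intro!: differentiable_scaleC Cons.prems(2) simp: dbar_dir_scaleC[OF Cons.prems(2)])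
  have "dbar_dir (\<lambda>z. G (map (\<lambda>u. u z) (u # us)) z) z0 v =
     (\<Sum>e\<in>UNIV. dbar_dir (\<lambda>z. \<tau> (u z $ e) *\<^sub>C G (axis e 1 # ?U z) z) z0 v)"
    unfolding exp1 by (rule dbar_dir_sum) (use d in auto)
  also have "\<dots> = \<kappa> *\<^sub>C G (frechet_derivative u (at z0) v # ?U z0) z0 +
     dbar_dir (\<lambda>z. G (u z0 # ?U z0) z) z0 v +
     \<kappa> *\<^sub>C (\<Sum>a<length us. G (u z0 # (?U z0)[a := frechet_derivative (us ! a) (at z0) v]) z0)"
  proof -
    let ?X = "\<lambda>a e. G (axis e 1 # (?U z0)[a := frechet_derivative (us ! a) (at z0) v]) z0"
    have "(\<Sum>e\<in>UNIV. \<tau> (u z0 $ e) *\<^sub>C \<kappa> *\<^sub>C (\<Sum>a<length us. ?X a e)) =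
       (\<Sum>e\<in>UNIV. \<Sum>a<length us. \<kappa> *\<^sub>C \<tau> (u z0 $ e) *\<^sub>C ?X a e)"
      by (simp add: cvs.scale_sum_right mult.commute)
    also have "\<dots> = \<kappa> *\<^sub>C (\<Sum>a<length us. \<Sum>e\<in>UNIV. \<tau> (u z0 $ e) *\<^sub>C ?X a e)"
      by (subst sum.swap) (simp only: cvs.scale_sum_right)
    finally have "(\<Sum>e\<in>UNIV. \<tau> (u z0 $ e) *\<^sub>C \<kappa> *\<^sub>C (\<Sum>a<length us. ?X a e)) = \<dots>" .
    moreover have "(\<Sum>e\<in>UNIV. (\<kappa> * \<tau> (frechet_derivative u (at z0) v $ e)) *\<^sub>C G (axis e 1 # ?U z0) z0) =
       \<kappa> *\<^sub>C (\<Sum>e\<in>UNIV. \<tau> (frechet_derivative u (at z0) v $ e) *\<^sub>C G (axis e 1 # ?U z0) z0)"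
      by (simp add: cvs.scale_sum_right)
    ultimately show ?thesis
      unfolding dd IH(2) expand[of "frechet_derivative u (at z0) v"] expand[of "u z0"] c
      by (simp only: sum.distrib scaleC_add_right add.assoc)
  qed
  finally show ?case using diff
    by (simp add: sum.lessThan_Suc_shift scaleC_add_right add_ac del: sum.lessThan_Suc)
qed

section \<open>Alternating maps and forms on the manifold\<close>

lemma alt_multilinear_skew:
  assumes "alt_multilinear \<tau> f" "\<tau> 1 = 1"
  shows "f (us @ v # w # ws) = - f (us @ w # v # ws)"
proof -
  have lin: "f (us @ (v + w) # ws) = f (us @ v # ws) + f (us @ w # ws)" for us ws v w
  proof -
    have "f (us @ (1 *\<^sub>C v + 1 *\<^sub>C w) # ws) = \<tau> 1 *\<^sub>C f (us @ v # ws) + \<tau> 1 *\<^sub>C f (us @ w # ws)"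
      using assms(1) unfolding alt_multilinear_def by blast
    then show ?thesis by (simp add: assms(2))
  qed
  have dup: "f (us @ v # v # ws) = 0" for v
    using assms(1) by (simp add: alt_multilinear_def)
  have "f (us @ (v + w) # (v + w) # ws) = f (us @ v # w # ws) + f (us @ w # v # ws)"
    using lin[of "us @ [v + w]" v w ws] by (simp add: lin dup add.commute)
  then have "f (us @ v # w # ws) + f (us @ w # v # ws) = 0" by (simp only: dup)
  then show ?thesis by (rule eq_neg_iff_add_eq_0[THEN iffD2])
qed

lemma alt_multilinear_move:
  assumes f: "alt_multilinear \<tau> f" "\<tau> 1 = 1"
  shows "f (us @ y # ws) = (-1) ^ length us *\<^sub>C f (y # us @ ws)"
proof (induction us arbitrary: ws rule: rev_induct)
  case (snoc u us)
  have "f ((us @ [u]) @ y # ws) = - f (us @ y # u # ws)"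
    using alt_multilinear_skew[OF f, of us u y ws] by simp
  then show ?case using snoc.IH[of "u # ws"] by (simp)
qed simp

lemma alt_multilinear_compose:
  assumes "alt_multilinear \<tau> f" "\<And>x y. h (x + y) = h x + h y" "\<And>c x. h (c *\<^sub>C x) = c *\<^sub>C h x"
  shows "alt_multilinear \<tau> (\<lambda>us. h (f us))"
proof -
  have "h 0 = 0" using assms(3)[of 0 0] by simp
  then show ?thesis using assms unfolding alt_multilinear_def by simp
qed

lemma alt_multilinear_0: "alt_multilinear \<tau> (\<lambda>us. 0)"
  by (simp add: alt_multilinear_def)

lemma alt_multilinear_add:
  "alt_multilinear \<tau> f \<Longrightarrow> alt_multilinear \<tau> g \<Longrightarrow> alt_multilinear \<tau> (\<lambda>us. f us + g us)"
  unfolding alt_multilinear_def by (simp add: scaleC_add_right)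

lemma alt_multilinear_scale_length:
  "alt_multilinear \<tau> f \<Longrightarrow> alt_multilinear \<tau> (\<lambda>us. c (length us) *\<^sub>C f us)"
  unfolding alt_multilinear_def by (simp add: scaleC_add_right mult.commute)

lemma alt_multilinear_scale: "alt_multilinear \<tau> f \<Longrightarrow> alt_multilinear \<tau> (\<lambda>us. c *\<^sub>C f us)"
  by (rule alt_multilinear_scale_length)

lemma alt_multilinear_sum:
  "(\<And>i. i \<in> I \<Longrightarrow> alt_multilinear \<tau> (f i)) \<Longrightarrow> alt_multilinear \<tau> (\<lambda>us. \<Sum>i\<in>I. f i us)"
  by (induction I rule: infinite_finite_induct) (simp_all add: alt_multilinear_0 alt_multilinear_add)

lemma alt_multilinear_shuf_param:
  "(\<And>Ls. alt_multilinear \<tau> (\<lambda>us. F us Ls)) \<Longrightarrow> alt_multilinear \<tau> (\<lambda>us. shuf dg n (F us) ws)"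
proof (induction ws arbitrary: F)
  case (Cons w ws)
  show ?case unfolding shuf.simps
    by (intro alt_multilinear_sum Cons.IH alt_multilinear_scale Cons.prems)
qed simp

lemma alt_multilinear_pick:
  assumes "\<And>v. alt_multilinear \<tau> (H v)" "\<tau> 1 = 1"
    and "\<And>a b v w us. H (a *\<^sub>C v + b *\<^sub>C w) us = \<tau> a *\<^sub>C H v us + \<tau> b *\<^sub>C H w us"
  shows "alt_multilinear \<tau> (pick (\<lambda>_. 1) H)"
proof -
  define T where "T = (\<lambda>Ks :: nat \<Rightarrow> _. if length (Ks 0) = 1 then H (hd (Ks 0)) (Ks 1) else 0)"
  have "alt_multilinear \<tau> (\<lambda>K. T (Ks(l := K)))" if "l < 2" for Ks l
  proof (cases "l = 0")
    case True
    have "alt_multilinear \<tau> (\<lambda>K. if length K = 1 then H (hd K) (Ks 1) else 0)"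
      unfolding alt_multilinear_def
    proof (intro conjI allI impI)
      fix us ws v w a b
      show "(if length (us @ (a *\<^sub>C v + b *\<^sub>C w) # ws) = 1 then H (hd (us @ (a *\<^sub>C v + b *\<^sub>C w) # ws)) (Ks 1) else 0) =
         \<tau> a *\<^sub>C (if length (us @ v # ws) = 1 then H (hd (us @ v # ws)) (Ks 1) else 0) +
         \<tau> b *\<^sub>C (if length (us @ w # ws) = 1 then H (hd (us @ w # ws)) (Ks 1) else 0)"
        by (cases us) (auto simp: assms(3))
    next
      fix K :: "'a list" assume "\<not> distinct K"
      then show "(if length K = 1 then H (hd K) (Ks 1) else 0) = 0" by (cases K; cases "tl K") auto
    qed
    then show ?thesis unfolding True T_def by (simp cong: if_cong)
  next
    case False
    then have "l = 1" using that by simp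
    then show ?thesis using assms(1) by (cases "length (Ks 0) = 1") (simp_all add: T_def alt_multilinear_0)
  qed
  then have "alt_multilinear \<tau> (shuf (\<lambda>_. 1) 2 T)" using assms(2) by (rule alt_multilinear_shuf)
  then show ?thesis unfolding pick_def[abs_def] T_def .
qed

lemma alt_multilinear_dbar:
  fixes f :: "'v::cvs list \<Rightarrow> 'z::complex_normed \<Rightarrow> 'w::complex_normed"
  assumes "\<And>z. alt_multilinear \<tau> (\<lambda>us. f us z)" "\<And>us. (\<lambda>z. f us z) differentiable (at z0)"
  shows "alt_multilinear \<tau> (\<lambda>us. dbar_dir (\<lambda>z. f us z) z0 v)"
  unfolding alt_multilinear_def
proof (intro conjI allI impI)
  fix us ws a b v' w
  have "(\<lambda>z. f (us @ (a *\<^sub>C v' + b *\<^sub>C w) # ws) z) = (\<lambda>z. \<tau> a *\<^sub>C f (us @ v' # ws) z + \<tau> b *\<^sub>C f (us @ w # ws) z)"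
    using assms(1) by (simp add: alt_multilinear_def)
  then show "dbar_dir (\<lambda>z. f (us @ (a *\<^sub>C v' + b *\<^sub>C w) # ws) z) z0 v =
      \<tau> a *\<^sub>C dbar_dir (\<lambda>z. f (us @ v' # ws) z) z0 v + \<tau> b *\<^sub>C dbar_dir (\<lambda>z. f (us @ w # ws) z) z0 v"
    by (simp only: dbar_dir_add differentiable_scaleC assms(2) dbar_dir_scaleC)
next
  fix us :: "'v list" assume "\<not> distinct us"
  then have "(\<lambda>z. f us z) = (\<lambda>z. 0)" using assms(1) by (simp add: alt_multilinear_def)
  then show "dbar_dir (\<lambda>z. f us z) z0 v = 0" by simp
qed

text \<open>The terms with derivatives of the coordinate change in the transformation of \<open>\<partial>\<close>-bar. Moving the new
  entry to the front turns the sum into one over pairs of entries; a pair contributes \<open>H v w - H w v\<close>.\<close>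

lemma pick_symmetric_slots_zero:
  assumes f: "alt_multilinear \<tau> f" "\<tau> 1 = 1" and H: "\<And>v w. H v w = H w v"
  shows "pick (\<lambda>_. 1) (\<lambda>v us. \<Sum>b<length us. f ((map J us)[b := H v (us ! b)])) vs = 0"
proof -
  have "(\<Sum>b<length us. f ((map J us)[b := H v (us ! b)])) = pick (\<lambda>_. 1) (\<lambda>w us. f (H v w # map J us)) us" for v us
    unfolding pick_eq_sum
  proof (rule sum.cong[OF refl])
    fix b assume "b \<in> {..<length us}"
    then show "f ((map J us)[b := H v (us ! b)]) = (- 1) ^ b *\<^sub>C f (H v (us ! b) # map J (take b us @ drop (Suc b) us))"
      using alt_multilinear_move[OF f, of "map J (take b us)" "H v (us ! b)" "map J (drop (Suc b) us)"]
      by (simp add: upd_conv_take_nth_drop take_map drop_map)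
  qed
  then have "pick (\<lambda>_. 1) (\<lambda>v us. \<Sum>b<length us. f ((map J us)[b := H v (us ! b)])) vs =
     pick (\<lambda>_. 1) (\<lambda>v. pick (\<lambda>_. 1) (\<lambda>w us. f (H v w # map J us))) vs"
    by (simp only:)
  also have "\<dots> = shuf (\<lambda>_. 1) 2 (\<lambda>_. 0) vs"
    unfolding pick_pick by (rule shuf_cong) (simp add: H)
  finally show ?thesis by simp
qed

lemma shuf_map: "shuf dg n T (map f vs) = shuf (\<lambda>x. dg (f x)) n (\<lambda>Ls. T (\<lambda>l. map f (Ls l))) vs"
proof (induction vs arbitrary: T)
  case (Cons v vs)
  have *: "predeg dg (\<lambda>l. map f (Ls l)) m = predeg (\<lambda>x. dg (f x)) Ls m" for Ls m
    by (simp add: predeg_def ldeg_def comp_def)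
  have "(\<lambda>k. map f (Ls k))(l := f v # map f (Ls l)) = (\<lambda>k. map f ((Ls(l := v # Ls l)) k))" for Ls and l :: nat
    by auto
  then show ?case by (simp only: list.map shuf.simps Cons.IH *)
qed simp

lemma smooth_on_shuf:
  fixes T :: "'z::real_normed_vector \<Rightarrow> (nat \<Rightarrow> 'a list) \<Rightarrow> 'w::complex_normed"
  shows "open S \<Longrightarrow> (\<And>Ls. smooth_on S (\<lambda>z. T z Ls)) \<Longrightarrow> smooth_on S (\<lambda>z. shuf dg n (T z) vs)"
proof (induction vs arbitrary: T)
  case (Cons v vs)
  show ?case unfolding shuf.simps
    by (intro smooth_on_sum Cons.IH smooth_on_scaleC Cons.prems)
qed simp


lemma form_prod_eq_shuf:
  "form_prod \<mu> \<alpha> \<beta> c i j x vs ls = shuf (\<lambda>_. 1) 2 (\<lambda>Vs. shuf (\<lambda>_. 1) 2 (\<lambda>Zs.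
     (-1) ^ (length (Vs 1) * length (Zs 0)) *\<^sub>C \<mu> (\<alpha> c i j x (Vs 0) (Zs 0)) (\<beta> c i j x (Vs 1) (Zs 1))) ls) vs"
proof -
  let ?t = "\<lambda>Va Vb Za Zb. (-1) ^ (length Vb * length Za) *\<^sub>C \<mu> (\<alpha> c i j x Va Za) (\<beta> c i j x Vb Zb)"
  have "form_prod \<mu> \<alpha> \<beta> c i j x vs ls = (\<Sum>A\<in>Pow {..<length vs}. koszul2 (\<lambda>_. 1) (length vs) A *\<^sub>C
      (\<Sum>B\<in>Pow {..<length ls}. koszul2 (\<lambda>_. 1) (length ls) B *\<^sub>C ?t (nths vs A) (nths vs (- A)) (nths ls B) (nths ls (- B))))"
    by (simp add: form_prod_def cvs.scale_sum_right mult.assoc)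
  then show ?thesis
    by (simp only: shuf2_eq_koszul2_sum[of "\<lambda>_. 1" ls "\<lambda>Za Zb. ?t _ _ Za Zb"]
       shuf2_eq_koszul2_sum[of "\<lambda>_. 1" vs "\<lambda>Va Vb. shuf (\<lambda>_. 1) 2 (\<lambda>Zs. ?t Va Vb (Zs 0) (Zs 1)) ls"])
qed

lemma hol_on_subset: "hol_on S f \<Longrightarrow> T \<subseteq> S \<Longrightarrow> hol_on T f"
  unfolding hol_on_def using smooth_on_subset by blast

locale bundles =
  fixes X :: "('x::t2_space, 'c, 'm::finite) atlas"
    and E :: "('x, 'i, 'r::finite) vbundle"
    and L :: "('x, 'j, 's::finite) vbundle"
  assumes manifold: "compact_complex_manifold X"
    and bundle_E: "holomorphic_bundle X E" and bundle_L: "holomorphic_bundle X L"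
begin

abbreviation dom where "dom \<equiv> dom_EL X E L"
abbreviation A where "A \<equiv> A_End X E L"

lemma open_chart_image:
  assumes "c \<in> charts X" "open U" "U \<subseteq> cdom X c"
  shows "open (chart X c ` U)"
proof -
  have o: "open (chart X c ` cdom X c)"
    and h: "homeomorphism (cdom X c) (chart X c ` cdom X c) (chart X c) (pchart X c)"
    using manifold assms(1) by (auto simp: compact_complex_manifold_def)
  have "openin (top_of_set (cdom X c)) U" using assms open_subset by blast
  then have "openin (top_of_set (chart X c ` cdom X c)) (chart X c ` U)"
    by (rule homeomorphism_imp_open_map[OF h])
  then show ?thesis using o openin_open_trans by blast
qed

lemma pchart_chart: "c \<in> charts X \<Longrightarrow> x \<in> cdom X c \<Longrightarrow> pchart X c (chart X c x) = x"
  using manifold by (auto simp: compact_complex_manifold_def homeomorphism_def)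

lemma open_dom: "open (dom c i j)"
proof -
  have "open (cdom X c)" if "c \<in> charts X" using manifold that by (auto simp: compact_complex_manifold_def)
  moreover have "open (tdom E i)" if "i \<in> trivs E" using bundle_E that by (auto simp: holomorphic_bundle_def)
  moreover have "open (tdom L j)" if "j \<in> trivs L" using bundle_L that by (auto simp: holomorphic_bundle_def)
  ultimately show ?thesis by (auto simp: dom_EL_def)
qed

lemma dom_memD:
  "x \<in> dom c i j \<Longrightarrow> c \<in> charts X \<and> i \<in> trivs E \<and> j \<in> trivs L \<and> x \<in> cdom X c \<and> x \<in> tdom E i \<and> x \<in> tdom L j"
  by (auto simp: dom_EL_def split: if_splits)

lemma open_chart_dom: "open (chart X c ` dom c i j)"
proof (cases "dom c i j = {}")
  case False
  then have "c \<in> charts X" "dom c i j \<subseteq> cdom X c" using dom_memD by blast+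
  then show ?thesis using open_chart_image open_dom by blast
qed simp

lemma pchart_dom: "x \<in> dom c i j \<Longrightarrow> pchart X c (chart X c x) = x"
  using pchart_chart dom_memD by blast

lemma A_zero: "\<alpha> \<in> A p q \<Longrightarrow> x \<notin> dom c i j \<or> length vs \<noteq> p \<or> length ls \<noteq> q \<Longrightarrow> \<alpha> c i j x vs ls = 0"
  unfolding A_End_def mem_Collect_eq by (drule conjunct1, simp)

lemma A_alt_vs: "\<alpha> \<in> A p q \<Longrightarrow> alt_multilinear cnj (\<lambda>vs. \<alpha> c i j x vs ls)"
  unfolding A_End_def mem_Collect_eq by (drule conjunct2, drule conjunct1, simp)

lemma A_alt_ls: "\<alpha> \<in> A p q \<Longrightarrow> alt_multilinear id (\<lambda>ls. \<alpha> c i j x vs ls)"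
  unfolding A_End_def mem_Collect_eq by (drule conjunct2, drule conjunct2, drule conjunct1, simp)

lemma A_smooth: "\<alpha> \<in> A p q \<Longrightarrow> smooth_on (chart X c ` dom c i j) (\<lambda>z. \<alpha> c i j (pchart X c z) vs ls)"
  unfolding A_End_def mem_Collect_eq by (drule conjunct2, drule conjunct2, drule conjunct2, drule conjunct1, simp)

lemma A_trans: "\<alpha> \<in> A p q \<Longrightarrow> x \<in> dom c i j \<Longrightarrow> x \<in> dom c' i' j' \<Longrightarrow>
  \<alpha> c i j x vs ls =
       transf E i i' x ** \<alpha> c' i' j' x (map (jac X c c' x) vs) (map (dual_trans L j j' x) ls) ** transf E i' i x"
  unfolding A_End_def mem_Collect_eq by ((drule conjunct2)+, blast)

lemma A_differentiable:
  assumes "\<alpha> \<in> A p q" "x \<in> dom c i j"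
  shows "(\<lambda>z. \<alpha> c i j (pchart X c z) vs ls) differentiable (at (chart X c x))"
  by (rule smooth_on_differentiable[OF A_smooth[OF assms(1)]]) (use assms(2) in blast)

lemma A_introI:
  assumes "\<And>c i j x vs ls. x \<notin> dom c i j \<or> length vs \<noteq> p \<or> length ls \<noteq> q \<Longrightarrow> \<alpha> c i j x vs ls = 0"
    and "\<And>c i j x ls. x \<in> dom c i j \<Longrightarrow> alt_multilinear cnj (\<lambda>vs. \<alpha> c i j x vs ls)"
    and "\<And>c i j x vs. x \<in> dom c i j \<Longrightarrow> alt_multilinear id (\<lambda>ls. \<alpha> c i j x vs ls)"
    and "\<And>c i j vs ls. smooth_on (chart X c ` dom c i j) (\<lambda>z. \<alpha> c i j (pchart X c z) vs ls)"
    and "\<And>c i j c' i' j' x vs ls. x \<in> dom c i j \<Longrightarrow> x \<in> dom c' i' j' \<Longrightarrow> \<alpha> c i j x vs ls =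
       transf E i i' x ** \<alpha> c' i' j' x (map (jac X c c' x) vs) (map (dual_trans L j j' x) ls) ** transf E i' i x"
  shows "\<alpha> \<in> A p q"
proof -
  have "alt_multilinear cnj (\<lambda>vs. \<alpha> c i j x vs ls)" "alt_multilinear id (\<lambda>ls. \<alpha> c i j x vs ls)" for c i j x vs ls
    using assms(1,2,3) by (cases "x \<in> dom c i j"; simp add: alt_multilinear_0)+
  then show ?thesis unfolding A_End_def using assms(1,4,5) by auto
qed

lemma subspace_A: "cvs.subspace (A p q)"
  unfolding cvs.subspace_def
proof (intro conjI ballI allI)
  show "0 \<in> A p q"
    by (rule A_introI) (simp_all add: alt_multilinear_0 smooth_on_const)
next
  fix \<alpha> \<beta> assume ab: "\<alpha> \<in> A p q" "\<beta> \<in> A p q"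
  show "\<alpha> + \<beta> \<in> A p q"
  proof (rule A_introI)
    fix c i j c' i' j' x vs ls assume x: "x \<in> dom c i j" "x \<in> dom c' i' j'"
    show "(\<alpha> + \<beta>) c i j x vs ls = transf E i i' x **
        (\<alpha> + \<beta>) c' i' j' x (map (jac X c c' x) vs) (map (dual_trans L j j' x) ls) ** transf E i' i x"
      using A_trans[OF ab(1) x, of vs ls] A_trans[OF ab(2) x, of vs ls]
      by (simp add: matrix_add_ldistrib matrix_add_rdistrib)
  qed (use ab in \<open>simp_all add: A_zero alt_multilinear_add A_alt_vs A_alt_ls smooth_on_add open_chart_dom A_smooth\<close>)
next
  fix \<alpha> and a :: complex assume ab: "\<alpha> \<in> A p q"
  show "a *\<^sub>C \<alpha> \<in> A p q"
  proof (rule A_introI)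
    fix c i j c' i' j' x vs ls assume x: "x \<in> dom c i j" "x \<in> dom c' i' j'"
    show "(a *\<^sub>C \<alpha>) c i j x vs ls = transf E i i' x **
        (a *\<^sub>C \<alpha>) c' i' j' x (map (jac X c c' x) vs) (map (dual_trans L j j' x) ls) ** transf E i' i x"
      using A_trans[OF ab x, of vs ls]
      by (simp add: scaleC_fun_def matrix_mul_scaleC)
  qed (use ab in \<open>simp_all add: scaleC_fun_def A_zero alt_multilinear_scale A_alt_vs A_alt_ls smooth_on_scaleC open_chart_dom A_smooth\<close>)
qed

end

context bundles
begin

lemma dbar_End_eq_pick:
  "x \<in> dom c i j \<Longrightarrow> dbar_End X E L \<alpha> c i j x vs ls =
    pick (\<lambda>_. 1) (\<lambda>v us. dbar_dir (\<lambda>z. \<alpha> c i j (pchart X c z) us ls) (chart X c x) v) vs"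
  by (simp add: dbar_End_def pick_eq_sum)

lemma dbar_End_outside: "x \<notin> dom c i j \<Longrightarrow> dbar_End X E L \<alpha> c i j x vs ls = 0"
  by (simp add: dbar_End_def)

context
  fixes c i j c' i' j' x
  assumes x: "x \<in> dom c i j" "x \<in> dom c' i' j'"
begin

private abbreviation "U \<equiv> dom c i j \<inter> dom c' i' j'"
private abbreviation "D \<equiv> chart X c ` U"
private abbreviation "z0 \<equiv> chart X c x"
private abbreviation "\<phi> z \<equiv> chart X c' (pchart X c z)"
private abbreviation "J w z \<equiv> frechet_derivative (\<lambda>z. \<phi> z) (at z) w"

private lemma cc: "c \<in> charts X" "c' \<in> charts X" "i \<in> trivs E" "i' \<in> trivs E" "j \<in> trivs L" "j' \<in> trivs L"
  using x dom_memD by blast+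

private lemma open_D: "open D"
  using open_chart_image[OF cc(1), of U] open_dom[of c i j] open_dom[of c' i' j'] dom_memD by blast

private lemma z0_D: "z0 \<in> D"
  using x by blast

private lemma D_memD:
  assumes "z \<in> D"
  shows "pchart X c z \<in> U" "chart X c (pchart X c z) = z" "\<phi> z \<in> chart X c' ` dom c' i' j'"
    "pchart X c' (\<phi> z) = pchart X c z"
proof -
  from assms obtain y where y: "y \<in> U" "z = chart X c y" by blast
  then have p: "pchart X c z = y" using pchart_dom by blast
  then show "pchart X c z \<in> U" "chart X c (pchart X c z) = z" "\<phi> z \<in> chart X c' ` dom c' i' j'"
    "pchart X c' (\<phi> z) = pchart X c z" using y pchart_dom[of y c' i' j'] by auto
qed

private lemma hol_\<phi>: "hol_on D \<phi>"
proof (rule hol_on_subset)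
  show "hol_on (chart X c ` (cdom X c \<inter> cdom X c')) \<phi>"
    using manifold cc by (auto simp: compact_complex_manifold_def)
  show "D \<subseteq> chart X c ` (cdom X c \<inter> cdom X c')" using dom_memD by blast
qed

private lemma hol_transf_E:
  assumes "z \<in> D"
  shows "hol_at (\<lambda>z. transf E i i' (pchart X c z)) z" "hol_at (\<lambda>z. transf E i' i (pchart X c z)) z"
proof -
  have "hol_on (chart X c ` (cdom X c \<inter> tdom E i \<inter> tdom E i')) (\<lambda>z. transf E i i' (pchart X c z))"
    "hol_on (chart X c ` (cdom X c \<inter> tdom E i' \<inter> tdom E i)) (\<lambda>z. transf E i' i (pchart X c z))"
    using bundle_E cc unfolding holomorphic_bundle_def by blast+
  moreover have "z \<in> chart X c ` (cdom X c \<inter> tdom E i \<inter> tdom E i')" "z \<in> chart X c ` (cdom X c \<inter> tdom E i' \<inter> tdom E i)"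
    using assms dom_memD by blast+
  ultimately show "hol_at (\<lambda>z. transf E i i' (pchart X c z)) z" "hol_at (\<lambda>z. transf E i' i (pchart X c z)) z"
    using hol_on_hol_at by blast+
qed

private lemma hol_dual_trans:
  assumes "z \<in> D"
  shows "hol_at (\<lambda>z. dual_trans L j j' (pchart X c z) \<xi>) z"
proof -
  have "hol_on (chart X c ` (cdom X c \<inter> tdom L j \<inter> tdom L j')) (\<lambda>z. transf L j j' (pchart X c z))"
    using bundle_L cc unfolding holomorphic_bundle_def by blast
  moreover have "z \<in> chart X c ` (cdom X c \<inter> tdom L j \<inter> tdom L j')"
    using assms dom_memD by blast
  ultimately have h: "hol_at (\<lambda>z. transf L j j' (pchart X c z)) z" using hol_on_hol_at by blast
  have sc: "transpose (c *\<^sub>C B) *v \<xi> = c *\<^sub>C (transpose B *v \<xi>)" for c and B :: "complex^'s^'s"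
    by (simp add: vec_eq_iff vector_matrix_mult_def scaleC_vec_def scaleC_complex_def sum_distrib_left algebra_simps)
  have "transpose (B + C) *v \<xi> = transpose B *v \<xi> + transpose C *v \<xi>" for B C :: "complex^'s^'s"
    by (simp add: vec_eq_iff vector_matrix_mult_def distrib_left sum.distrib)
  then have "linear (\<lambda>B. transpose B *v \<xi> :: complex^'s)"
    by (rule linearI) (simp only: scaleR_eq_scaleC sc)
  then have "bounded_linear (\<lambda>B. transpose B *v \<xi> :: complex^'s)" by (simp add: linear_conv_bounded_linear)
  then show ?thesis unfolding dual_trans_def
    using hol_at_bounded_linear[OF _ sc h] by simp
qed

private lemma hol_J: "hol_at (J w) z0"
proof -
  have sm: "smooth_on D \<phi>" using hol_\<phi> by (simp add: hol_on_def)
  have dJ: "J w differentiable (at z0)" for w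
    by (rule smooth_on_differentiable[OF smooth_on_derivative[OF sm] z0_D])
  have sym: "frechet_derivative (J v) (at z0) w = frechet_derivative (J w) (at z0) v" for v w
    by (rule symmetric_second_derivative[OF sm open_D z0_D])
  \<comment> \<open>By the symmetry of second derivatives, complex linearity in the direction of differentiation follows
      from the one in the other slot.\<close>
  have "frechet_derivative (J (a *\<^sub>C v)) (at z0) w = a *\<^sub>C frechet_derivative (J v) (at z0) w" for a v w
  proof -
    have "frechet_derivative (J (a *\<^sub>C v)) (at z0) = frechet_derivative (\<lambda>z. a *\<^sub>C J v z) (at z0)"
      by (rule frechet_derivative_transform_within_open[OF dJ open_D z0_D])
        (use hol_\<phi> in \<open>unfold hol_on_def, blast\<close>)
    then show ?thesis by (simp add: frechet_derivative_bounded_linear[OF bounded_linear_scaleC dJ])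
  qed
  then have "frechet_derivative (J w) (at z0) (a *\<^sub>C v) = a *\<^sub>C frechet_derivative (J w) (at z0) v" for a v
    using sym by metis
  then show ?thesis using dJ by (simp add: hol_at_def)
qed

private lemma jac_eq: "z \<in> D \<Longrightarrow> jac X c c' (pchart X c z) = (\<lambda>w. J w z)"
  by (simp add: jac_def D_memD)

text \<open>In the overlap of two charts, \<open>\<alpha>\<close> is the second local expression, evaluated at vectors that depend on the
  point through the Jacobian \<open>J\<close> and the dual transition \<open>\<delta>\<close>, and conjugated by \<open>T\<close>. Everything but the local
  expression is holomorphic. Hence \<open>\<partial>\<close>-bar sees, apart from the local expression (\<open>Av\<close>), only the
  derivatives of \<open>J\<close> in the antilinear slots (\<open>Bv\<close>). These are second derivatives of the coordinate
  change and disappear in the alternating sum.\<close>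

lemma dbar_End_trans:
  assumes \<alpha>: "\<alpha> \<in> A p q"
  shows "dbar_End X E L \<alpha> c i j x vs ls = transf E i i' x **
    dbar_End X E L \<alpha> c' i' j' x (map (jac X c c' x) vs) (map (dual_trans L j j' x) ls) ** transf E i' i x"
proof -
  define T where "T = (\<lambda>z. transf E i i' (pchart X c z))"
  define T' where "T' = (\<lambda>z. transf E i' i (pchart X c z))"
  define \<delta> where "\<delta> = (\<lambda>\<xi> z. dual_trans L j j' (pchart X c z) \<xi>)"
  define G where "G = (\<lambda>us ks z. \<alpha> c' i' j' (pchart X c' z) us ks)"
  define F where "F = (\<lambda>us ks z. G us ks (\<phi> z))"
  define H where "H = (\<lambda>v w. frechet_derivative (J w) (at z0) v)"
  let ?Jx = "\<lambda>us. map (\<lambda>w. J w z0) us" and ?ks = "map (\<lambda>\<xi>. \<delta> \<xi> z0) ls"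
  define Av where "Av = (\<lambda>v us. dbar_dir (G (?Jx us) ?ks) (\<phi> z0) (J v z0))"
  define Bv where "Bv = (\<lambda>v us. \<Sum>b<length us. G ((?Jx us)[b := H v (us ! b)]) ?ks (\<phi> z0))"
  have hol\<phi>: "hol_at \<phi> z0" using hol_on_hol_at[OF hol_\<phi> z0_D] .
  have Gd: "G us ks differentiable (at (\<phi> z0))" for us ks
    unfolding G_def by (rule smooth_on_differentiable[OF A_smooth[OF \<alpha>] D_memD(3)[OF z0_D]])
  have Fd: "F us ks differentiable (at z0)" for us ks
    unfolding F_def by (rule dbar_dir_compose_hol(2)[OF hol\<phi> Gd])
  have alt_vs: "alt_multilinear cnj (\<lambda>us. F us ks z)" for ks z
    unfolding F_def G_def by (rule A_alt_vs[OF \<alpha>])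
  have alt_ls: "alt_multilinear id (\<lambda>ks. F us ks z)" for us z
    unfolding F_def G_def by (rule A_alt_ls[OF \<alpha>])
  have ls: "(\<lambda>z. F us (map (\<lambda>\<xi>. \<delta> \<xi> z) ls) z) differentiable (at z0) \<and>
     dbar_dir (\<lambda>z. F us (map (\<lambda>\<xi>. \<delta> \<xi> z) ls) z) z0 v = dbar_dir (F us ?ks) z0 v" for us v
    using dbar_dir_slots[of id "\<lambda>ks z. F us ks z" z0 v 0 "map \<delta> ls", OF alt_ls _ Fd]
      hol_dual_trans[OF z0_D] by (auto simp: comp_def \<delta>_def dbar_dir_hol hol_at_def[of _ z0])
  have vs: "(\<lambda>z. F (map (\<lambda>w. J w z) us) (map (\<lambda>\<xi>. \<delta> \<xi> z) ls) z) differentiable (at z0) \<and>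
     dbar_dir (\<lambda>z. F (map (\<lambda>w. J w z) us) (map (\<lambda>\<xi>. \<delta> \<xi> z) ls) z) z0 v = Av v us + Bv v us" for us v
  proof -
    have "dbar_dir (F (?Jx us) ?ks) z0 v = Av v us"
      unfolding F_def Av_def using dbar_dir_compose_hol(1)[OF hol\<phi> Gd] .
    define K where "K = (\<lambda>us z. F us (map (\<lambda>\<xi>. \<delta> \<xi> z) ls) z)"
    let ?us = "map (\<lambda>w z. J w z) us"
    have s: "(\<lambda>z. K (map (\<lambda>u. u z) ?us) z) differentiable (at z0) \<and>
      dbar_dir (\<lambda>z. K (map (\<lambda>u. u z) ?us) z) z0 v = dbar_dir (\<lambda>z. K (map (\<lambda>u. u z0) ?us) z) z0 v +
        1 *\<^sub>C (\<Sum>a<length ?us. K ((map (\<lambda>u. u z0) ?us)[a := frechet_derivative (?us ! a) (at z0) v]) z0)"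
    proof (rule dbar_dir_slots[where \<tau>=cnj])
      show "alt_multilinear cnj (\<lambda>us. K us z)" for z unfolding K_def by (rule alt_vs)
      show "(\<lambda>z. K us z) differentiable (at z0)" for us unfolding K_def using ls by blast
      show "(\<lambda>z. cnj (u z)) differentiable (at z0) \<and> dbar_dir (\<lambda>z. cnj (u z)) z0 v = 1 * cnj (frechet_derivative u (at z0) v)"
        if "hol_at u z0" for u :: "complex^'m \<Rightarrow> complex" using dbar_dir_cnj_hol[OF that] by simp
      show "hol_at u z0" if "u \<in> set ?us" for u using that hol_J by auto
    qed simp
    have K: "dbar_dir (\<lambda>z. K (?Jx us) z) z0 v = Av v us"
      unfolding K_def using ls \<open>dbar_dir (F (?Jx us) ?ks) z0 v = Av v us\<close> by simp
    have B: "(\<Sum>a<length ?us. K ((?Jx us)[a := frechet_derivative (?us ! a) (at z0) v]) z0) = Bv v us"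
      unfolding Bv_def H_def K_def F_def by simp
    have m: "map (\<lambda>u. u z) ?us = map (\<lambda>w. J w z) us" for z by simp
    show ?thesis using s unfolding m K B cvs.scale_one by (simp only: K_def)
  qed
  have loc: "dbar_dir (\<lambda>z. \<alpha> c i j (pchart X c z) us ls) z0 v = T z0 ** (Av v us + Bv v us) ** T' z0" for us v
  proof -
    have T: "T differentiable (at z0)" "dbar_dir T z0 v = 0" "T' differentiable (at z0)" "dbar_dir T' z0 v = 0"
      using hol_transf_E[OF z0_D] by (auto simp: T_def T'_def hol_at_def[of _ z0] dbar_dir_hol)
    have "dbar_dir (\<lambda>z. \<alpha> c i j (pchart X c z) us ls) z0 v =
      dbar_dir (\<lambda>z. T z ** F (map (\<lambda>w. J w z) us) (map (\<lambda>\<xi>. \<delta> \<xi> z) ls) z ** T' z) z0 v"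
    proof (rule dbar_dir_cong[OF A_differentiable[OF \<alpha> x(1)] open_D z0_D])
      fix z assume z: "z \<in> D"
      have "\<alpha> c i j (pchart X c z) us ls = T z ** \<alpha> c' i' j' (pchart X c z) (map (\<lambda>w. J w z) us) (map (\<lambda>\<xi>. \<delta> \<xi> z) ls) ** T' z"
        unfolding T_def T'_def \<delta>_def jac_eq[OF z, symmetric]
        by (rule A_trans[OF \<alpha>]) (use D_memD[OF z] in auto)
      then show "\<alpha> c i j (pchart X c z) us ls = T z ** F (map (\<lambda>w. J w z) us) (map (\<lambda>\<xi>. \<delta> \<xi> z) ls) z ** T' z"
        unfolding F_def G_def D_memD(4)[OF z] .
    qed
    also have "\<dots> = T z0 ** (Av v us + Bv v us) ** T' z0"
      using vs[of us v] T
      by (simp add: dbar_dir_matrix_mult differentiable_bilinear[OF bounded_bilinear_matrix_mult])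
    finally show ?thesis .
  qed
  have "dbar_End X E L \<alpha> c i j x vs ls = pick (\<lambda>_. 1) (\<lambda>v us. T z0 ** (Av v us + Bv v us) ** T' z0) vs"
    unfolding dbar_End_eq_pick[OF x(1)] loc ..
  also have "\<dots> = T z0 ** pick (\<lambda>_. 1) (\<lambda>v us. Av v us + Bv v us) vs ** T' z0"
    unfolding pick_eq_sum by (simp only: matrix_mul_sum_left matrix_mul_sum_right matrix_mul_scaleC)
  also have "pick (\<lambda>_. 1) (\<lambda>v us. Av v us + Bv v us) vs = pick (\<lambda>_. 1) Av vs + pick (\<lambda>_. 1) Bv vs"
    by (rule pick_add)
  also have "pick (\<lambda>_. 1) Bv vs = 0"
    unfolding Bv_def
  proof (rule pick_symmetric_slots_zero)
    show "alt_multilinear cnj (\<lambda>us. G us ?ks (\<phi> z0))" using alt_vs[of ?ks z0] by (simp add: F_def)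
    show "H v w = H w v" for v w
      unfolding H_def using hol_\<phi> by (intro symmetric_second_derivative[OF _ open_D z0_D]) (simp add: hol_on_def)
  qed simp
  also have "pick (\<lambda>_. 1) Av vs = dbar_End X E L \<alpha> c' i' j' x (map (jac X c c' x) vs) (map (dual_trans L j j' x) ls)"
  proof -
    have j: "jac X c c' x = (\<lambda>w. J w z0)" using jac_eq[OF z0_D] pchart_dom[OF x(1)] by simp
    have k: "map (dual_trans L j j' x) ls = ?ks" by (simp add: \<delta>_def pchart_dom[OF x(1)])
    have p: "\<phi> z0 = chart X c' x" by (simp add: pchart_dom[OF x(1)])
    show ?thesis
      unfolding dbar_End_eq_pick[OF x(2)] pick_eq_sum j k Av_def G_def p
      by (simp add: take_map drop_map)
  qed
  finally show ?thesis by (simp add: T_def T'_def pchart_dom[OF x(1)])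
qed

end

lemma dbar_End_in:
  assumes \<alpha>: "\<alpha> \<in> A p q"
  shows "dbar_End X E L \<alpha> \<in> A (Suc p) q"
proof (rule A_introI)
  fix c i j x and vs :: "(complex^'m) list" and ls :: "(complex^'s) list" assume a: "x \<notin> dom c i j \<or> length vs \<noteq> Suc p \<or> length ls \<noteq> q"
  show "dbar_End X E L \<alpha> c i j x vs ls = 0"
  proof (cases "x \<in> dom c i j")
    case True
    have "\<alpha> c i j y (take a vs @ drop (Suc a) vs) ls = 0" if "a < length vs" for a y
      using a True that by (intro A_zero[OF \<alpha>]) auto
    then show ?thesis by (simp add: dbar_End_def)
  qed (simp add: dbar_End_outside)
next
  fix c i j x and ls :: "(complex^'s) list" assume x: "x \<in> dom c i j"
  have "alt_multilinear cnj (pick (\<lambda>_. 1) (\<lambda>v us. dbar_dir (\<lambda>z. \<alpha> c i j (pchart X c z) us ls) (chart X c x) v))"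
    by (rule alt_multilinear_pick)
      (auto intro!: alt_multilinear_dbar A_alt_vs[OF \<alpha>] A_differentiable[OF \<alpha> x] dbar_dir_direction_antilinear)
  then show "alt_multilinear cnj (\<lambda>vs. dbar_End X E L \<alpha> c i j x vs ls)"
    unfolding dbar_End_eq_pick[OF x] .
next
  fix c i j x and vs :: "(complex^'m) list" assume x: "x \<in> dom c i j"
  show "alt_multilinear id (\<lambda>ls. dbar_End X E L \<alpha> c i j x vs ls)"
    unfolding dbar_End_eq_pick[OF x] pick_eq_sum
    by (intro alt_multilinear_sum alt_multilinear_scale alt_multilinear_dbar A_alt_ls[OF \<alpha>] A_differentiable[OF \<alpha> x])
next
  fix c i j and vs :: "(complex^'m) list" and ls :: "(complex^'s) list"
  let ?f = "\<lambda>a z. \<alpha> c i j (pchart X c z) (take a vs @ drop (Suc a) vs) ls"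
  have "smooth_on (chart X c ` dom c i j) (\<lambda>z. \<Sum>a<length vs. (-1) ^ a *\<^sub>C dbar_dir (?f a) z (vs ! a))"
    unfolding dbar_dir_def
    by (intro smooth_on_sum smooth_on_scaleC smooth_on_add smooth_on_derivative A_smooth[OF \<alpha>] open_chart_dom)
  then show "smooth_on (chart X c ` dom c i j) (\<lambda>z. dbar_End X E L \<alpha> c i j (pchart X c z) vs ls)"
    by (rule smooth_on_cong[OF open_chart_dom, rotated]) (auto simp: dbar_End_def pchart_dom)
qed (rule dbar_End_trans[OF _ _ \<alpha>])

lemma transf_inverse:
  assumes "x \<in> dom c i j" "x \<in> dom c' i' j'"
  shows "transf E i' i x ** transf E i i' x = mat 1"
proof -
  have m: "i \<in> trivs E" "i' \<in> trivs E" "x \<in> tdom E i" "x \<in> tdom E i'" using assms dom_memD by blast+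
  have "transf E i' i x ** transf E i i' x = transf E i' i' x"
    using bundle_E m unfolding holomorphic_bundle_def by blast
  also have "\<dots> = mat 1" using bundle_E m unfolding holomorphic_bundle_def by blast
  finally show ?thesis .
qed

text \<open>The conditions on \<open>\<mu>\<close> hold for the commutator: it is complex bilinear and compatible with the
  conjugation by transition functions.\<close>

lemma form_prod_in:
  fixes \<mu> :: "complex^'r^'r \<Rightarrow> complex^'r^'r \<Rightarrow> complex^'r^'r"
  assumes \<alpha>: "\<alpha> \<in> A p q" and \<beta>: "\<beta> \<in> A p' q'"
    and bil: "bounded_bilinear \<mu>" and C: "\<And>c a b. \<mu> (c *\<^sub>C a) b = c *\<^sub>C \<mu> a b" "\<And>c a b. \<mu> a (c *\<^sub>C b) = c *\<^sub>C \<mu> a b"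
    and conj: "\<And>g h a b. h ** g = mat 1 \<Longrightarrow> \<mu> (g ** a ** h) (g ** b ** h) = g ** \<mu> a b ** h"
  shows "form_prod \<mu> \<alpha> \<beta> \<in> A (p + p') (q + q')"
proof (rule A_introI)
  note l0 = bounded_bilinear.zero_left[OF bil] bounded_bilinear.zero_right[OF bil]
  note ladd = bounded_bilinear.add_left[OF bil] bounded_bilinear.add_right[OF bil]
  {
    fix c i j x and vs :: "(complex^'m) list" and ls :: "(complex^'s) list" assume a: "x \<notin> dom c i j \<or> length vs \<noteq> p + p' \<or> length ls \<noteq> q + q'"
    have "form_prod \<mu> \<alpha> \<beta> c i j x vs ls = shuf (\<lambda>_. 1) 2 (\<lambda>Vs. shuf (\<lambda>_. 1) 2 (\<lambda>Zs. 0) ls) vs"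
      unfolding form_prod_eq_shuf
    proof (intro shuf_cong)
      fix Vs Zs assume "splits 2 vs Vs" "splits 2 ls Zs"
      then have l: "length (Vs 0) + length (Vs 1) = length vs" "length (Zs 0) + length (Zs 1) = length ls"
        using splits_length by (fastforce simp: two_labels)+
      have "\<alpha> c i j x (Vs 0) (Zs 0) = 0 \<or> \<beta> c i j x (Vs 1) (Zs 1) = 0"
      proof (cases "x \<in> dom c i j \<and> length (Vs 0) = p \<and> length (Zs 0) = q")
        case True
        then have "length (Vs 1) \<noteq> p' \<or> length (Zs 1) \<noteq> q'" using a l by linarith
        then have "\<beta> c i j x (Vs 1) (Zs 1) = 0" using A_zero[OF \<beta>] by blast
        then show ?thesis ..
      next
        case False
        then have "\<alpha> c i j x (Vs 0) (Zs 0) = 0" using A_zero[OF \<alpha>] by blast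
        then show ?thesis ..
      qed
      then show "(- 1) ^ (length (Vs 1) * length (Zs 0)) *\<^sub>C \<mu> (\<alpha> c i j x (Vs 0) (Zs 0)) (\<beta> c i j x (Vs 1) (Zs 1)) = 0"
        using l0 by auto
    qed
    then show "form_prod \<mu> \<alpha> \<beta> c i j x vs ls = 0" by simp
  next
    fix c i j x and ls :: "(complex^'s) list"
    show "alt_multilinear cnj (\<lambda>vs. form_prod \<mu> \<alpha> \<beta> c i j x vs ls)"
      unfolding form_prod_eq_shuf
    proof (rule alt_multilinear_shuf)
      fix Vs :: "nat \<Rightarrow> (complex^'m) list" and l :: nat assume "l < 2"
      then consider "l = 0" | "l = 1" by linarith
      then show "alt_multilinear cnj (\<lambda>K. shuf (\<lambda>_. 1) 2 (\<lambda>Zs. (- 1) ^ (length ((Vs(l := K)) 1) * length (Zs 0)) *\<^sub>C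
          \<mu> (\<alpha> c i j x ((Vs(l := K)) 0) (Zs 0)) (\<beta> c i j x ((Vs(l := K)) 1) (Zs 1))) ls)"
      proof cases
        case 1
        have "alt_multilinear cnj (\<lambda>K. \<mu> (\<alpha> c i j x K u) y)" for u y
          by (rule alt_multilinear_compose[OF A_alt_vs[OF \<alpha>]]) (simp_all add: ladd C)
        then show ?thesis unfolding 1 by (simp add: alt_multilinear_shuf_param alt_multilinear_scale)
      next
        case 2
        have "alt_multilinear cnj (\<lambda>K. \<mu> y (\<beta> c i j x K u))" for u y
          by (rule alt_multilinear_compose[OF A_alt_vs[OF \<beta>]]) (simp_all add: ladd C)
        then have "alt_multilinear cnj (\<lambda>K. shuf (\<lambda>_. 1) 2 (\<lambda>Zs. (- 1) ^ (length K * length (Zs 0)) *\<^sub>C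
          \<mu> (\<alpha> c i j x (Vs 0) (Zs 0)) (\<beta> c i j x K (Zs 1))) ls)"
          by (intro alt_multilinear_shuf_param)
            (rule alt_multilinear_scale_length[where c="\<lambda>n. (- 1) ^ (n * _)"])
        then show ?thesis unfolding 2 by simp
      qed
    qed simp
  next
    fix c i j x and vs :: "(complex^'m) list"
    show "alt_multilinear id (\<lambda>ls. form_prod \<mu> \<alpha> \<beta> c i j x vs ls)"
      unfolding form_prod_eq_shuf
    proof (intro alt_multilinear_shuf_param alt_multilinear_shuf)
      fix Vs :: "nat \<Rightarrow> (complex^'m) list" and Zs :: "nat \<Rightarrow> (complex^'s) list" and l :: nat assume "l < 2"
      then consider "l = 0" | "l = 1" by linarith
      then show "alt_multilinear id (\<lambda>K. (- 1) ^ (length (Vs 1) * length ((Zs(l := K)) 0)) *\<^sub>C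
          \<mu> (\<alpha> c i j x (Vs 0) ((Zs(l := K)) 0)) (\<beta> c i j x (Vs 1) ((Zs(l := K)) 1)))"
      proof cases
        case 1
        have "alt_multilinear id (\<lambda>K. \<mu> (\<alpha> c i j x u K) y)" for u y
          by (rule alt_multilinear_compose[OF A_alt_ls[OF \<alpha>]]) (simp_all add: ladd C)
        then have "alt_multilinear id (\<lambda>K. (- 1) ^ (length (Vs 1) * length K) *\<^sub>C
          \<mu> (\<alpha> c i j x (Vs 0) K) (\<beta> c i j x (Vs 1) (Zs 1)))"
          by (rule alt_multilinear_scale_length[where c="\<lambda>n. (- 1) ^ (_ * n)"])
        then show ?thesis unfolding 1 by simp
      next
        case 2
        have "alt_multilinear id (\<lambda>K. \<mu> y (\<beta> c i j x u K))" for u y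
          by (rule alt_multilinear_compose[OF A_alt_ls[OF \<beta>]]) (simp_all add: ladd C)
        then show ?thesis unfolding 2 by (simp add: alt_multilinear_scale)
      qed
    qed simp
  next
    fix c i j and vs :: "(complex^'m) list" and ls :: "(complex^'s) list"
    show "smooth_on (chart X c ` dom c i j) (\<lambda>z. form_prod \<mu> \<alpha> \<beta> c i j (pchart X c z) vs ls)"
      unfolding form_prod_eq_shuf
      by (intro smooth_on_shuf smooth_on_scaleC smooth_on_bilinear[OF bil] A_smooth[OF \<alpha>] A_smooth[OF \<beta>] open_chart_dom)
  next
    fix c i j c' i' j' x and vs :: "(complex^'m) list" and ls :: "(complex^'s) list" assume x: "x \<in> dom c i j" "x \<in> dom c' i' j'"
    let ?g = "transf E i i' x" and ?h = "transf E i' i x"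
    have m: "\<mu> (\<alpha> c i j x us ks) (\<beta> c i j x us' ks') =
        ?g ** \<mu> (\<alpha> c' i' j' x (map (jac X c c' x) us) (map (dual_trans L j j' x) ks))
          (\<beta> c' i' j' x (map (jac X c c' x) us') (map (dual_trans L j j' x) ks')) ** ?h" for us us' ks ks'
      unfolding A_trans[OF \<alpha> x, of us ks] A_trans[OF \<beta> x, of us' ks']
      by (rule conj[OF transf_inverse[OF x]])
    have out: "shuf dg n (\<lambda>Ls. ?g ** T Ls ** ?h) ws = ?g ** shuf dg n T ws ** ?h"
      for dg :: "complex^'m \<Rightarrow> int" and n T ws
      by (rule shuf_linear[symmetric]) (simp_all add: matrix_add_ldistrib matrix_add_rdistrib matrix_mul_scaleC)
    have out': "shuf dg n (\<lambda>Ls. ?g ** T Ls ** ?h) ws = ?g ** shuf dg n T ws ** ?h"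
      for dg :: "complex^'s \<Rightarrow> int" and n T ws
      by (rule shuf_linear[symmetric]) (simp_all add: matrix_add_ldistrib matrix_add_rdistrib matrix_mul_scaleC)
    have pull: "k *\<^sub>C (?g ** a ** ?h) = ?g ** (k *\<^sub>C a) ** ?h" for k a
      by (simp add: matrix_mul_scaleC)
    show "form_prod \<mu> \<alpha> \<beta> c i j x vs ls = ?g **
       form_prod \<mu> \<alpha> \<beta> c' i' j' x (map (jac X c c' x) vs) (map (dual_trans L j j' x) ls) ** ?h"
      unfolding form_prod_eq_shuf m shuf_map length_map
      by (simp only: pull out out')
  }
qed

lemma bounded_bilinear_commutator: "bounded_bilinear (commutator :: complex^'r^'r \<Rightarrow> _)"
proof -
  have "bilinear (commutator :: complex^'r^'r \<Rightarrow> _)"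
    unfolding bilinear_def commutator_def
    by (auto intro!: linearI simp: matrix_add_ldistrib matrix_add_rdistrib scaleR_eq_scaleC matrix_mul_scaleC
        cvs.scale_right_diff_distrib)
  then show ?thesis by (simp add: bilinear_conv_bounded_bilinear)
qed

lemma M_bracket_eq: "M_bracket = form_prod commutator"
  by (simp add: M_bracket_def commutator_def[abs_def])

lemma M_bracket_in:
  assumes "\<alpha> \<in> A p q" "\<beta> \<in> A p' q'"
  shows "M_bracket \<alpha> \<beta> \<in> A (p + p') (q + q')"
  unfolding M_bracket_eq
proof (rule form_prod_in[OF assms bounded_bilinear_commutator])
  fix g h a b :: "complex^'r^'r" assume hg: "h ** g = mat 1"
  have *: "(g ** a ** h) ** (g ** b ** h) = g ** (a ** b) ** h" for a b
    by (metis hg matrix_mul_assoc matrix_mul_rid)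
  show "commutator (g ** a ** h) (g ** b ** h) = g ** commutator a b ** h"
    unfolding commutator_def * by (simp add: matrix_diff_distrib)
qed (simp_all add: commutator_def matrix_mul_scaleC cvs.scale_right_diff_distrib)

lemma form_prod_add_left:
  assumes "\<And>a b c. \<mu> (a + b) c = \<mu> a c + \<mu> b c"
  shows "form_prod \<mu> (\<alpha> + \<alpha>') \<beta> = form_prod \<mu> \<alpha> \<beta> + form_prod \<mu> \<alpha>' \<beta>"
  by (simp add: form_prod_def fun_eq_iff assms scaleC_add_right sum.distrib)

lemma form_prod_add_right:
  assumes "\<And>a b c. \<mu> c (a + b) = \<mu> c a + \<mu> c b"
  shows "form_prod \<mu> \<beta> (\<alpha> + \<alpha>') = form_prod \<mu> \<beta> \<alpha> + form_prod \<mu> \<beta> \<alpha>'"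
  by (simp add: form_prod_def fun_eq_iff assms scaleC_add_right sum.distrib)

lemma M_bracket_add:
  "M_bracket (\<alpha> + \<alpha>') \<beta> = M_bracket \<alpha> \<beta> + M_bracket \<alpha>' \<beta>"
  "M_bracket \<beta> (\<alpha> + \<alpha>') = M_bracket \<beta> \<alpha> + M_bracket \<beta> \<alpha>'"
  unfolding M_bracket_eq
  by (rule form_prod_add_left form_prod_add_right, simp add: commutator_def matrix_add_ldistrib matrix_add_rdistrib)+

lemma M_bracket_sum:
  assumes "finite I"
  shows "M_bracket (\<Sum>i\<in>I. \<alpha> i) \<beta> = (\<Sum>i\<in>I. M_bracket (\<alpha> i) \<beta>)"
    and "M_bracket \<beta> (\<Sum>i\<in>I. \<alpha> i) = (\<Sum>i\<in>I. M_bracket \<beta> (\<alpha> i))"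
proof -
  have z: "M_bracket 0 \<beta> = 0" "M_bracket \<beta> 0 = 0"
    using M_bracket_add(1)[of 0 0 \<beta>] M_bracket_add(2)[of \<beta> 0 0] by simp_all
  show "M_bracket (\<Sum>i\<in>I. \<alpha> i) \<beta> = (\<Sum>i\<in>I. M_bracket (\<alpha> i) \<beta>)"
    "M_bracket \<beta> (\<Sum>i\<in>I. \<alpha> i) = (\<Sum>i\<in>I. M_bracket \<beta> (\<alpha> i))"
    using assms by (induction I rule: finite_induct) (simp_all add: z M_bracket_add)
qed

lemma sum_form_apply: "(\<Sum>i\<in>I. \<alpha> i) c i' j x vs ls = (\<Sum>i\<in>I. \<alpha> i c i' j x vs ls)"
  by (induction I rule: infinite_finite_induct) simp_all

lemma dbar_End_sum:
  assumes "finite I" "\<And>i. i \<in> I \<Longrightarrow> \<alpha> i \<in> A (p i) (q i)"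
  shows "dbar_End X E L (\<Sum>i\<in>I. \<alpha> i) = (\<Sum>i\<in>I. dbar_End X E L (\<alpha> i))"
proof (intro ext)
  fix c i j x vs ls
  show "dbar_End X E L (\<Sum>i\<in>I. \<alpha> i) c i j x vs ls = (\<Sum>i\<in>I. dbar_End X E L (\<alpha> i)) c i j x vs ls"
  proof (cases "x \<in> dom c i j")
    case True
    show ?thesis
      unfolding dbar_End_eq_pick[OF True] sum_form_apply
      by (subst dbar_dir_sum) (use assms True in \<open>auto intro: A_differentiable simp: pick_sum\<close>)
  qed (simp add: dbar_End_outside sum_form_apply)
qed

abbreviation M where "M \<equiv> M_dgla X E L"

lemma subspace_M: "cvs.subspace (M n)"
proof (cases "n < 0")
  case True
  then have "M n = {0}" by (simp add: M_dgla_def)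
  then show ?thesis by (simp add: cvs.subspace_def)
next
  case False
  show ?thesis
    unfolding cvs.subspace_def
  proof (intro conjI ballI allI)
    have "(\<Sum>p\<le>nat n. 0) \<in> M n"
      unfolding M_dgla_def using False by (auto intro!: exI[of _ "\<lambda>_. 0"] cvs.subspace_0[OF subspace_A])
    then show "0 \<in> M n" by simp
  next
    fix v w assume "v \<in> M n" "w \<in> M n"
    then obtain a b where "v = (\<Sum>p\<le>nat n. a p)" "\<forall>p\<le>nat n. a p \<in> A p (nat n - p)"
       "w = (\<Sum>p\<le>nat n. b p)" "\<forall>p\<le>nat n. b p \<in> A p (nat n - p)"
      using False by (auto simp: M_dgla_def)
    then show "v + w \<in> M n"
      using False unfolding M_dgla_def
      by (auto intro!: exI[of _ "\<lambda>p. a p + b p"] cvs.subspace_add[OF subspace_A] simp: sum.distrib)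
  next
    fix v and k :: complex assume "v \<in> M n"
    then obtain a where "v = (\<Sum>p\<le>nat n. a p)" "\<forall>p\<le>nat n. a p \<in> A p (nat n - p)"
      using False by (auto simp: M_dgla_def)
    then show "k *\<^sub>C v \<in> M n"
      using False unfolding M_dgla_def
      by (auto intro!: exI[of _ "\<lambda>p. k *\<^sub>C a p"] cvs.subspace_scale[OF subspace_A] simp: cvs.scale_sum_right)
  qed
qed

lemma A_subset_M:
  assumes "\<alpha> \<in> A p q" "n = int p + int q"
  shows "\<alpha> \<in> M n"
proof -
  have "\<alpha> = (\<Sum>p'\<le>nat n. if p' = p then \<alpha> else 0)"
    using assms(2) by (simp add: sum.delta)
  moreover have "(if p' = p then \<alpha> else 0) \<in> A p' (nat n - p')" for p'
  proof -
    have "nat n - p = q" using assms(2) by linarith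
    then show ?thesis using assms(1) cvs.subspace_0[OF subspace_A] by auto
  qed
  moreover have "\<not> n < 0" using assms(2) by simp
  ultimately show ?thesis
    unfolding M_dgla_def by (auto intro!: exI[of _ "\<lambda>p'. if p' = p then \<alpha> else 0"])
qed

lemma M_cases:
  assumes "v \<in> M n"
  obtains "v = 0" | \<alpha> where "n \<ge> 0" "v = (\<Sum>p\<le>nat n. \<alpha> p)" "\<And>p. p \<le> nat n \<Longrightarrow> \<alpha> p \<in> A p (nat n - p)"
  using assms by (auto simp: M_dgla_def split: if_splits)

text \<open>The pieces \<open>A\<^sup>0\<^sup>,\<^sup>p(End(E) \<otimes> \<And>\<^sup>q L)\<close> with \<open>p + q = n\<close> are separated by the number of arguments from
  \<open>L\<^sup>*\<close> on which they do not vanish.\<close>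

lemma M_component:
  assumes "v \<in> M n" "n = int p + int q"
  obtains \<alpha> where "\<alpha> \<in> A p q" "\<And>c i j x vs ls. length ls = q \<Longrightarrow> v c i j x vs ls = \<alpha> c i j x vs ls"
  using assms(1)
proof (cases rule: M_cases)
  case 1
  then show ?thesis using that[of 0] cvs.subspace_0[OF subspace_A] by simp
next
  case (2 \<alpha>)
  have p: "p \<le> nat n" "nat n - p = q" using assms(2) by auto
  have "v c i j x vs ls = \<alpha> p c i j x vs ls" if "length ls = q" for c i j x vs ls
  proof -
    have "\<alpha> p' c i j x vs ls = 0" if "p' \<in> {..nat n} - {p}" for p'
      by (rule A_zero[OF 2(3)]) (use that \<open>length ls = q\<close> p in auto)
    then have "v c i j x vs ls = (\<Sum>p'\<in>{p}. \<alpha> p' c i j x vs ls)"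
      unfolding 2(2) sum_form_apply using p by (intro sum.mono_neutral_right) auto
    then show ?thesis by simp
  qed
  then show ?thesis using that 2(3)[OF p(1)] p(2) by metis
qed

lemma M_zero_component:
  assumes "v \<in> M n" "n < int (length ls)"
  shows "v c i j x vs ls = 0"
  using assms(1)
proof (cases rule: M_cases)
  case (2 \<alpha>)
  have "\<alpha> p c i j x vs ls = 0" if "p \<le> nat n" for p
    by (rule A_zero[OF 2(3)[OF that]]) (use assms(2) 2(1) in auto)
  then show ?thesis unfolding 2(2) sum_form_apply by simp
qed simp

lemma dbar_End_M:
  assumes "v \<in> M n"
  shows "dbar_End X E L v \<in> M (n + 1)"
  using assms
proof (cases rule: M_cases)
  case 1
  then show ?thesis using cvs.subspace_0[OF subspace_M] dbar_End_sum[of "{}"] by simp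
next
  case (2 \<alpha>)
  have "dbar_End X E L v = (\<Sum>p\<le>nat n. dbar_End X E L (\<alpha> p))"
    unfolding 2(2) by (rule dbar_End_sum) (use 2(3) in auto)
  also have "\<dots> \<in> M (n + 1)"
    by (intro cvs.subspace_sum[OF subspace_M] A_subset_M[OF dbar_End_in[OF 2(3)]]) (use 2(1) in auto)
  finally show ?thesis .
qed

lemma M_bracket_M:
  assumes "v \<in> M n" "w \<in> M m"
  shows "M_bracket v w \<in> M (n + m)"
  using assms(1)
proof (cases rule: M_cases)
  case 1
  then show ?thesis using M_bracket_sum(1)[of "{}" _ w] cvs.subspace_0[OF subspace_M] by simp
next
  case v: (2 \<alpha>)
  show ?thesis using assms(2)
  proof (cases rule: M_cases)
    case 1
    then show ?thesis using M_bracket_sum(2)[of "{}" v] cvs.subspace_0[OF subspace_M] by simp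
  next
    case w: (2 \<beta>)
    have "M_bracket v w = (\<Sum>p\<le>nat n. \<Sum>p'\<le>nat m. M_bracket (\<alpha> p) (\<beta> p'))"
      unfolding v(2) w(2) by (simp add: M_bracket_sum) (rule sum.swap)
    also have "\<dots> \<in> M (n + m)"
      by (intro cvs.subspace_sum[OF subspace_M] A_subset_M[OF M_bracket_in[OF v(3) w(3)]])
        (use v(1) w(1) in auto)
    finally show ?thesis .
  qed
qed

lemma M_diff_M:
  assumes "\<theta> \<in> A 0 1" "v \<in> M n"
  shows "M_diff X E L \<theta> v \<in> M (n + 1)"
proof -
  have "\<theta> \<in> M 1" by (rule A_subset_M[OF assms(1)]) simp
  from M_bracket_M[OF this assms(2)] have "M_bracket \<theta> v \<in> M (n + 1)" by (simp add: add.commute)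
  with dbar_End_M[OF assms(2)] show ?thesis
    unfolding M_diff_def by (rule cvs.subspace_add[OF subspace_M])
qed

lemma Linfty_of_dgla_M:
  assumes "\<theta> \<in> A 0 1" "w \<in> words (shift M 1)"
  shows "Linfty_of_dgla (M_diff X E L \<theta>) M_bracket w \<in> shift M 1 (wdeg w + 1)"
proof -
  consider (1) e v where "w = [(e, v)]" | (2) e v e' v' where "w = [(e, v), (e', v')]" |
    (3) "Linfty_of_dgla (M_diff X E L \<theta>) M_bracket w = 0"
    by (cases "(M_diff X E L \<theta>, M_bracket :: ('x, 'c, 'm, 'i, 'r, 'j, 's) End_form \<Rightarrow> _, w)" rule: Linfty_of_dgla.cases) auto
  then show ?thesis
  proof cases
    case 1
    then have "v \<in> M (e + 1)" using assms(2) by (simp add: words_iff shift_def)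
    from cvs.subspace_neg[OF subspace_M M_diff_M[OF assms(1) this]] show ?thesis
      using 1 by (simp add: shift_def wdeg_def)
  next
    case 2
    then have "v \<in> M (e + 1)" "v' \<in> M (e' + 1)" using assms(2) by (simp_all add: words_iff shift_def)
    from M_bracket_M[OF this] show ?thesis using 2 cvs.subspace_scale[OF subspace_M]
      by (simp add: shift_def wdeg_def add_ac)
  next
    case 3
    then show ?thesis using cvs.subspace_0[OF subspace_M] by (simp add: shift_def)
  qed
qed

end

section \<open>Trace coefficients as functions\<close>

lemma subspace_hom_polys: "cvs.subspace (hom_polys k)"
  unfolding hom_polys_def by (rule cvs.subspace_span)

lemma hom_polys_add: "f \<in> hom_polys k \<Longrightarrow> g \<in> hom_polys k \<Longrightarrow> (\<lambda>\<xi>. f \<xi> + g \<xi>) \<in> hom_polys k"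
  using cvs.subspace_add[OF subspace_hom_polys, of f k g] by (simp add: plus_fun_def)

lemma hom_polys_scale: "f \<in> hom_polys k \<Longrightarrow> (\<lambda>\<xi>. c * f \<xi>) \<in> hom_polys k"
  using cvs.subspace_scale[OF subspace_hom_polys, of f k c] by (simp add: scaleC_fun_def scaleC_complex_def)

lemma hom_polys_0: "(\<lambda>\<xi>. 0) \<in> hom_polys k"
  using cvs.subspace_0[OF subspace_hom_polys, of k] by (simp add: zero_fun_def)

lemma hom_polys_sum: "(\<And>i. i \<in> I \<Longrightarrow> f i \<in> hom_polys k) \<Longrightarrow> (\<lambda>\<xi>. \<Sum>i\<in>I. f i \<xi>) \<in> hom_polys k"
  by (induction I rule: infinite_finite_induct) (auto simp: hom_polys_0 intro!: hom_polys_add)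

lemma hom_polys_const: "(\<lambda>\<xi>. c) \<in> hom_polys 0"
proof -
  have "(\<lambda>\<xi>. 1) \<in> hom_polys 0"
    unfolding hom_polys_def by (rule cvs.span_base) (auto intro!: exI[of _ "[]"])
  from hom_polys_scale[OF this, of c] show ?thesis by simp
qed

lemma hom_polys_linear: "(\<lambda>\<xi>. \<Sum>a\<in>UNIV. \<xi> $ a * l a) \<in> hom_polys 1"
proof -
  have "(\<lambda>\<xi>. \<Prod>l\<leftarrow>[\<chi> a. l a]. \<Sum>a\<in>UNIV. \<xi> $ a * l $ a) \<in> hom_polys 1"
    unfolding hom_polys_def by (rule cvs.span_base) (rule CollectI, intro exI conjI, rule refl, simp)
  then show ?thesis by simp
qed

lemma hom_polys_mult:
  fixes f g :: "complex^'s::finite \<Rightarrow> complex"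
  assumes "f \<in> hom_polys k" "g \<in> hom_polys l"
  shows "(\<lambda>\<xi>. f \<xi> * g \<xi>) \<in> hom_polys (k + l)"
proof -
  let ?m = "\<lambda>ls (\<xi> :: complex^'s). \<Prod>l\<leftarrow>ls. \<Sum>a\<in>UNIV. \<xi> $ a * l $ a"
  have sub: "cvs.subspace {f. (\<lambda>\<xi>. f \<xi> * h \<xi>) \<in> hom_polys n}" for h :: "complex^'s \<Rightarrow> complex" and n
    unfolding cvs.subspace_def
    using hom_polys_0[of n] hom_polys_add hom_polys_scale
    by (auto simp: distrib_right scaleC_fun_def scaleC_complex_def mult.assoc)
  have 1: "(\<lambda>\<xi>. f \<xi> * ?m ls \<xi>) \<in> hom_polys (k + l)" if "length ls = l" for ls
  proof -
    have "hom_polys k \<subseteq> {f. (\<lambda>\<xi>. f \<xi> * ?m ls \<xi>) \<in> hom_polys (k + l)}"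
      unfolding hom_polys_def[of k]
    proof (rule cvs.span_minimal[OF _ sub], rule subsetI)
      fix f assume "f \<in> {?m ls' | ls'. length ls' = k}"
      then obtain ls' where ls': "f = ?m ls'" "length ls' = k" by blast
      have "?m (ls' @ ls) \<in> hom_polys (k + l)"
        unfolding hom_polys_def
        by (rule cvs.span_base, rule CollectI, intro exI[of _ "ls' @ ls"] conjI refl) (simp add: ls'(2) that)
      then show "f \<in> {f. (\<lambda>\<xi>. f \<xi> * ?m ls \<xi>) \<in> hom_polys (k + l)}" by (simp add: ls'(1))
    qed
    then show ?thesis using assms(1) by blast
  qed
  have "hom_polys l \<subseteq> {g. (\<lambda>\<xi>. g \<xi> * f \<xi>) \<in> hom_polys (k + l)}"
    unfolding hom_polys_def[of l]
  proof (rule cvs.span_minimal[OF _ sub], rule subsetI)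
    fix g assume "g \<in> {?m ls' | ls'. length ls' = l}"
    then show "g \<in> {g. (\<lambda>\<xi>. g \<xi> * f \<xi>) \<in> hom_polys (k + l)}" using 1 by (auto simp: mult.commute)
  qed
  then show ?thesis using assms(2) by (auto simp: mult.commute)
qed

lemma pcoeff_hom_polys:
  fixes \<Theta> :: "complex^'s::finite \<Rightarrow> complex^'r^'r"
  assumes "finite S" "\<And>a b. (\<lambda>\<xi>. \<Theta> \<xi> $ a $ b) \<in> hom_polys 1" "\<And>l a b. l \<in> S \<Longrightarrow> (\<lambda>\<xi>. B \<xi> l $ a $ b) \<in> hom_polys 1"
  shows "(\<lambda>\<xi>. pcoeff (\<Theta> \<xi>) (B \<xi>) k S $ a $ b) \<in> hom_polys k"
  using assms(1,3)
proof (induction k arbitrary: S a b)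
  case 0
  then show ?case by (simp add: hom_polys_const)
next
  case (Suc k)
  have IH: "(\<lambda>\<xi>. pcoeff (\<Theta> \<xi>) (B \<xi>) k S' $ a $ b) \<in> hom_polys k" if "S' \<subseteq> S" for S' a b
    using Suc.prems that finite_subset by (intro Suc.IH) auto
  have e: "pcoeff (\<Theta> \<xi>) (B \<xi>) (Suc k) S $ a $ b = (\<Sum>c\<in>UNIV. \<Theta> \<xi> $ a $ c * pcoeff (\<Theta> \<xi>) (B \<xi>) k S $ c $ b) +
    (\<Sum>l\<in>S. \<Sum>c\<in>UNIV. B \<xi> l $ a $ c * pcoeff (\<Theta> \<xi>) (B \<xi>) k (S - {l}) $ c $ b)" for \<xi>
    by (simp add: matrix_matrix_mult_def)
  have m: "(\<lambda>\<xi>. f \<xi> * g \<xi>) \<in> hom_polys (Suc k)" if "f \<in> hom_polys 1" "g \<in> hom_polys k" for f g :: "complex^'s \<Rightarrow> complex"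
    using hom_polys_mult[OF that] by simp
  show ?case unfolding e
    by (intro hom_polys_add hom_polys_sum m assms(2) Suc.prems(2) IH) auto
qed

lemma smooth_on_pcoeff:
  assumes "open U" "finite S" "smooth_on U \<Theta>" "\<And>l. l \<in> S \<Longrightarrow> smooth_on U (\<lambda>z. B z l)"
  shows "smooth_on U (\<lambda>z. pcoeff (\<Theta> z) (B z) k S)"
  using assms(2,4)
proof (induction k arbitrary: S)
  case 0
  then show ?case by (simp add: smooth_on_const)
next
  case (Suc k)
  have IH: "smooth_on U (\<lambda>z. pcoeff (\<Theta> z) (B z) k S')" if "S' \<subseteq> S" for S'
    using Suc.prems that finite_subset by (intro Suc.IH) auto
  show ?case unfolding pcoeff.simps
    by (intro smooth_on_add smooth_on_sum smooth_on_matrix_mult assms IH Suc.prems) auto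
qed

text \<open>A derivation that kills \<open>\<Theta>\<close> acts on one letter \<open>B\<^sub>m\<close> at a time.\<close>

lemma dbar_dir_pcoeff:
  fixes \<Theta> :: "'z::complex_normed \<Rightarrow> complex^'r^'r"
  assumes "finite S" and \<Theta>: "hol_at \<Theta> z0"
    and "\<And>l. l \<in> S \<Longrightarrow> (\<lambda>z. B z l) differentiable (at z0)"
  shows "(\<lambda>z. pcoeff (\<Theta> z) (B z) k S) differentiable (at z0) \<and>
    dbar_dir (\<lambda>z. pcoeff (\<Theta> z) (B z) k S) z0 v =
      (\<Sum>m\<in>S. pcoeff (\<Theta> z0) ((B z0)(m := dbar_dir (\<lambda>z. B z m) z0 v)) k S)"
  using assms(1,3)
proof (induction k arbitrary: S)
  case 0
  then show ?case by (auto simp: sum.neutral)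
next
  case (Suc k)
  let ?R = "\<lambda>S z. pcoeff (\<Theta> z) (B z) k S"
  let ?Bm = "\<lambda>m. (B z0)(m := dbar_dir (\<lambda>z. B z m) z0 v)"
  let ?Rm = "\<lambda>m S. pcoeff (\<Theta> z0) (?Bm m) k S"
  have T: "\<Theta> differentiable (at z0)" "dbar_dir \<Theta> z0 v = 0"
    using \<Theta> dbar_dir_hol by (auto simp: hol_at_def)
  have IH: "?R S' differentiable (at z0)" "dbar_dir (?R S') z0 v = (\<Sum>m\<in>S'. ?Rm m S')" if "S' \<subseteq> S" for S'
    using Suc.IH[of S'] Suc.prems that finite_subset[OF that] by (auto simp del: fun_upd_apply)
  have dT: "(\<lambda>z. \<Theta> z ** ?R S z) differentiable (at z0)"
    "dbar_dir (\<lambda>z. \<Theta> z ** ?R S z) z0 v = \<Theta> z0 ** (\<Sum>m\<in>S. ?Rm m S)"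
    using T IH[of S] by (simp_all add: differentiable_bilinear[OF bounded_bilinear_matrix_mult] dbar_dir_matrix_mult)
  have dB: "(\<lambda>z. B z l ** ?R (S - {l}) z) differentiable (at z0)"
    "dbar_dir (\<lambda>z. B z l ** ?R (S - {l}) z) z0 v =
      dbar_dir (\<lambda>z. B z l) z0 v ** ?R (S - {l}) z0 + (\<Sum>m\<in>S - {l}. B z0 l ** ?Rm m (S - {l}))" if "l \<in> S" for l
    using Suc.prems(2)[OF that] IH[of "S - {l}"]
    by (auto simp: differentiable_bilinear[OF bounded_bilinear_matrix_mult] dbar_dir_matrix_mult matrix_mul_sum_right)
  have e: "pcoeff (\<Theta> z0) (?Bm m) (Suc k) S = \<Theta> z0 ** ?Rm m S + (dbar_dir (\<lambda>z. B z m) z0 v ** ?R (S - {m}) z0 +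
      (\<Sum>l\<in>S - {m}. B z0 l ** ?Rm m (S - {l})))" if "m \<in> S" for m
  proof -
    have "?Rm m (S - {m}) = ?R (S - {m}) z0" by (rule pcoeff_cong) auto
    moreover have "(\<Sum>l\<in>S - {m}. ?Bm m l ** ?Rm m (S - {l})) = (\<Sum>l\<in>S - {m}. B z0 l ** ?Rm m (S - {l}))"
      by (rule sum.cong) auto
    ultimately show ?thesis using that Suc.prems(1) by (simp add: sum.remove)
  qed
  have swap: "(\<Sum>m\<in>S. \<Sum>l\<in>S - {m}. B z0 l ** ?Rm m (S - {l})) = (\<Sum>l\<in>S. \<Sum>m\<in>S - {l}. B z0 l ** ?Rm m (S - {l}))"
    by (subst (1 2) sum.Sigma) (use Suc.prems in \<open>auto intro!: sum.reindex_bij_witness[where i=prod.swap and j=prod.swap]\<close>)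
  have diff: "(\<lambda>z. \<Sum>l\<in>S. B z l ** ?R (S - {l}) z) differentiable (at z0)"
    using dB(1) Suc.prems(1) by (intro differentiable_sum) auto
  have "dbar_dir (\<lambda>z. pcoeff (\<Theta> z) (B z) (Suc k) S) z0 v =
     \<Theta> z0 ** (\<Sum>m\<in>S. ?Rm m S) + (\<Sum>l\<in>S. dbar_dir (\<lambda>z. B z l) z0 v ** ?R (S - {l}) z0 +
       (\<Sum>m\<in>S - {l}. B z0 l ** ?Rm m (S - {l})))"
    unfolding pcoeff.simps dbar_dir_add[OF dT(1) diff] dT(2)
    by (subst dbar_dir_sum) (use dB Suc.prems(1) in auto)
  also have "\<dots> = (\<Sum>m\<in>S. \<Theta> z0 ** ?Rm m S + (dbar_dir (\<lambda>z. B z m) z0 v ** ?R (S - {m}) z0 +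
      (\<Sum>l\<in>S - {m}. B z0 l ** ?Rm m (S - {l}))))"
    unfolding sum.distrib swap by (simp only: matrix_mul_sum_right)
  also have "\<dots> = (\<Sum>m\<in>S. pcoeff (\<Theta> z0) (?Bm m) (Suc k) S)"
    by (rule sum.cong[OF refl e[symmetric]])
  finally show ?case
    using differentiable_add[OF dT(1) diff] by (intro conjI) (simp_all only: pcoeff.simps)
qed

lemma tr_coeff_linear:
  "m < n \<Longrightarrow> tr_coeff k \<Theta> n (B(m := a *\<^sub>C x + b *\<^sub>C y)) =
    a *\<^sub>C tr_coeff k \<Theta> n (B(m := x)) + b *\<^sub>C tr_coeff k \<Theta> n (B(m := y))"
  by (simp add: tr_coeff_eq pcoeff_linear trace_add trace_scaleC)

lemma tr_coeff_add: "m < n \<Longrightarrow> tr_coeff k \<Theta> n (B(m := x + y)) = tr_coeff k \<Theta> n (B(m := x)) + tr_coeff k \<Theta> n (B(m := y))"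
  using tr_coeff_linear[of m n k \<Theta> B 1 x 1 y] by simp

lemma tr_coeff_scale: "m < n \<Longrightarrow> tr_coeff k \<Theta> n (B(m := a *\<^sub>C x)) = a *\<^sub>C tr_coeff k \<Theta> n (B(m := x))"
  using tr_coeff_linear[of m n k \<Theta> B a x 0 0] by simp

lemma tr_coeff_zero: "m < n \<Longrightarrow> B m = 0 \<Longrightarrow> tr_coeff k \<Theta> n B = 0"
  by (simp add: tr_coeff_eq pcoeff_zero trace_def)

lemma tr_coeff_cong: "(\<And>l. l < n \<Longrightarrow> B l = B' l) \<Longrightarrow> tr_coeff k \<Theta> n B = tr_coeff k \<Theta> n B'"
  unfolding tr_coeff_eq by (subst pcoeff_cong[of _ B B']) auto

lemma tr_coeff_swap:
  assumes "Suc p < n"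
  shows "tr_coeff k \<Theta> n (B(p := B (Suc p), Suc p := B p)) = tr_coeff k \<Theta> n B"
proof -
  define \<tau> where "\<tau> = (id :: nat \<Rightarrow> nat)(p := Suc p, Suc p := p)"
  have "bij_betw \<tau> {..<n} {..<n}"
    by (rule bij_betw_byWitness[where f'=\<tau>]) (use assms in \<open>auto simp: \<tau>_def\<close>)
  then have "pcoeff \<Theta> B k {..<n} = pcoeff \<Theta> (\<lambda>l. B (\<tau> l)) k {..<n}"
    using pcoeff_image[of \<tau> "{..<n}" \<Theta> B k] by (simp add: bij_betw_def)
  moreover have "(\<lambda>l. B (\<tau> l)) = B(p := B (Suc p), Suc p := B p)" by (auto simp: \<tau>_def)
  ultimately show ?thesis by (simp add: tr_coeff_eq)
qed

lemma tr_coeff_conjugate: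
  fixes g h \<Theta> :: "complex^'r^'r"
  assumes "h ** g = mat 1"
  shows "tr_coeff k (g ** \<Theta> ** h) n (\<lambda>l. g ** B l ** h) = tr_coeff k \<Theta> n B"
proof -
  have g: "g ** h = mat 1" using assms by (rule matrix_left_right_inverse[THEN iffD1])
  have "trace (g ** A ** h) = trace A" for A
    by (metis assms matrix_mul_assoc matrix_mul_lid trace_mul_sym)
  then show ?thesis by (simp add: tr_coeff_eq pcoeff_conjugate[OF g assms])
qed

text \<open>The letter \<open>[\<phi>, \<Theta>]\<close> takes the first place and shifts the others, as in the word that the
  differential of \<open>M\<close> produces.\<close>

lemma tr_coeff_invariant:
  "tr_coeff k \<Theta> (Suc n) (case_nat (commutator \<phi> \<Theta>) B) +
    (\<Sum>j<n. tr_coeff k \<Theta> n (B(j := commutator \<phi> (B j)))) = 0"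
proof -
  let ?S = "Suc ` {..<n}"
  define B' where "B' = case_nat (0 :: complex^'a^'a) B"
  have i: "{..<Suc n} = insert 0 ?S" by (rule lessThan_Suc_eq_insert_0)
  have c: "case_nat (commutator \<phi> \<Theta>) B = B'(0 := commutator \<phi> \<Theta>)"
    by (auto simp: B'_def split: nat.split)
  have "pcoeff \<Theta> (B'(Suc j := commutator \<phi> (B' (Suc j)))) k ?S = pcoeff \<Theta> (B(j := commutator \<phi> (B j))) k {..<n}" for j
  proof -
    have "(\<lambda>l. (B'(Suc j := commutator \<phi> (B' (Suc j)))) (Suc l)) = B(j := commutator \<phi> (B j))"
      by (auto simp: B'_def)
    then show ?thesis by (simp add: pcoeff_image del: fun_upd_apply)
  qed
  then have "(\<Sum>j\<in>?S. trace (pcoeff \<Theta> (B'(j := commutator \<phi> (B' j))) k ?S)) =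
     (\<Sum>j<n. tr_coeff k \<Theta> n (B(j := commutator \<phi> (B j))))"
    by (simp add: sum.reindex tr_coeff_eq del: fun_upd_apply)
  then show ?thesis
    using trace_pcoeff_invariant[of ?S 0 \<Theta> B' \<phi> k] by (simp add: tr_coeff_eq i c del: fun_upd_apply)
qed

lemma alt_multilinear_tr_coeff:
  assumes "m < n" "alt_multilinear \<tau> f"
  shows "alt_multilinear \<tau> (\<lambda>us. tr_coeff k \<Theta> n (B(m := f us)))"
  by (rule alt_multilinear_compose[OF assms(2)]) (simp_all add: tr_coeff_add tr_coeff_scale assms(1) del: fun_upd_apply)

lemma smooth_on_tr_coeff:
  assumes "open U" "smooth_on U \<Theta>" "\<And>l. l < n \<Longrightarrow> smooth_on U (\<lambda>z. B z l)"
  shows "smooth_on U (\<lambda>z. tr_coeff k (\<Theta> z) n (B z))"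
  unfolding tr_coeff_eq
  by (intro smooth_on_bounded_linear[OF bounded_linear_trace] smooth_on_pcoeff) (use assms in auto)

lemma dbar_dir_tr_coeff:
  fixes \<Theta> :: "'z::complex_normed \<Rightarrow> complex^'r^'r"
  assumes "hol_at \<Theta> z0" "\<And>l. l < n \<Longrightarrow> (\<lambda>z. B z l) differentiable (at z0)"
  shows "(\<lambda>z. tr_coeff k (\<Theta> z) n (B z)) differentiable (at z0)"
    and "dbar_dir (\<lambda>z. tr_coeff k (\<Theta> z) n (B z)) z0 v =
      (\<Sum>m<n. tr_coeff k (\<Theta> z0) n ((B z0)(m := dbar_dir (\<lambda>z. B z m) z0 v)))"
proof -
  have *: "(\<lambda>z. pcoeff (\<Theta> z) (B z) k {..<n}) differentiable (at z0)"
    "dbar_dir (\<lambda>z. pcoeff (\<Theta> z) (B z) k {..<n}) z0 v =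
      (\<Sum>m<n. pcoeff (\<Theta> z0) ((B z0)(m := dbar_dir (\<lambda>z. B z m) z0 v)) k {..<n})"
    using dbar_dir_pcoeff[of "{..<n}" \<Theta> z0 B k v] assms by auto
  show "(\<lambda>z. tr_coeff k (\<Theta> z) n (B z)) differentiable (at z0)"
    unfolding tr_coeff_eq by (rule differentiable_bounded_linear[OF bounded_linear_trace *(1)])
  show "dbar_dir (\<lambda>z. tr_coeff k (\<Theta> z) n (B z)) z0 v =
      (\<Sum>m<n. tr_coeff k (\<Theta> z0) n ((B z0)(m := dbar_dir (\<lambda>z. B z m) z0 v)))"
    unfolding tr_coeff_eq
    by (subst dbar_dir_bounded_linear[OF bounded_linear_trace _ *(1)]) (simp_all add: trace_scaleC *(2) trace_sum)
qed

lemma dbar_dir_shuf: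
  fixes T :: "'z::complex_normed \<Rightarrow> (nat \<Rightarrow> 'a list) \<Rightarrow> 'w::complex_normed"
  assumes "\<And>Ls. (\<lambda>z. T z Ls) differentiable (at z0)"
  shows "(\<lambda>z. shuf dg n (T z) vs) differentiable (at z0) \<and>
    dbar_dir (\<lambda>z. shuf dg n (T z) vs) z0 v = shuf dg n (\<lambda>Ls. dbar_dir (\<lambda>z. T z Ls) z0 v) vs"
  using assms
proof (induction vs arbitrary: T)
  case (Cons w ws)
  have d: "(\<lambda>z. shuf dg n (\<lambda>Ls. eps (dg w * predeg dg Ls l) *\<^sub>C T z (Ls(l := w # Ls l))) ws) differentiable (at z0)"
    "dbar_dir (\<lambda>z. shuf dg n (\<lambda>Ls. eps (dg w * predeg dg Ls l) *\<^sub>C T z (Ls(l := w # Ls l))) ws) z0 v =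
     shuf dg n (\<lambda>Ls. eps (dg w * predeg dg Ls l) *\<^sub>C dbar_dir (\<lambda>z. T z (Ls(l := w # Ls l))) z0 v) ws" for l
    using Cons.IH[of "\<lambda>z Ls. eps (dg w * predeg dg Ls l) *\<^sub>C T z (Ls(l := w # Ls l))"] Cons.prems
    by (simp_all add: differentiable_scaleC dbar_dir_scaleC)
  show ?case unfolding shuf.simps
    by (subst dbar_dir_sum) (auto intro!: d differentiable_sum simp: d(2))
qed simp

section \<open>The Taylor coefficients of the Hitchin map\<close>

lemma scaleC_fun_apply: "(a *\<^sub>C f) x = a *\<^sub>C f x"
  by (simp add: scaleC_fun_def)

text \<open>The map \<open>g_map\<close> computed in one fixed trivialisation of \<open>E\<close>. The definition of \<open>g_map\<close> chooses a
  trivialisation at each point, so that it cannot be differentiated directly.\<close>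

definition local_g ::
    "('x, 'c, 'm::finite, 'i, 'r::finite, 'j, 's::finite) End_form \<Rightarrow> nat \<Rightarrow> 'i \<Rightarrow>
      ('x, 'c, 'm, 'i, 'r, 'j, 's) End_form word \<Rightarrow> ('x, 'c, 'm, 'j, 's) Sym_form"
  where "local_g \<theta> k i w = (\<lambda>c j x vs \<xi>. shuf (\<lambda>_. 1) (length w) (\<lambda>Ls.
    tr_coeff k (\<theta> c i j x [] [\<xi>]) (length w) (\<lambda>l. snd (w ! l) c i j x (Ls l) [\<xi>])) vs)"

lemma g_map_eq_local:
  "g_map E \<theta> k w c j x vs \<xi> = local_g \<theta> k (SOME i. i \<in> trivs E \<and> x \<in> tdom E i) w c j x vs \<xi>"
  unfolding g_map_def local_g_def Let_def shuf_eq_koszul_sum[symmetric]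
  by (simp add: scaleC_complex_def)

lemma local_g_cong:
  assumes "length w = length w'"
    and "\<And>l K. l < length w \<Longrightarrow> snd (w ! l) c i j x K [\<xi>] = snd (w' ! l) c i j x K [\<xi>]"
  shows "local_g \<theta> k i w c j x vs \<xi> = local_g \<theta> k i w' c j x vs \<xi>"
  unfolding local_g_def assms(1)[symmetric]
  by (intro shuf_cong tr_coeff_cong) (use assms(2) in simp)

lemma letters_update:
  "(\<lambda>l. snd ((u @ (d, z) # w) ! l) c i j x (Ls l) [\<xi>]) =
    (\<lambda>l. snd ((u @ y # w) ! l) c i j x (Ls l) [\<xi>])(length u := z c i j x (Ls (length u)) [\<xi>])"
  by (auto simp: nth_append nth_Cons' fun_eq_iff)

lemma local_g_linear:
  "local_g \<theta> k i (u @ (d, a *\<^sub>C y + b *\<^sub>C z) # w) c j x vs \<xi> =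
    a *\<^sub>C local_g \<theta> k i (u @ (d', y) # w) c j x vs \<xi> + b *\<^sub>C local_g \<theta> k i (u @ (d'', z) # w) c j x vs \<xi>"
proof -
  have *: "tr_coeff k \<Theta> (length (u @ (d, a *\<^sub>C y + b *\<^sub>C z) # w)) (\<lambda>l. snd ((u @ (d, a *\<^sub>C y + b *\<^sub>C z) # w) ! l) c i j x (Ls l) [\<xi>]) =
     a *\<^sub>C tr_coeff k \<Theta> (length (u @ (d', y) # w)) (\<lambda>l. snd ((u @ (d', y) # w) ! l) c i j x (Ls l) [\<xi>]) +
     b *\<^sub>C tr_coeff k \<Theta> (length (u @ (d'', z) # w)) (\<lambda>l. snd ((u @ (d'', z) # w) ! l) c i j x (Ls l) [\<xi>])" for \<Theta> Ls
  proof -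
    let ?B = "\<lambda>l. snd ((u @ (0, 0) # w) ! l) c i j x (Ls l) [\<xi>]"
    have B: "(\<lambda>l. snd ((u @ (e, q) # w) ! l) c i j x (Ls l) [\<xi>]) = ?B(length u := q c i j x (Ls (length u)) [\<xi>])" for e q
      by (rule letters_update)
    show ?thesis
      unfolding B[of d "a *\<^sub>C y + b *\<^sub>C z"] B[of d' y] B[of d'' z]
      by (simp add: tr_coeff_linear scaleC_fun_def del: fun_upd_apply)
  qed
  show ?thesis
    unfolding local_g_def * shuf_add shuf_scale by simp
qed

lemma local_g_linear_Cons:
  "local_g \<theta> k i ((d, a *\<^sub>C y + b *\<^sub>C z) # w) c j x vs \<xi> =
    a *\<^sub>C local_g \<theta> k i ((d', y) # w) c j x vs \<xi> + b *\<^sub>C local_g \<theta> k i ((d'', z) # w) c j x vs \<xi>"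
  using local_g_linear[of \<theta> k i "[]"] by simp

lemma local_g_zero_Cons: "local_g \<theta> k i ((d, 0) # w) c j x vs \<xi> = 0"
  using local_g_linear_Cons[of \<theta> k i d 0 0 0 0 w c j x vs \<xi> d d] by simp

lemma lin_ext_diff: "lin_ext \<phi> (x - y) = lin_ext \<phi> x - lin_ext \<phi> y"
  using lin_ext_add[of \<phi> x "(-1) *\<^sub>C y"] lin_ext_scale[of \<phi> "-1" y] by (simp)

text \<open>A multilinear graded symmetric map is well defined on the symmetric coalgebra.\<close>

lemma lin_ext_sym_eq:
  fixes f :: "'v::cvs word \<Rightarrow> 'w::cvs"
  assumes lin: "\<And>u w d a b x y. u @ (d, x) # w \<in> words V \<Longrightarrow> y \<in> V d \<Longrightarrow>
      f (u @ (d, a *\<^sub>C x + b *\<^sub>C y) # w) = a *\<^sub>C f (u @ (d, x) # w) + b *\<^sub>C f (u @ (d, y) # w)"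
    and swap: "\<And>u w d e x y. u @ (d, x) # (e, y) # w \<in> words V \<Longrightarrow>
      f (u @ (d, x) # (e, y) # w) = eps (d * e) *\<^sub>C f (u @ (e, y) # (d, x) # w)"
    and "sym_eq V X Y"
  shows "lin_ext f X = lin_ext f Y"
proof -
  have sub: "cvs.subspace {x. lin_ext f x = 0}"
    by (simp add: cvs.subspace_def lin_ext_add lin_ext_scale)
  have "sym_rel V \<subseteq> {x. lin_ext f x = 0}"
    unfolding sym_rel_def
    by (rule cvs.span_minimal[OF _ sub])
      (auto simp: lin_ext_diff lin_ext_scale lin swap eps_def[symmetric])
  then have "lin_ext f (X - Y) = 0" using assms(3) by (auto simp: sym_eq_def)
  then show ?thesis by (simp add: lin_ext_diff)
qed

lemma lin_ext_pick: "lin_ext f (pick dg H w) = pick dg (\<lambda>v us. lin_ext f (H v us)) w"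
  unfolding pick_def lin_ext_shuf by (rule shuf_cong) simp

text \<open>The evaluation of \<open>sym_eq_pick_move\<close> by a graded symmetric map \<open>f\<close>.\<close>

lemma pick_move:
  fixes f :: "'v::cvs word \<Rightarrow> 'w::cvs"
  assumes "\<And>u w d a b x y. u @ (d, x) # w \<in> words V \<Longrightarrow> y \<in> V d \<Longrightarrow>
      f (u @ (d, a *\<^sub>C x + b *\<^sub>C y) # w) = a *\<^sub>C f (u @ (d, x) # w) + b *\<^sub>C f (u @ (d, y) # w)"
    and "\<And>u w d e x y. u @ (d, x) # (e, y) # w \<in> words V \<Longrightarrow>
      f (u @ (d, x) # (e, y) # w) = eps (d * e) *\<^sub>C f (u @ (e, y) # (d, x) # w)"
    and g: "\<And>x. x \<in> set w \<Longrightarrow> snd x \<in> V (fst x) \<and> fst (g x) = fst x + s \<and> snd (g x) \<in> V (fst x + s)"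
  shows "pick fst (\<lambda>x us. f (g x # us)) w =
    (\<Sum>a<length w. eps (s * ldeg fst (take a w)) *\<^sub>C f (take a w @ g (w ! a) # drop (Suc a) w))"
proof -
  have "lin_ext f (pick fst (\<lambda>x us. mono1 ([] @ g x # us)) w) =
    lin_ext f (\<Sum>a<length w. eps (s * ldeg fst (take a w)) *\<^sub>C mono1 ([] @ take a w @ g (w ! a) # drop (Suc a) w))"
    by (rule lin_ext_sym_eq[OF assms(1,2)], assumption+, rule sym_eq_pick_move) (use g in auto)
  then show ?thesis by (simp add: lin_ext_pick lin_ext_sum lin_ext_scale)
qed

lemma hom_polys_shuf:
  "(\<And>Ls. (\<lambda>\<xi>. T \<xi> Ls) \<in> hom_polys k) \<Longrightarrow> (\<lambda>\<xi>. shuf dg n (T \<xi>) vs) \<in> hom_polys k"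
proof (induction vs arbitrary: T)
  case (Cons v vs)
  have "(\<lambda>\<xi>. eps (dg v * predeg dg Ls l) *\<^sub>C T \<xi> (Ls(l := v # Ls l))) \<in> hom_polys k" for l Ls
    using hom_polys_scale[OF Cons.prems] by (simp add: scaleC_complex_def)
  then show ?case unfolding shuf.simps by (intro hom_polys_sum Cons.IH)
qed simp

lemma form_prod_one:
  "form_prod \<mu> \<alpha> \<beta> c i j x vs [\<xi>] = shuf (\<lambda>_. 1) 2 (\<lambda>Vs.
     (-1) ^ length (Vs 1) *\<^sub>C \<mu> (\<alpha> c i j x (Vs 0) [\<xi>]) (\<beta> c i j x (Vs 1) []) +
     \<mu> (\<alpha> c i j x (Vs 0) []) (\<beta> c i j x (Vs 1) [\<xi>])) vs"
  unfolding form_prod_eq_shuf by (intro shuf_cong) (simp add: two_labels)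

locale hitchin = bundles X E L
  for X :: "('x::t2_space, 'c, 'm::finite) atlas"
    and E :: "('x, 'i, 'r::finite) vbundle"
    and L :: "('x, 'j, 's::finite) vbundle" +
  fixes \<theta> :: "('x, 'c, 'm, 'i, 'r, 'j, 's) End_form"
  assumes \<theta>_A: "\<theta> \<in> A 0 1"
    and \<theta>_hol: "hol_on (chart X c ` dom c i j) (\<lambda>z. \<theta> c i j (pchart X c z) [] [\<xi>])"
begin

abbreviation "V \<equiv> shift M 1"

text \<open>Only the component in \<open>A\<^sup>0\<^sup>,\<^sup>d(End(E) \<otimes> L)\<close> of a letter of degree \<open>d\<close> in \<open>M[1]\<close> is seen by \<open>g_map\<close>. A
  letter of negative degree has no such component.\<close>

lemma letter_obtain:
  assumes "v \<in> M (d + 1)"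
  obtains \<alpha> p where "\<alpha> \<in> A p 1" "int p = d \<or> \<alpha> = 0" "\<And>c i j x vs \<xi>. v c i j x vs [\<xi>] = \<alpha> c i j x vs [\<xi>]"
proof (cases "d \<ge> 0")
  case True
  then have n: "d + 1 = int (nat d) + int 1" by simp
  obtain \<alpha> where "\<alpha> \<in> A (nat d) 1" "\<And>c i j x vs ls. length ls = 1 \<Longrightarrow> v c i j x vs ls = \<alpha> c i j x vs ls"
    using M_component[OF assms n] by metis
  then show ?thesis using that[of \<alpha> "nat d"] True by simp
next
  case False
  then have "v c i j x vs [\<xi>] = 0" for c i j x vs \<xi>
    by (intro M_zero_component[OF assms]) simp
  then show ?thesis using that[of 0 0] cvs.subspace_0[OF subspace_A] by simp
qed

lemma letter_alt: "v \<in> M (d + 1) \<Longrightarrow> alt_multilinear cnj (\<lambda>vs. v c i j x vs [\<xi>])"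
  by (erule letter_obtain) (simp add: A_alt_vs)

lemma letter_out: "v \<in> M (d + 1) \<Longrightarrow> x \<notin> dom c i j \<Longrightarrow> v c i j x vs [\<xi>] = 0"
  by (erule letter_obtain) (simp add: A_zero)

lemma letter_deg: "v \<in> M (d + 1) \<Longrightarrow> int (length vs) \<noteq> d \<Longrightarrow> v c i j x vs [\<xi>] = 0"
  by (erule letter_obtain) (auto simp: A_zero)

lemma letter_smooth: "v \<in> M (d + 1) \<Longrightarrow> smooth_on (chart X c ` dom c i j) (\<lambda>z. v c i j (pchart X c z) vs [\<xi>])"
  by (erule letter_obtain) (simp add: A_smooth)

lemma letter_differentiable:
  "v \<in> M (d + 1) \<Longrightarrow> x \<in> dom c i j \<Longrightarrow> (\<lambda>z. v c i j (pchart X c z) vs [\<xi>]) differentiable (at (chart X c x))"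
  by (rule smooth_on_differentiable[OF letter_smooth]) auto

lemma letter_trans:
  assumes "v \<in> M (d + 1)" "x \<in> dom c i j" "x \<in> dom c' i' j'"
  shows "v c i j x vs [\<xi>] = transf E i i' x ** v c' i' j' x (map (jac X c c' x) vs) [dual_trans L j j' x \<xi>] ** transf E i' i x"
proof -
  obtain \<alpha> p where \<alpha>: "\<alpha> \<in> A p 1" "\<And>c i j x vs \<xi>. v c i j x vs [\<xi>] = \<alpha> c i j x vs [\<xi>]"
    using letter_obtain[OF assms(1)] by metis
  show ?thesis unfolding \<alpha>(2) using A_trans[OF \<alpha>(1) assms(2,3), of vs "[\<xi>]"] by simp
qed

lemma A_one_linear:
  assumes "\<alpha> \<in> A p 1"
  shows "(\<lambda>\<xi>. \<alpha> c i j x vs [\<xi>] $ a $ b) \<in> hom_polys 1"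
proof -
  have e: "\<alpha> c i j x vs [\<xi>] = (\<Sum>e\<in>UNIV. \<xi> $ e *\<^sub>C \<alpha> c i j x vs [axis e 1])" for \<xi>
    using alt_multilinear_slot_sum[OF A_alt_ls[OF assms], of UNIV c i j x vs "[]" "\<lambda>e. \<xi> $ e" "\<lambda>e. axis e 1" "[]"]
    by (simp add: vec_axis_expansion[symmetric])
  have "(\<lambda>\<xi>. \<alpha> c i j x vs [\<xi>] $ a $ b) = (\<lambda>\<xi>. \<Sum>e\<in>UNIV. \<xi> $ e * \<alpha> c i j x vs [axis e 1] $ a $ b)"
    by (rule ext, subst e) (simp add: scaleC_vec_def scaleC_complex_def)
  also have "\<dots> \<in> hom_polys 1" by (rule hom_polys_linear)
  finally show ?thesis .
qed

lemma letter_linear: "v \<in> M (d + 1) \<Longrightarrow> (\<lambda>\<xi>. v c i j x vs [\<xi>] $ a $ b) \<in> hom_polys 1"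
  by (erule letter_obtain) (simp add: A_one_linear del: One_nat_def)

lemma letter_in: "w \<in> words V \<Longrightarrow> l < length w \<Longrightarrow> snd (w ! l) \<in> M (fst (w ! l) + 1)"
  using nth_mem[of l w] by (auto simp: words_iff shift_def)

lemma \<theta>_trans:
  assumes "x \<in> dom c i j" "x \<in> dom c' i' j'"
  shows "\<theta> c i j x [] [\<xi>] = transf E i i' x ** \<theta> c' i' j' x [] [dual_trans L j j' x \<xi>] ** transf E i' i x"
  using A_trans[OF \<theta>_A assms, of "[]" "[\<xi>]"] by simp

text \<open>The transition functions of \<open>E\<close> conjugate all matrices simultaneously and disappear under the trace.\<close>

lemma local_g_trans:
  assumes x: "x \<in> dom c i j" "x \<in> dom c' i' j'" and w: "w \<in> words V"
  shows "local_g \<theta> k i w c j x vs \<xi> = local_g \<theta> k i' w c' j' x (map (jac X c c' x) vs) (dual_trans L j j' x \<xi>)"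
  unfolding local_g_def shuf_map
proof (rule shuf_cong)
  fix Ls
  let ?g = "transf E i i' x" and ?h = "transf E i' i x" and ?\<xi> = "dual_trans L j j' x \<xi>"
  have "tr_coeff k (\<theta> c i j x [] [\<xi>]) (length w) (\<lambda>l. snd (w ! l) c i j x (Ls l) [\<xi>]) =
    tr_coeff k (?g ** \<theta> c' i' j' x [] [?\<xi>] ** ?h) (length w)
      (\<lambda>l. ?g ** snd (w ! l) c' i' j' x (map (jac X c c' x) (Ls l)) [?\<xi>] ** ?h)"
    unfolding \<theta>_trans[OF x, of \<xi>] by (rule tr_coeff_cong) (rule letter_trans[OF letter_in[OF w] x])
  then show "tr_coeff k (\<theta> c i j x [] [\<xi>]) (length w) (\<lambda>l. snd (w ! l) c i j x (Ls l) [\<xi>]) =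
    tr_coeff k (\<theta> c' i' j' x [] [?\<xi>]) (length w) (\<lambda>l. snd (w ! l) c' i' j' x (map (jac X c c' x) (Ls l)) [?\<xi>])"
    by (simp only: tr_coeff_conjugate[OF transf_inverse[OF x]])
qed

lemma jac_same:
  assumes "x \<in> dom c i j"
  shows "jac X c c x = (\<lambda>v. v)"
proof -
  have "frechet_derivative (\<lambda>z. z) (at (chart X c x)) = frechet_derivative (\<lambda>z. chart X c (pchart X c z)) (at (chart X c x))"
    by (rule frechet_derivative_transform_within_open[OF _ open_chart_dom[of c i j]])
      (use assms pchart_dom in auto)
  then show ?thesis by (simp add: jac_def)
qed

lemma dual_trans_same:
  assumes "x \<in> dom c i j"
  shows "dual_trans L j j x = (\<lambda>\<xi>. \<xi>)"
proof -
  have "transf L j j x = mat 1"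
    using bundle_L dom_memD[OF assms] unfolding holomorphic_bundle_def by blast
  then show ?thesis by (simp add: fun_eq_iff dual_trans_def)
qed

lemma local_g_frame:
  assumes x: "x \<in> dom c i j" "x \<in> dom c i' j" and w: "w \<in> words V"
  shows "local_g \<theta> k i w c j x vs \<xi> = local_g \<theta> k i' w c j x vs \<xi>"
  using local_g_trans[OF assms, of k vs \<xi>] by (simp add: jac_same[OF x(1)] dual_trans_same[OF x(1)])

lemma local_g_out: "w \<in> words V \<Longrightarrow> x \<notin> dom c i j \<Longrightarrow> local_g \<theta> k i w c j x vs \<xi> = 0"
proof -
  assume w: "w \<in> words V" and x: "x \<notin> dom c i j"
  have n: "0 < length w" using w by (simp add: words_iff)
  have "tr_coeff k \<Theta> (length w) (\<lambda>l. snd (w ! l) c i j x (Ls l) [\<xi>]) = 0" for \<Theta> Ls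
    by (rule tr_coeff_zero[OF n]) (rule letter_out[OF letter_in[OF w n] x])
  then show ?thesis by (simp add: local_g_def)
qed

lemma local_g_deg:
  assumes w: "w \<in> words V" and vs: "int (length vs) \<noteq> wdeg w"
  shows "local_g \<theta> k i w c j x vs \<xi> = 0"
proof -
  have "tr_coeff k \<Theta> (length w) (\<lambda>l. snd (w ! l) c i j x (Ls l) [\<xi>]) = 0" if s: "splits (length w) vs Ls" for \<Theta> Ls
  proof -
    have "\<exists>l<length w. int (length (Ls l)) \<noteq> fst (w ! l)"
    proof (rule ccontr)
      assume "\<not> ?thesis"
      then have "(\<Sum>l<length w. int (length (Ls l))) = (\<Sum>l<length w. fst (w ! l))" by (intro sum.cong) auto
      moreover have "(\<Sum>l<length w. fst (w ! l)) = wdeg w"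
        by (simp add: wdeg_def sum_list_sum_nth atLeast0LessThan)
      moreover have "(\<Sum>l<length w. int (length (Ls l))) = int (length vs)"
        using splits_length[OF s] by (metis of_nat_sum)
      ultimately show False using vs by simp
    qed
    then obtain l where l: "l < length w" "int (length (Ls l)) \<noteq> fst (w ! l)" by blast
    show ?thesis by (rule tr_coeff_zero[OF l(1)]) (rule letter_deg[OF letter_in[OF w l(1)] l(2)])
  qed
  then have "local_g \<theta> k i w c j x vs \<xi> = shuf (\<lambda>_. 1) (length w) (\<lambda>_. 0) vs"
    unfolding local_g_def by (rule shuf_cong)
  then show ?thesis by simp
qed

lemma local_g_alt:
  assumes w: "w \<in> words V"
  shows "alt_multilinear cnj (\<lambda>vs. local_g \<theta> k i w c j x vs \<xi>)"
  unfolding local_g_def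
proof (rule alt_multilinear_shuf)
  fix Ls :: "nat \<Rightarrow> (complex^'m) list" and l assume l: "l < length w"
  let ?B = "\<lambda>l. snd (w ! l) c i j x (Ls l) [\<xi>]"
  have "(\<lambda>K. tr_coeff k (\<theta> c i j x [] [\<xi>]) (length w) (\<lambda>l'. snd (w ! l') c i j x ((Ls(l := K)) l') [\<xi>])) =
     (\<lambda>K. tr_coeff k (\<theta> c i j x [] [\<xi>]) (length w) (?B(l := snd (w ! l) c i j x K [\<xi>])))"
    by (intro ext tr_coeff_cong) simp
  then show "alt_multilinear cnj (\<lambda>K. tr_coeff k (\<theta> c i j x [] [\<xi>]) (length w) (\<lambda>l'. snd (w ! l') c i j x ((Ls(l := K)) l') [\<xi>]))"
    using alt_multilinear_tr_coeff[OF l letter_alt[OF letter_in[OF w l], of c i j x \<xi>], of k "\<theta> c i j x [] [\<xi>]" ?B]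
    by (simp only:)
qed simp

lemma local_g_hom_polys:
  assumes w: "w \<in> words V"
  shows "(\<lambda>\<xi>. local_g \<theta> k i w c j x vs \<xi>) \<in> hom_polys k"
  unfolding local_g_def tr_coeff_eq trace_def
  by (intro hom_polys_shuf hom_polys_sum pcoeff_hom_polys A_one_linear[OF \<theta>_A] letter_linear[OF letter_in[OF w]]) auto

lemma local_g_smooth:
  assumes w: "w \<in> words V"
  shows "smooth_on (chart X c ` dom c i j) (\<lambda>z. local_g \<theta> k i w c j (pchart X c z) vs \<xi>)"
  unfolding local_g_def
  by (intro smooth_on_shuf smooth_on_tr_coeff open_chart_dom A_smooth[OF \<theta>_A] letter_smooth[OF letter_in[OF w]])

text \<open>Exchanging two letters exchanges two blocks of tangent vectors. The lengths of these blocks are the degrees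
  of the letters, as otherwise the letters vanish.\<close>

lemma local_g_swap:
  assumes w: "u @ (d, y) # (e, z) # w \<in> words V"
  shows "local_g \<theta> k i (u @ (d, y) # (e, z) # w) c j x vs \<xi> =
    eps (d * e) *\<^sub>C local_g \<theta> k i (u @ (e, z) # (d, y) # w) c j x vs \<xi>"
proof -
  let ?w1 = "u @ (d, y) # (e, z) # w" and ?w2 = "u @ (e, z) # (d, y) # w"
  let ?p = "length u" and ?n = "length u + Suc (Suc (length w))"
  let ?\<Theta> = "\<theta> c i j x [] [\<xi>]"
  let ?B1 = "\<lambda>Ls l. snd (?w1 ! l) c i j x (Ls l) [\<xi>]" and ?B2 = "\<lambda>Ls l. snd (?w2 ! l) c i j x (Ls l) [\<xi>]"
  have p: "Suc ?p < ?n" by simp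
  have y: "y \<in> M (d + 1)" and z: "z \<in> M (e + 1)" using w by (auto simp: words_iff shift_def)
  have "shuf (\<lambda>_. 1) ?n (\<lambda>Ls. tr_coeff k ?\<Theta> ?n (?B1 Ls)) vs =
     shuf (\<lambda>_. 1) ?n (\<lambda>Ls. eps (ldeg (\<lambda>_. 1) (Ls ?p) * ldeg (\<lambda>_. 1) (Ls (Suc ?p))) *\<^sub>C
        tr_coeff k ?\<Theta> ?n (?B1 (Ls(?p := Ls (Suc ?p), Suc ?p := Ls ?p)))) vs"
    by (rule shuf_swap[OF p])
  also have "\<dots> = shuf (\<lambda>_. 1) ?n (\<lambda>Ls. eps (d * e) *\<^sub>C tr_coeff k ?\<Theta> ?n (?B2 Ls)) vs"
  proof (rule shuf_cong)
    fix Ls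
    have "?B1 (Ls(?p := Ls (Suc ?p), Suc ?p := Ls ?p)) = (?B2 Ls)(?p := ?B2 Ls (Suc ?p), Suc ?p := ?B2 Ls ?p)"
      by (auto simp: fun_eq_iff nth_append nth_Cons')
    then have "tr_coeff k ?\<Theta> ?n (?B1 (Ls(?p := Ls (Suc ?p), Suc ?p := Ls ?p))) =
        tr_coeff k ?\<Theta> ?n ((?B2 Ls)(?p := ?B2 Ls (Suc ?p), Suc ?p := ?B2 Ls ?p))"
      by (simp only:)
    also have "\<dots> = tr_coeff k ?\<Theta> ?n (?B2 Ls)" by (rule tr_coeff_swap[OF p])
    finally have 1: "tr_coeff k ?\<Theta> ?n (?B1 (Ls(?p := Ls (Suc ?p), Suc ?p := Ls ?p))) = tr_coeff k ?\<Theta> ?n (?B2 Ls)" .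
    show "eps (ldeg (\<lambda>_. 1) (Ls ?p) * ldeg (\<lambda>_. 1) (Ls (Suc ?p))) *\<^sub>C
        tr_coeff k ?\<Theta> ?n (?B1 (Ls(?p := Ls (Suc ?p), Suc ?p := Ls ?p))) = eps (d * e) *\<^sub>C tr_coeff k ?\<Theta> ?n (?B2 Ls)"
    proof (cases "int (length (Ls ?p)) = e \<and> int (length (Ls (Suc ?p))) = d")
      case True
      then show ?thesis unfolding 1 by (simp add: mult.commute)
    next
      case False
      then have "?B2 Ls ?p = 0 \<or> ?B2 Ls (Suc ?p) = 0"
        using letter_deg[OF y] letter_deg[OF z] by (auto simp: nth_append)
      then have "tr_coeff k ?\<Theta> ?n (?B2 Ls) = 0"
        using tr_coeff_zero[OF p, of "?B2 Ls"] tr_coeff_zero[OF Suc_lessD[OF p], of "?B2 Ls"] by blast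
      then show ?thesis unfolding 1 by simp
    qed
  qed
  finally show ?thesis by (simp add: local_g_def shuf_scale)
qed

definition frame :: "'x \<Rightarrow> 'i" where "frame x = (SOME i. i \<in> trivs E \<and> x \<in> tdom E i)"

lemma frame_props: "frame x \<in> trivs E \<and> x \<in> tdom E (frame x)"
  unfolding frame_def
proof (rule someI_ex)
  have "x \<in> (\<Union>i\<in>trivs E. tdom E i)" using bundle_E by (simp add: holomorphic_bundle_def)
  then show "\<exists>i. i \<in> trivs E \<and> x \<in> tdom E i" by blast
qed

lemma dom_L_frame: "x \<in> dom_L X L c j \<longleftrightarrow> x \<in> dom c (frame x) j"
  using frame_props by (auto simp: dom_L_def dom_EL_def)

lemma g_map_frame: "g_map E \<theta> k w c j x vs \<xi> = local_g \<theta> k (frame x) w c j x vs \<xi>"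
  unfolding g_map_eq_local frame_def ..

lemma g_map_local:
  assumes "w \<in> words V" "x \<in> dom c i j"
  shows "g_map E \<theta> k w c j x vs \<xi> = local_g \<theta> k i w c j x vs \<xi>"
proof -
  have "x \<in> dom c (frame x) j" using assms(2) frame_props dom_memD[OF assms(2)] by (auto simp: dom_EL_def)
  then show ?thesis unfolding g_map_frame by (rule local_g_frame[OF _ assms(2,1)])
qed

text \<open>Near a given point the trivialisation of \<open>E\<close> may be kept fixed, which gives smoothness. For the
  transformation law, the same trivialisation is used in both charts.\<close>

lemma g_map_A_Sym:
  assumes w: "w \<in> words V" and d: "wdeg w = int p"
  shows "g_map E \<theta> k w \<in> A_Sym X L p k"
  unfolding A_Sym_def mem_Collect_eq
proof (intro conjI allI impI ballI)
  fix c j x and vs :: "(complex^'m) list" and \<xi> assume "x \<notin> dom_L X L c j \<or> length vs \<noteq> p"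
  then show "g_map E \<theta> k w c j x vs \<xi> = 0"
    unfolding g_map_frame dom_L_frame using local_g_out[OF w] local_g_deg[OF w] d by auto
next
  fix c j x \<xi> show "alt_multilinear cnj (\<lambda>vs. g_map E \<theta> k w c j x vs \<xi>)"
    unfolding g_map_frame by (rule local_g_alt[OF w])
next
  fix c j x and vs :: "(complex^'m) list" show "g_map E \<theta> k w c j x vs \<in> hom_polys k"
    using local_g_hom_polys[OF w, of k "frame x" c j x vs] by (simp add: g_map_frame[abs_def])
next
  fix c j and vs :: "(complex^'m) list" and \<xi>
  show "smooth_on (chart X c ` dom_L X L c j) (\<lambda>z. g_map E \<theta> k w c j (pchart X c z) vs \<xi>)"
  proof (rule smooth_on_local)
    fix z assume "z \<in> chart X c ` dom_L X L c j"
    then obtain x where x: "x \<in> dom c (frame x) j" "z = chart X c x" using dom_L_frame by blast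
    have "smooth_on (chart X c ` dom c (frame x) j) (\<lambda>z. g_map E \<theta> k w c j (pchart X c z) vs \<xi>)"
      by (rule smooth_on_cong[OF open_chart_dom _ local_g_smooth[OF w]])
        (auto simp: pchart_dom g_map_local[OF w])
    then show "\<exists>T. open T \<and> z \<in> T \<and> smooth_on T (\<lambda>z. g_map E \<theta> k w c j (pchart X c z) vs \<xi>)"
      using open_chart_dom x by blast
  qed
next
  fix c j c' j' x and vs :: "(complex^'m) list" and \<xi> assume "x \<in> dom_L X L c j \<inter> dom_L X L c' j'"
  then have "x \<in> dom c (frame x) j" "x \<in> dom c' (frame x) j'" using dom_L_frame by blast+
  from local_g_trans[OF this w]
  show "g_map E \<theta> k w c j x vs \<xi> = g_map E \<theta> k w c' j' x (map (jac X c c' x) vs) (dual_trans L j j' x \<xi>)"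
    unfolding g_map_frame .
qed

lemma g_map_zero:
  assumes w: "w \<in> words V" and d: "wdeg w < 0"
  shows "g_map E \<theta> k w = 0"
proof (intro ext)
  fix c j x vs \<xi>
  show "g_map E \<theta> k w c j x vs \<xi> = 0 c j x vs \<xi>"
    unfolding g_map_frame using local_g_deg[OF w] d by simp
qed

lemma subspace_A_Sym: "cvs.subspace (A_Sym X L p k)"
  unfolding cvs.subspace_def
proof (intro conjI ballI allI)
  have o: "open (chart X c ` dom_L X L c j)" for c j
  proof (cases "dom_L X L c j = {}")
    case False
    then have c: "c \<in> charts X" "j \<in> trivs L" by (auto simp: dom_L_def split: if_splits)
    moreover have "open (cdom X c)" using manifold c by (auto simp: compact_complex_manifold_def)
    moreover have "open (tdom L j)" using bundle_L c by (auto simp: holomorphic_bundle_def)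
    ultimately show ?thesis by (auto simp: dom_L_def intro!: open_chart_image)
  qed simp
  have E: "\<beta> \<in> A_Sym X L p k \<longleftrightarrow>
    (\<forall>c j x vs \<xi>. x \<notin> dom_L X L c j \<or> length vs \<noteq> p \<longrightarrow> \<beta> c j x vs \<xi> = 0) \<and>
    (\<forall>c j x \<xi>. alt_multilinear cnj (\<lambda>vs. \<beta> c j x vs \<xi>)) \<and>
    (\<forall>c j x vs. (\<lambda>\<xi>. \<beta> c j x vs \<xi>) \<in> hom_polys k) \<and>
    (\<forall>c j vs \<xi>. smooth_on (chart X c ` dom_L X L c j) (\<lambda>z. \<beta> c j (pchart X c z) vs \<xi>)) \<and>
    (\<forall>c j c' j'. \<forall>x\<in>dom_L X L c j \<inter> dom_L X L c' j'. \<forall>vs \<xi>.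
       \<beta> c j x vs \<xi> = \<beta> c' j' x (map (jac X c c' x) vs) (dual_trans L j j' x \<xi>))" for \<beta>
    by (simp add: A_Sym_def)
  show "0 \<in> A_Sym X L p k"
    by (simp add: E alt_multilinear_0 hom_polys_0 smooth_on_const)
  fix \<alpha> assume \<alpha>: "\<alpha> \<in> A_Sym X L p k"
  {
    fix \<beta> assume \<beta>: "\<beta> \<in> A_Sym X L p k"
    show "\<alpha> + \<beta> \<in> A_Sym X L p k"
      unfolding E
    proof (intro conjI)
      show "\<forall>c j c' j'. \<forall>x\<in>dom_L X L c j \<inter> dom_L X L c' j'. \<forall>vs \<xi>.
        (\<alpha> + \<beta>) c j x vs \<xi> = (\<alpha> + \<beta>) c' j' x (map (jac X c c' x) vs) (dual_trans L j j' x \<xi>)"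
        using \<alpha>[unfolded E] \<beta>[unfolded E] unfolding plus_fun_def by metis
      show "\<forall>c j x vs. (\<lambda>\<xi>. (\<alpha> + \<beta>) c j x vs \<xi>) \<in> hom_polys k"
        using \<alpha>[unfolded E] \<beta>[unfolded E] unfolding plus_fun_def by (auto intro!: hom_polys_add)
    qed (use \<alpha>[unfolded E] \<beta>[unfolded E] in \<open>auto intro!: alt_multilinear_add hom_polys_add smooth_on_add o\<close>)
  next
    fix a :: complex
    show "a *\<^sub>C \<alpha> \<in> A_Sym X L p k"
      unfolding E scaleC_fun_def
    proof (intro conjI)
      show "\<forall>c j c' j'. \<forall>x\<in>dom_L X L c j \<inter> dom_L X L c' j'. \<forall>vs \<xi>.
        a *\<^sub>C \<alpha> c j x vs \<xi> = a *\<^sub>C \<alpha> c' j' x (map (jac X c c' x) vs) (dual_trans L j j' x \<xi>)"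
        using \<alpha>[unfolded E] by metis
      show "\<forall>c j x vs. (\<lambda>\<xi>. a *\<^sub>C \<alpha> c j x vs \<xi>) \<in> hom_polys k"
        unfolding scaleC_complex_def using \<alpha>[unfolded E] by (auto intro!: hom_polys_scale)
    qed (use \<alpha>[unfolded E] in \<open>auto intro!: alt_multilinear_scale smooth_on_scaleC o\<close>)
  }
qed

lemma subspace_Sym_forms: "cvs.subspace (Sym_forms r X L n)"
proof (cases "n < 0")
  case True
  then show ?thesis by (simp add: Sym_forms_def cvs.subspace_def)
next
  case False
  then show ?thesis
    using subspace_A_Sym unfolding cvs.subspace_def Sym_forms_def
    by (auto simp: scaleC_fun_apply)
qed

lemma h_map_apply: "h_map E \<theta> w k c j x vs \<xi> =
    (if k \<in> {1..CARD('r)} then local_g \<theta> k (frame x) w c j x vs \<xi> else 0)"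
  by (simp add: h_map_def g_map_frame)

lemma h_map_sym_maps: "sym_maps V (Sym_forms CARD('r) X L) 0 (h_map E \<theta>)"
  unfolding sym_maps_def
proof (intro conjI allI impI ballI)
  fix w assume w: "w \<in> words V"
  show "h_map E \<theta> w \<in> Sym_forms CARD('r) X L (wdeg w + 0)"
  proof (cases "wdeg w < 0")
    case True
    then show ?thesis using g_map_zero[OF w True] by (auto simp: Sym_forms_def h_map_def)
  next
    case False
    then have "g_map E \<theta> k w \<in> A_Sym X L (nat (wdeg w)) k" for k by (intro g_map_A_Sym[OF w]) simp
    then show ?thesis using False by (auto simp: Sym_forms_def h_map_def)
  qed
next
  fix u w d x y a b
  show "h_map E \<theta> (u @ (d, a *\<^sub>C x + b *\<^sub>C y) # w) =
      a *\<^sub>C h_map E \<theta> (u @ (d, x) # w) + b *\<^sub>C h_map E \<theta> (u @ (d, y) # w)"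
    by (intro ext) (simp add: scaleC_fun_apply h_map_apply
        local_g_linear[where d=d and d'=d and d''=d])
next
  fix u w d e x y assume "u @ (d, x) # (e, y) # w \<in> words V"
  then show "h_map E \<theta> (u @ (d, x) # (e, y) # w) = (-1) powi (d * e) *\<^sub>C h_map E \<theta> (u @ (e, y) # (d, x) # w)"
    by (intro ext) (simp add: scaleC_fun_apply h_map_apply local_g_swap eps_def)
qed

end

section \<open>The morphism equation\<close>

lemma commutator_minus: "commutator A B = - commutator B A"
  by (simp add: commutator_def)

context hitchin
begin

text \<open>The part of an element of \<open>M\<close> in \<open>\<And>\<^sup>0 L\<close>.\<close>

definition degree_zero :: "('x, 'c, 'm, 'i, 'r, 'j, 's) End_form \<Rightarrow> ('x, 'c, 'm, 'i, 'r, 'j, 's) End_form"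
  where "degree_zero v = (\<lambda>c i j x vs ls. if ls = [] then v c i j x vs ls else 0)"

lemma degree_zero_simps [simp]:
  "degree_zero v c i j x vs [] = v c i j x vs []" "degree_zero v c i j x vs (l # ls) = 0"
  by (simp_all add: degree_zero_def)

lemma degree_zero_in: "v \<in> M n \<Longrightarrow> degree_zero v \<in> M n"
proof (cases "n \<ge> 0")
  case True
  assume v: "v \<in> M n"
  have n: "n = int (nat n) + int 0" using True by simp
  obtain \<alpha> where \<alpha>: "\<alpha> \<in> A (nat n) 0" "\<And>c i j x vs ls. length ls = 0 \<Longrightarrow> v c i j x vs ls = \<alpha> c i j x vs ls"
    using M_component[OF v n] by metis
  have "degree_zero v = \<alpha>"
  proof (intro ext)
    fix c i j x vs ls
    show "degree_zero v c i j x vs ls = \<alpha> c i j x vs ls"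
      using \<alpha>(2)[of ls] A_zero[OF \<alpha>(1), of x c i j vs ls] by (cases ls) auto
  qed
  then show ?thesis using A_subset_M[OF \<alpha>(1) n] by simp
next
  case False
  assume v: "v \<in> M n"
  have "v c i j x vs [] = 0" for c i j x vs
    using M_zero_component[OF v, of "[]"] False by simp
  then have "degree_zero v = 0" by (simp add: degree_zero_def fun_eq_iff)
  then show ?thesis using cvs.subspace_0[OF subspace_M] by simp
qed

lemma letter0_deg:
  assumes "v \<in> M (d + 1)" "int (length vs) \<noteq> d + 1"
  shows "v c i j x vs [] = 0"
proof (cases "d + 1 \<ge> 0")
  case True
  have n: "d + 1 = int (nat (d + 1)) + int 0" using True by simp
  obtain \<alpha> where \<alpha>: "\<alpha> \<in> A (nat (d + 1)) 0" "\<And>c i j x vs ls. length ls = 0 \<Longrightarrow> v c i j x vs ls = \<alpha> c i j x vs ls"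
    using M_component[OF assms(1) n] by metis
  have "\<alpha> c i j x vs [] = 0" by (rule A_zero[OF \<alpha>(1)]) (use assms(2) True in auto)
  then show ?thesis using \<alpha>(2)[of "[]"] by simp
qed (use M_zero_component[OF assms(1), of "[]"] in simp)

text \<open>The tangent vectors all go to \<open>v\<close>, and the argument from \<open>L\<^sup>*\<close> goes to \<open>\<theta>\<close>, passing the form part of
  \<open>v\<close>.\<close>

lemma bracket_\<theta>_value:
  "M_bracket \<theta> v c i j x K [\<xi>] = (-1) ^ length K *\<^sub>C commutator (\<theta> c i j x [] [\<xi>]) (v c i j x K [])"
proof -
  have "M_bracket \<theta> v c i j x K [\<xi>] = shuf (\<lambda>_. 1) 2 (\<lambda>Vs. if Vs 0 = [] then
      (-1) ^ length (Vs 1) *\<^sub>C commutator (\<theta> c i j x [] [\<xi>]) (v c i j x (Vs 1) []) else 0) K"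
    unfolding M_bracket_eq form_prod_one
    by (rule shuf_cong) (use A_zero[OF \<theta>_A, of x c i j] in simp)
  then show ?thesis
    unfolding shuf2_Nil[of "\<lambda>_. 1" "\<lambda>us. (-1) ^ length us *\<^sub>C commutator (\<theta> c i j x [] [\<xi>]) (v c i j x us [])"] .
qed

lemma bracket_degree_zero_value:
  "M_bracket (degree_zero a) b c i j x K [\<xi>] =
    shuf (\<lambda>_. 1) 2 (\<lambda>Vs. commutator (a c i j x (Vs 0) []) (b c i j x (Vs 1) [\<xi>])) K"
  unfolding M_bracket_eq form_prod_one by (rule shuf_cong) simp

text \<open>On one argument from \<open>L\<^sup>*\<close> either \<open>a\<close> or \<open>b\<close> enters with its part in \<open>\<And>\<^sup>0 L\<close>. The second term is
  brought to the same shape as the first one by graded antisymmetry.\<close>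

lemma bracket_value:
  assumes a: "a \<in> M (d + 1)" and b: "b \<in> M (e + 1)"
  shows "M_bracket a b c i j x K [\<xi>] = M_bracket (degree_zero a) b c i j x K [\<xi>] +
    eps (d * e + d + e) *\<^sub>C M_bracket (degree_zero b) a c i j x K [\<xi>]"
proof -
  let ?a0 = "\<lambda>V. a c i j x V []" and ?a1 = "\<lambda>V. a c i j x V [\<xi>]"
  let ?b0 = "\<lambda>V. b c i j x V []" and ?b1 = "\<lambda>V. b c i j x V [\<xi>]"
  have "M_bracket (degree_zero b) a c i j x K [\<xi>] =
    shuf (\<lambda>_. 1) 2 (\<lambda>Vs. eps (int (length (Vs 0)) * int (length (Vs 1))) *\<^sub>C commutator (?b0 (Vs 1)) (?a1 (Vs 0))) K"
    unfolding bracket_degree_zero_value by (subst shuf_swap[of 0]) simp_all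
  then have "eps (d * e + d + e) *\<^sub>C M_bracket (degree_zero b) a c i j x K [\<xi>] =
    shuf (\<lambda>_. 1) 2 (\<lambda>Vs. eps (d * e + d + e + int (length (Vs 0)) * int (length (Vs 1))) *\<^sub>C
      commutator (?b0 (Vs 1)) (?a1 (Vs 0))) K"
    by (simp add: shuf_scale[symmetric] eps_mult)
  also have "\<dots> = shuf (\<lambda>_. 1) 2 (\<lambda>Vs. (-1) ^ length (Vs 1) *\<^sub>C commutator (?a1 (Vs 0)) (?b0 (Vs 1))) K"
  proof (rule shuf_cong)
    fix Vs :: "nat \<Rightarrow> (complex^'m) list"
    show "eps (d * e + d + e + int (length (Vs 0)) * int (length (Vs 1))) *\<^sub>C commutator (?b0 (Vs 1)) (?a1 (Vs 0)) =
      (-1) ^ length (Vs 1) *\<^sub>C commutator (?a1 (Vs 0)) (?b0 (Vs 1))"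
    proof (cases "int (length (Vs 0)) = d \<and> int (length (Vs 1)) = e + 1")
      case True
      have "(-1) ^ length (Vs 1) = eps (int (length (Vs 1)))" by (simp add: eps_def)
      then have "(-1) ^ length (Vs 1) = eps (e + 1)" using True by simp
      moreover have "eps (d * e + d + e + d * (e + 1)) = - eps (e + 1)"
        unfolding minus_eps by (rule eps_eqI) (simp add: algebra_simps)
      ultimately show ?thesis using True commutator_minus[of "?b0 (Vs 1)"] by simp
    next
      case False
      then show ?thesis using letter_deg[OF a] letter0_deg[OF b] by auto
    qed
  qed
  finally have "eps (d * e + d + e) *\<^sub>C M_bracket (degree_zero b) a c i j x K [\<xi>] =
     shuf (\<lambda>_. 1) 2 (\<lambda>Vs. (-1) ^ length (Vs 1) *\<^sub>C commutator (?a1 (Vs 0)) (?b0 (Vs 1))) K" .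
  then show ?thesis
    unfolding bracket_degree_zero_value[of a] M_bracket_eq[THEN fun_cong, THEN fun_cong, of a] form_prod_one shuf_add
    by simp
qed

lemma local_g_pick_move:
  assumes "\<And>x. x \<in> set w \<Longrightarrow> snd x \<in> V (fst x) \<and> fst (g x) = fst x + s \<and> snd (g x) \<in> V (fst x + s)"
  shows "pick fst (\<lambda>b us. local_g \<theta> k i (g b # us) c j x vs \<xi>) w =
    (\<Sum>a<length w. eps (s * ldeg fst (take a w)) *\<^sub>C local_g \<theta> k i (take a w @ g (w ! a) # drop (Suc a) w) c j x vs \<xi>)"
  by (rule pick_move[where f="\<lambda>w. local_g \<theta> k i w c j x vs \<xi>"])
    (rule local_g_linear local_g_swap assms, assumption?)+

text \<open>Where the letters do not vanish, the blocks of tangent vectors have the lengths prescribed by the degrees;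
  so signs of vectors and signs of letters agree.\<close>

lemma predeg_letters:
  assumes u: "\<And>y. y \<in> set u \<Longrightarrow> snd y \<in> M (fst y + 1)" and l: "l \<le> length u"
    and nz: "\<And>m. m < l \<Longrightarrow> snd (u ! m) c i j x (Ls m) [\<xi>] \<noteq> 0"
  shows "predeg (\<lambda>_. 1) Ls l = ldeg fst (take l u)"
  using l nz
proof (induction l)
  case (Suc l)
  have "int (length (Ls l)) = fst (u ! l)"
    using letter_deg[OF u[of "u ! l"]] Suc.prems by (metis Suc_le_eq lessI nth_mem)
  then show ?case using Suc by (simp add: take_Suc_conv_app_nth)
qed simp

text \<open>The terms of the morphism equation in which \<open>v\<close> enters through its part \<open>\<phi>\<close> in \<open>\<And>\<^sup>0 L\<close>. All of them are
  written as a sum that first extracts the tangent vectors \<open>Ks 0\<close> for \<open>\<phi>\<close> and then distributes the other ones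
  to the letters of \<open>u\<close>: for the differential (\<open>P\<close>) this is the splitting of the first block, for the bracket
  with the letter \<open>l\<close> (\<open>Q l\<close>) it is \<open>shuf_shuf_block\<close>, the bracket being itself a sum over distributions of
  block \<open>l\<close>. For fixed vectors the sum of \<open>P\<close> and of all \<open>Q l\<close> vanishes by \<open>tr_coeff_invariant\<close>.\<close>

lemma local_g_bracket_cancel:
  assumes v: "v \<in> M (d + 1)" and u: "\<And>y. y \<in> set u \<Longrightarrow> snd y \<in> M (fst y + 1)"
  shows "local_g \<theta> k i ((d + 1, - M_bracket \<theta> v) # u) c j x vs \<xi> +
    pick fst (\<lambda>b us. eps (d + 1) *\<^sub>C
      local_g \<theta> k i ((d + fst b + 1, M_bracket (degree_zero v) (snd b)) # us) c j x vs \<xi>) u = 0"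
proof -
  let ?n = "length u" and ?\<Theta> = "\<theta> c i j x [] [\<xi>]" and ?\<phi> = "\<lambda>K. v c i j x K []"
  let ?Y = "\<lambda>Ls l. snd (u ! l) c i j x (Ls l) [\<xi>]"
  let ?s = "\<lambda>K :: (complex^'m) list. (-1) ^ length K :: complex"
  define P where "P = (\<lambda>K Ls. tr_coeff k ?\<Theta> (Suc ?n) (case_nat (commutator (?\<phi> K) ?\<Theta>) (?Y Ls)))"
  define Q where "Q = (\<lambda>l K Ls. tr_coeff k ?\<Theta> ?n ((?Y Ls)(l := commutator (?\<phi> K) (?Y Ls l))))"
  have first: "local_g \<theta> k i ((d + 1, - M_bracket \<theta> v) # u) c j x vs \<xi> =
     shuf (\<lambda>_. 1) 2 (\<lambda>Ks. shuf (\<lambda>_. 1) ?n (\<lambda>Ls. ?s (Ks 0) *\<^sub>C P (Ks 0) Ls) (Ks 1)) vs"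
    unfolding local_g_def list.size One_nat_def[symmetric] add_0_right Suc_eq_plus1[symmetric] shuf_Suc_eq_shuf2
  proof (intro shuf_cong)
    fix Ks Ls
    let ?w = "(d + 1, - M_bracket \<theta> v) # u"
    have "- M_bracket \<theta> v c i j x (Ks 0) [\<xi>] = ?s (Ks 0) *\<^sub>C commutator (?\<phi> (Ks 0)) ?\<Theta>"
      unfolding bracket_\<theta>_value by (subst commutator_minus) simp
    then have "(\<lambda>l. snd (?w ! l) c i j x (case_nat (Ks 0) Ls l) [\<xi>]) =
      (case_nat (commutator (?\<phi> (Ks 0)) ?\<Theta>) (?Y Ls))(0 := ?s (Ks 0) *\<^sub>C commutator (?\<phi> (Ks 0)) ?\<Theta>)"
      by (auto simp: fun_eq_iff split: nat.split)
    moreover have "(case_nat (commutator (?\<phi> (Ks 0)) ?\<Theta>) (?Y Ls))(0 := commutator (?\<phi> (Ks 0)) ?\<Theta>) =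
      case_nat (commutator (?\<phi> (Ks 0)) ?\<Theta>) (?Y Ls)" by (auto simp: fun_eq_iff split: nat.split)
    ultimately show "tr_coeff k ?\<Theta> (Suc ?n) (\<lambda>l. snd (?w ! l) c i j x (case_nat (Ks 0) Ls l) [\<xi>]) = ?s (Ks 0) *\<^sub>C P (Ks 0) Ls"
      unfolding P_def by (simp only: tr_coeff_scale[OF zero_less_Suc])
  qed
  have second: "eps ((d + 1) * ldeg fst (take l u)) *\<^sub>C
      local_g \<theta> k i (take l u @ (d + fst (u ! l) + 1, M_bracket (degree_zero v) (snd (u ! l))) # drop (Suc l) u) c j x vs \<xi> =
     shuf (\<lambda>_. 1) 2 (\<lambda>Ks. shuf (\<lambda>_. 1) ?n (\<lambda>Ls. Q l (Ks 0) Ls) (Ks 1)) vs" if l: "l < ?n" for l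
  proof -
    let ?w = "take l u @ (d + fst (u ! l) + 1, M_bracket (degree_zero v) (snd (u ! l))) # drop (Suc l) u"
    define e where "e = (d + 1) * ldeg fst (take l u)"
    have len: "length ?w = ?n" using l by simp
    have "local_g \<theta> k i ?w c j x vs \<xi> = shuf (\<lambda>_. 1) ?n (\<lambda>Ls. shuf (\<lambda>_. 1) 2
        (\<lambda>Ks. Q l (Ks 0) (Ls(l := Ks 1))) (Ls l)) vs"
      unfolding local_g_def len
    proof (rule shuf_cong)
      fix Ls
      have "(\<lambda>m. snd (?w ! m) c i j x (Ls m) [\<xi>]) m = ((?Y Ls)(l := shuf (\<lambda>_. 1) 2
          (\<lambda>Ks. commutator (?\<phi> (Ks 0)) (snd (u ! l) c i j x (Ks 1) [\<xi>])) (Ls l))) m" if "m < ?n" for m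
        using l that bracket_degree_zero_value[of v "snd (u ! l)" c i j x "Ls l" \<xi>]
        by (cases m l rule: linorder_cases) (auto simp: nth_append nth_Cons' min_def)
      then have "tr_coeff k ?\<Theta> ?n (\<lambda>m. snd (?w ! m) c i j x (Ls m) [\<xi>]) =
        tr_coeff k ?\<Theta> ?n ((?Y Ls)(l := shuf (\<lambda>_. 1) 2 (\<lambda>Ks. commutator (?\<phi> (Ks 0)) (snd (u ! l) c i j x (Ks 1) [\<xi>])) (Ls l)))"
        by (rule tr_coeff_cong)
      also have "\<dots> = shuf (\<lambda>_. 1) 2 (\<lambda>Ks. tr_coeff k ?\<Theta> ?n ((?Y Ls)(l := commutator (?\<phi> (Ks 0)) (snd (u ! l) c i j x (Ks 1) [\<xi>])))) (Ls l)"
        by (rule shuf_linear) (simp_all only: tr_coeff_add[OF l] tr_coeff_scale[OF l])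
      also have "\<dots> = shuf (\<lambda>_. 1) 2 (\<lambda>Ks. Q l (Ks 0) (Ls(l := Ks 1))) (Ls l)"
        unfolding Q_def by (intro shuf_cong tr_coeff_cong) simp
      finally show "tr_coeff k ?\<Theta> ?n (\<lambda>m. snd (?w ! m) c i j x (Ls m) [\<xi>]) = \<dots>" .
    qed
    also have "\<dots> = shuf (\<lambda>_. 1) ?n (\<lambda>Ls. shuf (\<lambda>_. 1) 2 (\<lambda>Ks. eps (ldeg (\<lambda>_. 1) (Ks 0) * predeg (\<lambda>_. 1) Ls l) *\<^sub>C
        eps e *\<^sub>C Q l (Ks 0) (Ls(l := Ks 1))) (Ls l)) vs"
    \<comment> \<open>The sign required by \<open>shuf_shuf_block\<close> is inserted; on the terms that do not vanish, the vectors
        passed by \<open>Ks 0\<close> are as many as the letters before \<open>l\<close> require, so that it equals \<open>eps e\<close>.\<close>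
    proof (intro shuf_cong)
      fix Ls Ks :: "nat \<Rightarrow> (complex^'m) list"
      show "Q l (Ks 0) (Ls(l := Ks 1)) = eps (ldeg (\<lambda>_. 1) (Ks 0) * predeg (\<lambda>_. 1) Ls l) *\<^sub>C
        eps e *\<^sub>C Q l (Ks 0) (Ls(l := Ks 1))"
      proof (cases "int (length (Ks 0)) = d + 1 \<and> (\<forall>m<l. ?Y Ls m \<noteq> 0)")
        case True
        then have "predeg (\<lambda>_. 1) Ls l = ldeg fst (take l u)"
          using l by (intro predeg_letters[OF u]) auto
        then have "eps (ldeg (\<lambda>_. 1) (Ks 0) * predeg (\<lambda>_. 1) Ls l) * eps e = 1"
          using True by (simp add: e_def eps_mult) (simp add: eps_parity)
        then show ?thesis by (simp only: cvs.scale_scale cvs.scale_one)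
      next
        case False
        have "Q l (Ks 0) (Ls(l := Ks 1)) = 0"
        proof (cases "int (length (Ks 0)) = d + 1")
          case True
          then obtain m where m: "m < l" "?Y Ls m = 0" using False by blast
          show ?thesis unfolding Q_def
            by (rule tr_coeff_zero[of m]) (use m l in auto)
        next
          case ne: False
          show ?thesis unfolding Q_def letter0_deg[OF v ne]
            by (rule tr_coeff_zero[OF l]) simp
        qed
        then show ?thesis by simp
      qed
    qed
    also have "\<dots> = shuf (\<lambda>_. 1) 2 (\<lambda>Ks. shuf (\<lambda>_. 1) ?n (\<lambda>Ls. eps e *\<^sub>C Q l (Ks 0) Ls) (Ks 1)) vs"
      by (rule shuf_shuf_block[OF l, symmetric])
    finally have "eps e *\<^sub>C local_g \<theta> k i ?w c j x vs \<xi> = (eps e * eps e) *\<^sub>C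
        shuf (\<lambda>_. 1) 2 (\<lambda>Ks. shuf (\<lambda>_. 1) ?n (\<lambda>Ls. Q l (Ks 0) Ls) (Ks 1)) vs"
      by (simp only: shuf_scale cvs.scale_scale)
    moreover have "eps e * eps e = 1" by (simp add: eps_parity)
    ultimately show ?thesis by (simp add: e_def)
  qed
  have "pick fst (\<lambda>b us. eps (d + 1) *\<^sub>C local_g \<theta> k i ((d + fst b + 1, M_bracket (degree_zero v) (snd b)) # us) c j x vs \<xi>) u =
    eps (d + 1) *\<^sub>C (\<Sum>l<?n. eps ((d + 1) * ldeg fst (take l u)) *\<^sub>C
      local_g \<theta> k i (take l u @ (d + fst (u ! l) + 1, M_bracket (degree_zero v) (snd (u ! l))) # drop (Suc l) u) c j x vs \<xi>)"
    unfolding pick_scale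
  proof (rule arg_cong[where f="\<lambda>x. _ *\<^sub>C x"], rule local_g_pick_move)
    fix b assume b: "b \<in> set u"
    from M_bracket_M[OF degree_zero_in[OF v] u[OF b]]
    have "M_bracket (degree_zero v) (snd b) \<in> V (fst b + (d + 1))"
      by (simp add: shift_def add_ac)
    then show "snd b \<in> V (fst b) \<and> fst (d + fst b + 1, M_bracket (degree_zero v) (snd b)) = fst b + (d + 1) \<and>
       snd (d + fst b + 1, M_bracket (degree_zero v) (snd b)) \<in> V (fst b + (d + 1))"
      using u[OF b] by (simp add: shift_def)
  qed
  also have "\<dots> = eps (d + 1) *\<^sub>C shuf (\<lambda>_. 1) 2 (\<lambda>Ks. shuf (\<lambda>_. 1) ?n (\<lambda>Ls. \<Sum>l<?n. Q l (Ks 0) Ls) (Ks 1)) vs"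
    using second by (simp add: shuf_sum)
  also have "\<dots> = shuf (\<lambda>_. 1) 2 (\<lambda>Ks. shuf (\<lambda>_. 1) ?n (\<lambda>Ls. ?s (Ks 0) *\<^sub>C (\<Sum>l<?n. Q l (Ks 0) Ls)) (Ks 1)) vs"
    unfolding shuf_scale[symmetric]
  proof (intro shuf_cong)
    fix Ks Ls :: "nat \<Rightarrow> (complex^'m) list"
    show "eps (d + 1) *\<^sub>C (\<Sum>l<?n. Q l (Ks 0) Ls) = ?s (Ks 0) *\<^sub>C (\<Sum>l<?n. Q l (Ks 0) Ls)"
    proof (cases "int (length (Ks 0)) = d + 1")
      case True
      have "?s (Ks 0) = eps (int (length (Ks 0)))" by (simp add: eps_def)
      then show ?thesis using True by simp
    next
      case ne: False
      have "Q l (Ks 0) Ls = 0" if "l < ?n" for l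
        unfolding Q_def letter0_deg[OF v ne] by (rule tr_coeff_zero[OF that]) simp
      then show ?thesis by simp
    qed
  qed
  finally have sum: "pick fst (\<lambda>b us. eps (d + 1) *\<^sub>C local_g \<theta> k i ((d + fst b + 1, M_bracket (degree_zero v) (snd b)) # us) c j x vs \<xi>) u = \<dots>" .
  have "P K Ls + (\<Sum>l<?n. Q l K Ls) = 0" for K Ls
    unfolding P_def Q_def by (rule tr_coeff_invariant)
  then show ?thesis
    unfolding first sum shuf_add[symmetric] scaleC_add_right[symmetric] by simp
qed

lemma dbar_dir_local_g:
  assumes w: "w \<in> words V" and x: "x \<in> dom c i j"
  shows "(\<lambda>z. local_g \<theta> k i w c j (pchart X c z) vs \<xi>) differentiable (at (chart X c x)) \<and>
    dbar_dir (\<lambda>z. local_g \<theta> k i w c j (pchart X c z) vs \<xi>) (chart X c x) v =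
      (\<Sum>l<length w. shuf (\<lambda>_. 1) (length w) (\<lambda>Ls. tr_coeff k (\<theta> c i j x [] [\<xi>]) (length w)
        ((\<lambda>m. snd (w ! m) c i j x (Ls m) [\<xi>])
          (l := dbar_dir (\<lambda>z. snd (w ! l) c i j (pchart X c z) (Ls l) [\<xi>]) (chart X c x) v))) vs)"
proof -
  have \<theta>: "hol_at (\<lambda>z. \<theta> c i j (pchart X c z) [] [\<xi>]) (chart X c x)"
    by (rule hol_on_hol_at[OF \<theta>_hol]) (use x in blast)
  have d: "(\<lambda>z. snd (w ! l) c i j (pchart X c z) us [\<xi>]) differentiable (at (chart X c x))" if "l < length w" for l us
    by (rule letter_differentiable[OF letter_in[OF w that] x])
  have "(\<lambda>z. tr_coeff k (\<theta> c i j (pchart X c z) [] [\<xi>]) (length w) (\<lambda>l. snd (w ! l) c i j (pchart X c z) (Ls l) [\<xi>]))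
      differentiable (at (chart X c x))"
    "dbar_dir (\<lambda>z. tr_coeff k (\<theta> c i j (pchart X c z) [] [\<xi>]) (length w) (\<lambda>l. snd (w ! l) c i j (pchart X c z) (Ls l) [\<xi>]))
       (chart X c x) v = (\<Sum>l<length w. tr_coeff k (\<theta> c i j x [] [\<xi>]) (length w)
        ((\<lambda>m. snd (w ! m) c i j x (Ls m) [\<xi>])
          (l := dbar_dir (\<lambda>z. snd (w ! l) c i j (pchart X c z) (Ls l) [\<xi>]) (chart X c x) v)))" for Ls
    using dbar_dir_tr_coeff(1)[OF \<theta>, of "length w" "\<lambda>z l. snd (w ! l) c i j (pchart X c z) (Ls l) [\<xi>]" k]
      dbar_dir_tr_coeff(2)[OF \<theta>, of "length w" "\<lambda>z l. snd (w ! l) c i j (pchart X c z) (Ls l) [\<xi>]" k v] d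
    by (simp_all add: pchart_dom[OF x] del: fun_upd_apply)
  then show ?thesis
    unfolding local_g_def shuf_sum[symmetric]
    using dbar_dir_shuf[where T="\<lambda>z Ls. tr_coeff k (\<theta> c i j (pchart X c z) [] [\<xi>]) (length w) (\<lambda>l. snd (w ! l) c i j (pchart X c z) (Ls l) [\<xi>])"
        and ?z0.0="chart X c x" and dg="\<lambda>_. 1" and n="length w" and vs=vs and v=v]
    by (simp del: fun_upd_apply)
qed

text \<open>The Leibniz rule. The derivative hits one letter \<open>l\<close>, and \<open>pick_shuf\<close> moves the choice of the
  direction \<open>v\<close> into the block of \<open>l\<close>, where it forms \<open>\<partial>\<close>-bar of the letter. The direction passes the
  blocks before \<open>l\<close>, which is the sign of a differential of degree one passing the letters before \<open>l\<close>.\<close>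

lemma dbar_local_g:
  assumes w: "w \<in> words V" and x: "x \<in> dom c i j"
  shows "pick (\<lambda>_. 1) (\<lambda>v us. dbar_dir (\<lambda>z. local_g \<theta> k i w c j (pchart X c z) us \<xi>) (chart X c x) v) vs =
    (\<Sum>l<length w. eps (ldeg fst (take l w)) *\<^sub>C local_g \<theta> k i
      (take l w @ (fst (w ! l) + 1, dbar_End X E L (snd (w ! l))) # drop (Suc l) w) c j x vs \<xi>)"
proof -
  let ?n = "length w" and ?\<Theta> = "\<theta> c i j x [] [\<xi>]" and ?z = "chart X c x"
  let ?Y = "\<lambda>Ls m. snd (w ! m) c i j x (Ls m) [\<xi>]"
  let ?D = "\<lambda>l us v. dbar_dir (\<lambda>z. snd (w ! l) c i j (pchart X c z) us [\<xi>]) ?z v"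
  define U where "U = (\<lambda>l v Ls. tr_coeff k ?\<Theta> ?n ((?Y Ls)(l := ?D l (Ls l) v)))"
  have "pick (\<lambda>_. 1) (\<lambda>v us. dbar_dir (\<lambda>z. local_g \<theta> k i w c j (pchart X c z) us \<xi>) ?z v) vs =
    (\<Sum>l<?n. pick (\<lambda>_. 1) (\<lambda>v us. shuf (\<lambda>_. 1) ?n (U l v) us) vs)"
    unfolding pick_sum[symmetric] U_def using dbar_dir_local_g[OF w x] by simp
  also have "\<dots> = (\<Sum>l<?n. eps (ldeg fst (take l w)) *\<^sub>C local_g \<theta> k i
      (take l w @ (fst (w ! l) + 1, dbar_End X E L (snd (w ! l))) # drop (Suc l) w) c j x vs \<xi>)"
  proof (rule sum.cong[OF refl])
    fix l assume "l \<in> {..<?n}"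
    then have l: "l < ?n" by simp
    let ?w = "take l w @ (fst (w ! l) + 1, dbar_End X E L (snd (w ! l))) # drop (Suc l) w"
    have len: "length ?w = ?n" using l by simp
    have "pick (\<lambda>_. 1) (\<lambda>v us. shuf (\<lambda>_. 1) ?n (U l v) us) vs =
      shuf (\<lambda>_. 1) ?n (\<lambda>Ls. pick (\<lambda>_. 1) (\<lambda>v us. eps (1 * predeg (\<lambda>_. 1) Ls l) *\<^sub>C U l v (Ls(l := us))) (Ls l)) vs"
      by (rule pick_shuf[OF l])
    also have "\<dots> = shuf (\<lambda>_. 1) ?n (\<lambda>Ls. eps (ldeg fst (take l w)) *\<^sub>C
        tr_coeff k ?\<Theta> ?n (\<lambda>m. snd (?w ! m) c i j x (Ls m) [\<xi>])) vs"
    proof (rule shuf_cong)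
      fix Ls
      have "tr_coeff k ?\<Theta> ?n (\<lambda>m. snd (?w ! m) c i j x (Ls m) [\<xi>]) =
        tr_coeff k ?\<Theta> ?n ((?Y Ls)(l := pick (\<lambda>_. 1) (\<lambda>v us. ?D l us v) (Ls l)))"
      proof (rule tr_coeff_cong)
        fix m assume "m < ?n"
        then show "snd (?w ! m) c i j x (Ls m) [\<xi>] = ((?Y Ls)(l := pick (\<lambda>_. 1) (\<lambda>v us. ?D l us v) (Ls l))) m"
          using l dbar_End_eq_pick[OF x, of "snd (w ! l)" "Ls l" "[\<xi>]"]
          by (cases m l rule: linorder_cases) (auto simp: nth_append nth_Cons' min_def)
      qed
      also have "\<dots> = pick (\<lambda>_. 1) (\<lambda>v us. tr_coeff k ?\<Theta> ?n ((?Y Ls)(l := ?D l us v))) (Ls l)"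
      proof -
        have "tr_coeff k ?\<Theta> ?n ((?Y Ls)(l := sum f I)) = (\<Sum>a\<in>I. tr_coeff k ?\<Theta> ?n ((?Y Ls)(l := f a)))" for f :: "nat \<Rightarrow> _" and I
        proof (induction I rule: infinite_finite_induct)
          case (insert a I)
          then show ?case by (simp only: sum.insert[OF insert.hyps] tr_coeff_add[OF l])
        qed (auto intro: tr_coeff_zero[OF l])
        then show ?thesis unfolding pick_eq_sum by (simp only: tr_coeff_scale[OF l])
      qed
      also have "\<dots> = pick (\<lambda>_. 1) (\<lambda>v us. U l v (Ls(l := us))) (Ls l)"
        unfolding U_def by (intro pick_cong tr_coeff_cong) simp
      finally have e: "tr_coeff k ?\<Theta> ?n (\<lambda>m. snd (?w ! m) c i j x (Ls m) [\<xi>]) = pick (\<lambda>_. 1) (\<lambda>v us. U l v (Ls(l := us))) (Ls l)" .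
      show "pick (\<lambda>_. 1) (\<lambda>v us. eps (1 * predeg (\<lambda>_. 1) Ls l) *\<^sub>C U l v (Ls(l := us))) (Ls l) =
        eps (ldeg fst (take l w)) *\<^sub>C tr_coeff k ?\<Theta> ?n (\<lambda>m. snd (?w ! m) c i j x (Ls m) [\<xi>])"
      proof (cases "\<forall>m<l. ?Y Ls m \<noteq> 0")
        case True
        have "predeg (\<lambda>_. 1) Ls l = ldeg fst (take l w)"
          by (rule predeg_letters) (use w True l in \<open>auto simp: words_iff shift_def\<close>)
        then show ?thesis unfolding e pick_scale by simp
      next
        case False
        then obtain m where m: "m < l" "?Y Ls m = 0" by blast
        have "U l v (Ls(l := us)) = 0" for v us
          unfolding U_def by (rule tr_coeff_zero[of m]) (use m l in auto)
        then show ?thesis unfolding e by simp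
      qed
    qed
    finally show "pick (\<lambda>_. 1) (\<lambda>v us. shuf (\<lambda>_. 1) ?n (U l v) us) vs =
       eps (ldeg fst (take l w)) *\<^sub>C local_g \<theta> k i ?w c j x vs \<xi>"
      unfolding local_g_def len shuf_scale .
  qed
  finally show ?thesis .
qed

lemma dbar_g_map:
  assumes w: "w \<in> words V" and x: "x \<in> dom c i j"
  shows "dbar_Sym X L (g_map E \<theta> k w) c j x vs \<xi> =
    pick (\<lambda>_. 1) (\<lambda>v us. dbar_dir (\<lambda>z. local_g \<theta> k i w c j (pchart X c z) us \<xi>) (chart X c x) v) vs"
proof -
  have "x \<in> dom_L X L c j" using x by (auto simp: dom_L_def dom_EL_def split: if_splits)
  moreover have "dbar_dir (\<lambda>z. local_g \<theta> k i w c j (pchart X c z) us \<xi>) (chart X c x) v =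
    dbar_dir (\<lambda>z. g_map E \<theta> k w c j (pchart X c z) us \<xi>) (chart X c x) v" for v us
    by (rule dbar_dir_cong[OF _ open_chart_dom[of c i j]])
      (use dbar_dir_local_g[OF w x] x in \<open>auto simp: pchart_dom g_map_local[OF w]\<close>)
  ultimately show ?thesis by (simp add: dbar_Sym_def pick_eq_sum)
qed

text \<open>The structure map \<open>q\<close> is nonzero on one or two letters only. One letter gives \<open>D\<close> and \<open>T\<close>, the
  Dolbeault part and the part with \<open>\<theta>\<close>. Two letters give \<open>H\<close>, in both orders, and so, by
  \<open>pick_pick\<close>, the choice of a first letter that enters with its part in \<open>\<And>\<^sup>0 L\<close>, and of a second one. For each first
  letter \<open>T\<close> and \<open>H\<close> cancel.\<close>

lemma local_g_Linfty:
  assumes w: "w \<in> words V" and x: "x \<in> dom c i j"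
  shows "shuf fst 2 (\<lambda>Ks. if Ks 0 = [] then 0 else
      local_g \<theta> k i ((wdeg (Ks 0) + 1, Linfty_of_dgla (M_diff X E L \<theta>) M_bracket (Ks 0)) # Ks 1) c j x vs \<xi>) w =
    - dbar_Sym X L (g_map E \<theta> k w) c j x vs \<xi>"
proof -
  let ?q = "Linfty_of_dgla (M_diff X E L \<theta>) M_bracket"
  let ?lo = "\<lambda>u. local_g \<theta> k i u c j x vs \<xi>"
  define D where "D = (\<lambda>(a :: int \<times> _) u. ?lo ((fst a + 1, dbar_End X E L (snd a)) # u))"
  define T where "T = (\<lambda>(a :: int \<times> _) u. ?lo ((fst a + 1, - M_bracket \<theta> (snd a)) # u))"
  define H where "H = (\<lambda>(a :: int \<times> _) (b :: int \<times> _) u. eps (fst a + 1) *\<^sub>C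
    ?lo ((fst a + fst b + 1, M_bracket (degree_zero (snd a)) (snd b)) # u))"
  have letters: "snd a \<in> M (fst a + 1)" if "a \<in> set w" for a
    using w that by (auto simp: words_iff shift_def)
  have "shuf fst 2 (\<lambda>Ks. if Ks 0 = [] then 0 else ?lo ((wdeg (Ks 0) + 1, ?q (Ks 0)) # Ks 1)) w =
    shuf fst 2 (\<lambda>Ks. (if length (Ks 0) = 1 then - D (hd (Ks 0)) (Ks 1) else 0) +
      ((if length (Ks 0) = 1 then T (hd (Ks 0)) (Ks 1) else 0) +
      (if length (Ks 0) = 2 then H (Ks 0 ! 0) (Ks 0 ! 1) (Ks 1) +
        eps (fst (Ks 0 ! 0) * fst (Ks 0 ! 1)) *\<^sub>C H (Ks 0 ! 1) (Ks 0 ! 0) (Ks 1) else 0))) w"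
  proof (rule shuf_cong)
    fix Ks assume s: "splits 2 w Ks"
    have mem: "a \<in> set w" if "a \<in> set (Ks 0)" for a using splits_set[OF s] that by blast
    consider "Ks 0 = []" | d v where "Ks 0 = [(d, v)]" | d v e v' where "Ks 0 = [(d, v), (e, v')]" |
      a b b' u where "Ks 0 = a # b # b' # u"
      by (cases "Ks 0"; cases "tl (Ks 0)"; cases "tl (tl (Ks 0))") auto
    then show "(if Ks 0 = [] then 0 else ?lo ((wdeg (Ks 0) + 1, ?q (Ks 0)) # Ks 1)) =
      (if length (Ks 0) = 1 then - D (hd (Ks 0)) (Ks 1) else 0) +
      ((if length (Ks 0) = 1 then T (hd (Ks 0)) (Ks 1) else 0) +
      (if length (Ks 0) = 2 then H (Ks 0 ! 0) (Ks 0 ! 1) (Ks 1) +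
        eps (fst (Ks 0 ! 0) * fst (Ks 0 ! 1)) *\<^sub>C H (Ks 0 ! 1) (Ks 0 ! 0) (Ks 1) else 0))"
    proof cases
      case 1
      then show ?thesis by simp
    next
      case 2
      have "?lo ((d + 1, (-1) *\<^sub>C dbar_End X E L v + 1 *\<^sub>C (- M_bracket \<theta> v)) # Ks 1) =
        (-1) *\<^sub>C D (d, v) (Ks 1) + 1 *\<^sub>C T (d, v) (Ks 1)"
        unfolding D_def T_def fst_conv snd_conv by (rule local_g_linear_Cons)
      moreover have "(-1) *\<^sub>C dbar_End X E L v + 1 *\<^sub>C (- M_bracket \<theta> v) = - M_diff X E L \<theta> v"
        by (simp add: M_diff_def)
      ultimately show ?thesis using 2 by (simp add: wdeg_def)
    next
      case 3
      have v: "v \<in> M (d + 1)" "v' \<in> M (e + 1)" using letters[OF mem] 3 by fastforce+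
      let ?m = "eps (d + 1) *\<^sub>C M_bracket (degree_zero v) v' + (eps (d * e) * eps (e + 1)) *\<^sub>C M_bracket (degree_zero v') v"
      have sgn: "eps (d + 1) * eps (d * e + d + e) = eps (d * e) * eps (e + 1)"
        unfolding eps_mult by (rule eps_eqI) simp
      have "?lo ((d + e + 1, eps (d + 1) *\<^sub>C M_bracket v v') # Ks 1) = ?lo ((d + e + 1, ?m) # Ks 1)"
      proof (rule local_g_cong)
        fix l K
        have "(eps (d + 1) *\<^sub>C M_bracket v v') c i j x K [\<xi>] = ?m c i j x K [\<xi>]"
          using sgn by (simp add: scaleC_fun_apply bracket_value[OF v] scaleC_add_right)
        then show "snd (((d + e + 1, eps (d + 1) *\<^sub>C M_bracket v v') # Ks 1) ! l) c i j x K [\<xi>] =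
          snd (((d + e + 1, ?m) # Ks 1) ! l) c i j x K [\<xi>]"
          by (cases l) simp_all
      qed simp
      also have "\<dots> = H (d, v) (e, v') (Ks 1) + eps (d * e) *\<^sub>C H (e, v') (d, v) (Ks 1)"
        unfolding H_def fst_conv snd_conv cvs.scale_scale by (rule local_g_linear_Cons)
      finally show ?thesis using 3 by (simp add: wdeg_def add_ac flip: eps_def)
    next
      case 4
      then show ?thesis by (simp add: local_g_zero_Cons)
    qed
  qed
  also have "\<dots> = - pick fst D w + (pick fst T w + pick fst (\<lambda>a. pick fst (\<lambda>b u. H a b u)) w)"
    unfolding shuf_add pick_pick
    by (simp add: pick_def shuf_minus[symmetric] if_distrib[of uminus] del: One_nat_def cong: if_cong)
  also have "pick fst T w + pick fst (\<lambda>a. pick fst (\<lambda>b u. H a b u)) w = pick fst (\<lambda>a u. 0) w"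
    unfolding pick_add[symmetric]
  proof (rule pick_cong)
    fix a u assume m: "mset w = add_mset a (mset u)"
    then have "a \<in> set w" "set u \<subseteq> set w"
      by (metis insert_iff set_mset_add_mset_insert set_mset_mset,
          metis set_mset_add_mset_insert set_mset_mset subset_insertI)
    then show "T a u + pick fst (\<lambda>b u. H a b u) u = 0"
      unfolding T_def H_def by (intro local_g_bracket_cancel letters) auto
  qed
  also have "pick fst D w = dbar_Sym X L (g_map E \<theta> k w) c j x vs \<xi>"
  proof -
    have "pick fst D w = (\<Sum>l<length w. eps (1 * ldeg fst (take l w)) *\<^sub>C
      ?lo (take l w @ (fst (w ! l) + 1, dbar_End X E L (snd (w ! l))) # drop (Suc l) w))"
      unfolding D_def
    proof (rule local_g_pick_move)
      fix a assume "a \<in> set w"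
      from letters[OF this] dbar_End_M[OF letters[OF this]]
      show "snd a \<in> V (fst a) \<and> fst (fst a + 1, dbar_End X E L (snd a)) = fst a + 1 \<and>
        snd (fst a + 1, dbar_End X E L (snd a)) \<in> V (fst a + 1)" by (simp add: shift_def)
    qed
    then show ?thesis unfolding dbar_g_map[OF w x] dbar_local_g[OF w x] by simp
  qed
  finally show ?thesis by simp
qed

text \<open>Away from the domain of a chart both sides vanish: the letters \<open>q (Ks 0)\<close> lie in \<open>M\<close> and hence are
  extended by zero.\<close>

lemma h_map_Linfty:
  assumes w: "w \<in> words V"
  shows "shuf fst 2 (\<lambda>Ks. if Ks 0 = [] then 0 else
      h_map E \<theta> ((wdeg (Ks 0) + 1, Linfty_of_dgla (M_diff X E L \<theta>) M_bracket (Ks 0)) # Ks 1)) w =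
    - Sym_diff X L (h_map E \<theta> w)"
proof (intro ext)
  fix k c j x vs \<xi>
  let ?q = "Linfty_of_dgla (M_diff X E L \<theta>) M_bracket"
  let ?u = "\<lambda>Ks. (wdeg (Ks 0) + 1, ?q (Ks 0)) # Ks 1"
  have word: "?u Ks \<in> words V" if s: "splits 2 w Ks" and ne: "Ks 0 \<noteq> []" for Ks
  proof -
    have "Ks 0 \<in> words V" using w splits_set[OF s, of 0] ne by (auto simp: words_iff)
    from Linfty_of_dgla_M[OF \<theta>_A this] show ?thesis
      using w splits_set[OF s, of 1] by (auto simp: words_iff)
  qed
  have "shuf fst 2 (\<lambda>Ks. if Ks 0 = [] then 0 else h_map E \<theta> (?u Ks)) w k c j x vs \<xi> =
    shuf fst 2 (\<lambda>Ks. (if Ks 0 = [] then 0 else h_map E \<theta> (?u Ks)) k c j x vs \<xi>) w"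
    by (rule shuf_linear[where h="\<lambda>F. F k c j x vs \<xi>"]) (simp_all add: scaleC_fun_apply)
  also have "\<dots> = shuf fst 2 (\<lambda>Ks. if Ks 0 = [] then 0 else h_map E \<theta> (?u Ks) k c j x vs \<xi>) w"
    by (rule shuf_cong) simp
  also have "\<dots> = - Sym_diff X L (h_map E \<theta> w) k c j x vs \<xi>"
  proof (cases "k \<in> {1..CARD('r)}")
    case False
    then have "h_map E \<theta> w' k = 0" for w' by (auto simp: h_map_def)
    then show ?thesis by (simp add: Sym_diff_def dbar_Sym_def cong: if_cong)
  next
    case k: True
    then have h: "h_map E \<theta> w' k = g_map E \<theta> k w'" for w' by (simp add: h_map_def)
    show ?thesis
    proof (cases "x \<in> dom_L X L c j")
      case True
      then have x: "x \<in> dom c (frame x) j" by (simp add: dom_L_frame)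
      have "shuf fst 2 (\<lambda>Ks. if Ks 0 = [] then 0 else h_map E \<theta> (?u Ks) k c j x vs \<xi>) w =
        shuf fst 2 (\<lambda>Ks. if Ks 0 = [] then 0 else local_g \<theta> k (frame x) (?u Ks) c j x vs \<xi>) w"
        by (rule shuf_cong) (simp only: h g_map_frame)
      then show ?thesis unfolding Sym_diff_def h local_g_Linfty[OF w x] .
    next
      case False
      then have x: "x \<notin> dom c (frame x) j" by (simp add: dom_L_frame)
      have "shuf fst 2 (\<lambda>Ks. if Ks 0 = [] then 0 else h_map E \<theta> (?u Ks) k c j x vs \<xi>) w = shuf fst 2 (\<lambda>_. 0) w"
        by (rule shuf_cong) (simp add: h g_map_frame local_g_out[OF word x] del: One_nat_def)
      then show ?thesis using False by (simp add: Sym_diff_def dbar_Sym_def)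
    qed
  qed
  finally show "shuf fst 2 (\<lambda>Ks. if Ks 0 = [] then 0 else h_map E \<theta> (?u Ks)) w k c j x vs \<xi> =
    (- Sym_diff X L (h_map E \<theta> w)) k c j x vs \<xi>" by simp
qed

end

theorem proposition7p6:
  fixes X :: "('x::t2_space, 'c, 'm::finite) atlas"
    and E :: "('x, 'i, 'r::finite) vbundle"
    and L :: "('x, 'j, 's::finite) vbundle"
    and \<theta> :: "('x, 'c, 'm, 'i, 'r, 'j, 's) End_form"
  assumes "compact_complex_manifold X"
    and "hitchin_pair X E L \<theta>"
  shows "Linfty_morphism
    (M_dgla X E L) (Linfty_of_dgla (M_diff X E L \<theta>) M_bracket)
    (shift (Sym_forms CARD('r) X L) (-1)) (Linfty_of_dgla (Sym_diff X L) (\<lambda>_ _. 0))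
    (h_map E \<theta>)"
proof -
  interpret hitchin X E L \<theta>
    using assms by unfold_locales (auto simp: hitchin_pair_def)
  show ?thesis
  proof (rule Linfty_morphism_abelianI)
    have "shift (shift (Sym_forms CARD('r) X L) (- 1)) 1 = Sym_forms CARD('r) X L"
      by (simp add: shift_def)
    then show "sym_maps V (shift (shift (Sym_forms CARD('r) X L) (- 1)) 1) 0 (h_map E \<theta>)"
      using h_map_sym_maps by simp
    show "cvs.subspace (shift (Sym_forms CARD('r) X L) (- 1) n)" for n
      unfolding shift_def by (rule subspace_Sym_forms)
    show "Linfty_of_dgla (M_diff X E L \<theta>) M_bracket w \<in> V (wdeg w + 1)" if "w \<in> words V" for w
      by (rule Linfty_of_dgla_M[OF \<theta>_A that])
    show "shuf fst 2 (\<lambda>Ks. if Ks 0 = [] then 0 else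
        h_map E \<theta> ((wdeg (Ks 0) + 1, Linfty_of_dgla (M_diff X E L \<theta>) M_bracket (Ks 0)) # Ks 1)) w =
      - Sym_diff X L (h_map E \<theta> w)" if "w \<in> words V" for w
      by (rule h_map_Linfty[OF that])
  qed
qed

end
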